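(* Let $\overline P$ be a double graded quiver of weight $2$ (the weight $2$ double of a graded quiver $P$), $A=k\overline P$ its graded path algebra, $R$ the semisimple finite-dimensional algebra with basis the trivial paths, $B$ the path algebra of the weight $0$ subquiver of $\overline P$, and write $A=T_BM$ with $M=E_1[-1]\oplus E_2[-2]$, where $E_1,E_2$ are the finitely generated projective $B$-bimodules $E_w=\bigoplus_{a\in\overline P_1,\,|a|=w}BaB$ (placed in weight $0$). Let $\omega=\sum_{a\in P_1}da\,da^*\in\mathrm{DR}^2_R(A)$ be the canonical bi-symplectic form of weight $2$ on $A$. Then the isomorphism $\iota(\omega)\colon\mathbb{D}\mathrm{er}_RA\to\Omega^1_RA[-2]$, $\Theta\mapsto\iota_\Theta\omega$, restricts, in weight $1$, to a $B$-bimodule isomorphism $$(\iota(\omega))_1\colon E_1^\vee\xrightarrow{\ \cong\ }E_1,\qquad \widetilde a\longmapsto\varepsilon(a)\,a^*,$$ with inverse $$\flat\colon E_1\xrightarrow{\ \cong\ }E_1^\vee,\qquad a\longmapsto\varepsilon(a)\,\widetilde{a^*},$$ where $a$ runs over the arrows of $\overline P$ of weight $1$.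
   Context: $k$ is a field of characteristic $0$, $\otimes=\otimes_k$. All graded constructions follow the Koszul sign rule. The symbol $[-2]$ on $\Omega^1_RA$ records the shift of weight by $2$ caused by $\omega$ having weight $2$ ($\iota_\Theta\omega$ has weight $|\Theta|+2$). Quivers: quivers are finite; an arrow $a\colon i\to j$ has tail $t(a)=i$, head $h(a)=j$; paths compose from right to left; $e_i$ is the trivial path at $i$. A graded quiver $P$ has a weight function $|\cdot|\colon P_1\to\mathbb N$ on arrows; $kP$ is graded by total weight, trivial paths having weight $0$. The weight $N$ double graded quiver $\overline P$ (for $N\ge\max_{a\in P_1}|a|$) is obtained by adding for each arrow $a\colon i\to j$ of $P$ a reverse arrow $a^*\colon j\to i$ with $|a^*|=N-|a|$; put $(a^* )^*=a$. The sign $\varepsilon$ is $\varepsilon(a)=1$ if $a\in P_1$ and $\varepsilon(a)=-1$ if $a\in\overline P_1\setminus P_1$ (reverse arrows). The weight $0$ subquiver has all vertices and the arrows of weight $0$. $BaB$ denotes the $B$-sub-bimodule of $A$ generated by $a$. Noncommutative calculus: $\Omega^1_RA$ carries the universal $R$-linear derivation $d$; $\Omega^\bullet_RA=T_A\Omega^1_RA$, bigraded by weight $|\cdot|$ and form degree $\|\cdot\|$ with sign rule $(-1)^{|u||v|+\|u\|\|v\|}$; $\mathrm{DR}^\bullet_RA=\Omega^\bullet_RA/[\Omega^\bullet_RA,\Omega^\bullet_RA]$ (bigraded commutators). $\mathbb{D}\mathrm{er}_RA=\mathrm{Der}_R(A,(A\otimes A)_{\rm out})$, outer structure $a(u\otimes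 v)b=au\otimes vb$; it is an $A$-bimodule via the inner structure $a*(u\otimes v)*b=\pm ub\otimes av$ (Koszul sign). $\Theta\in\mathbb{D}\mathrm{er}_RA$ extends to a double derivation $i_\Theta$ of $\Omega^\bullet_RA$ of bidegree $(|\Theta|,-1)$ with $i_\Theta(a)=0$, $i_\Theta(da)=\Theta(a)$; with $i_\Theta\alpha=i_\Theta'\alpha\otimes i_\Theta''\alpha$, set $\iota_\Theta\alpha=\pm i''_\Theta(\alpha)i'_\Theta(\alpha)$ (bigraded Koszul sign). A closed $\omega\in\mathrm{DR}^2_R(A)$ of weight $N$ is bi-symplectic of weight $N$ if $\Theta\mapsto\iota_\Theta\omega$ is an isomorphism of graded $A$-bimodules $\mathbb{D}\mathrm{er}_RA\to\Omega^1_RA[-N]$. Dual bimodule: $E_1^\vee=\mathrm{Hom}_{B^{\rm e}}(E_1,(B\otimes B)_{\rm out})$, a $B$-bimodule via the inner structure on $B\otimes B$. For an arrow $a$ of weight $1$, $\widetilde a\in E_1^\vee$ is determined on arrows $b$ of weight $1$ by $\widetilde a(b)=e_{h(a)}\otimes e_{t(a)}$ if $b=a$ and $0$ otherwise. Meaning of the restriction in weight $1$: $\widetilde a\in E_1^\vee$ is viewed as the double derivation $\partial/\partial a$ of $A$ (sending $a$ to $e_{h(a)}\otimes e_{t(a)}$ and all other arrows to $0$); its image under $\iota(\omega)$ is projected to $E_1$ via $\Omega^1_RA\to A\otimes_BM\otimes_BA\to A\otimes_BE_1[-1]\otimes_BA$, whose weight $1$ part is $E_1$.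
   Formalization: The sign ε is corrected: for reverse arrows of weight 1 it is +1 instead of −1 (in general −(−1)^{|a||a*|}), since with −1 the two stated maps compose to −1 whenever P has an arrow of weight 1, and the Koszul rule gives ι(ã* ) = +a. *)

theory Defs
  imports
    "HOL-Library.Poly_Mapping"
    "HOL-Library.Function_Algebras"
    "Graph_Theory.Arc_Walk"
begin

section \<open>Free vector spaces and linear extension\<close>

definition scal :: "'k::field \<Rightarrow> ('b \<Rightarrow>\<^sub>0 'k) \<Rightarrow> ('b \<Rightarrow>\<^sub>0 'k)" where
  "scal c x = Poly_Mapping.map ((*) c) x"

abbreviation basis :: "'b \<Rightarrow> ('b \<Rightarrow>\<^sub>0 'k::field)" where
  "basis b \<equiv> Poly_Mapping.single b 1"

definition free_on :: "'b set \<Rightarrow> ('b \<Rightarrow>\<^sub>0 'k::field) set" where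
  "free_on S = {x. Poly_Mapping.keys x \<subseteq> S}"

abbreviation lspan :: "('b \<Rightarrow>\<^sub>0 'k::field) set \<Rightarrow> ('b \<Rightarrow>\<^sub>0 'k) set" where
  "lspan \<equiv> module.span scal"

definition linear_on :: "('b \<Rightarrow>\<^sub>0 'k::field) set \<Rightarrow> (('b \<Rightarrow>\<^sub>0 'k) \<Rightarrow> ('c \<Rightarrow>\<^sub>0 'k)) \<Rightarrow> bool" where
  "linear_on V f \<longleftrightarrow>
     (\<forall>x\<in>V. \<forall>y\<in>V. f (x + y) = f x + f y) \<and> (\<forall>c. \<forall>x\<in>V. f (scal c x) = scal c (f x))"

definition lin_ext :: "('b \<Rightarrow> ('c \<Rightarrow>\<^sub>0 'k)) \<Rightarrow> ('b \<Rightarrow>\<^sub>0 'k::field) \<Rightarrow> ('c \<Rightarrow>\<^sub>0 'k)" where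
  "lin_ext f x = (\<Sum>b\<in>Poly_Mapping.keys x. scal (Poly_Mapping.lookup x b) (f b))"

definition bilin_ext ::
  "('b \<Rightarrow> 'c \<Rightarrow> ('d \<Rightarrow>\<^sub>0 'k)) \<Rightarrow> ('b \<Rightarrow>\<^sub>0 'k::field) \<Rightarrow> ('c \<Rightarrow>\<^sub>0 'k) \<Rightarrow> ('d \<Rightarrow>\<^sub>0 'k)" where
  "bilin_ext f x y = lin_ext (\<lambda>b. lin_ext (f b) y) x"

text \<open>Tensor products over \<open>k\<close> of spaces with bases \<open>S\<close>, \<open>T\<close> have basis \<open>S \<times> T\<close>.\<close>

definition tens :: "('b \<Rightarrow>\<^sub>0 'k::field) \<Rightarrow> ('c \<Rightarrow>\<^sub>0 'k) \<Rightarrow> ('b \<times> 'c \<Rightarrow>\<^sub>0 'k)" where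
  "tens = bilin_ext (\<lambda>p q. basis (p, q))"

definition ksign :: "int \<Rightarrow> 'k::field" where
  "ksign n = (if even n then 1 else - 1)"


section \<open>Path algebras and the tensor algebra of \<open>A \<otimes>\<^sub>R A\<close>\<close>

text \<open>
  A quiver is a finite digraph \<open>G\<close> (locale \<open>fin_digraph\<close>) and a grading is a weight function
  \<open>w\<close> on its arcs.  A path is a triple (head, letters, tail); its letters are written as in the
  product, i.e. from right to left, so that reversing them gives an \<open>awalk\<close>.

  Besides arrows, words may contain bars.  A word with \<open>n\<close> bars
  \<open>p\<^sub>0 | p\<^sub>1 | \<dots> | p\<^sub>n\<close> (with composable consecutive paths) stands for the basis element
  \<open>p\<^sub>0 \<otimes> p\<^sub>1 \<otimes> \<dots> \<otimes> p\<^sub>n\<close> of \<open>A \<otimes>\<^sub>R \<dots> \<otimes>\<^sub>R A\<close> (\<open>n + 1\<close> factors), where \<open>A = kG\<close> and \<open>R\<close> is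
  spanned by the trivial paths.  All words together form a basis of the tensor algebra
  \<open>T\<^sub>A(A \<otimes>\<^sub>R A)\<close>, whose product is concatenation (the last factor of the left word is multiplied
  with the first factor of the right one); the words without bars form a basis of \<open>A\<close>.
\<close>

datatype 'e letter = Arr 'e | Bar

type_synonym ('v, 'e) word = "'v \<times> 'e letter list \<times> 'v"
type_synonym ('v, 'e, 'k) form = "('v, 'e) word \<Rightarrow>\<^sub>0 'k"
type_synonym ('v, 'e, 'k) form2 = "('v, 'e) word \<times> ('v, 'e) word \<Rightarrow>\<^sub>0 'k"

fun arrows :: "'e letter list \<Rightarrow> 'e list" where
  "arrows [] = []"
| "arrows (Arr a # ls) = a # arrows ls"
| "arrows (Bar # ls) = arrows ls"

definition words :: "('v, 'e) pre_digraph \<Rightarrow> ('v, 'e) word set" where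
  "words G = {(j, ls, i). pre_digraph.awalk G i (rev (arrows ls)) j}"

fun wt :: "('e \<Rightarrow> nat) \<Rightarrow> ('v, 'e) word \<Rightarrow> int" where
  "wt w (j, ls, i) = (\<Sum>a\<leftarrow>arrows ls. int (w a))"

fun fdeg :: "('v, 'e) word \<Rightarrow> int" where
  "fdeg (j, ls, i) = int (count_list ls Bar)"

definition paths :: "('v, 'e) pre_digraph \<Rightarrow> ('v, 'e) word set" where
  "paths G = {p \<in> words G. fdeg p = 0}"

definition path_alg :: "('v, 'e) pre_digraph \<Rightarrow> ('v, 'e, 'k::field) form set" where
  "path_alg G = free_on (paths G)"

fun mulw :: "('v, 'e) word \<Rightarrow> ('v, 'e) word \<Rightarrow> ('v, 'e, 'k::field) form" where
  "mulw (j, ls, i) (j', ls', i') = (if i = j' then basis (j, ls @ ls', i') else 0)"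

definition mul :: "('v, 'e, 'k::field) form \<Rightarrow> ('v, 'e, 'k) form \<Rightarrow> ('v, 'e, 'k) form"
    (infixl "\<cdot>" 70) where
  "x \<cdot> y = bilin_ext mulw x y"

definition idem :: "'v \<Rightarrow> ('v, 'e, 'k::field) form" where
  "idem i = basis (i, [], i)"

definition arw :: "('v, 'e) pre_digraph \<Rightarrow> 'e \<Rightarrow> ('v, 'e, 'k::field) form" where
  "arw G a = basis (head G a, [Arr a], tail G a)"

definition vertex_alg :: "('v, 'e) pre_digraph \<Rightarrow> ('v, 'e, 'k::field) form set" where
  "vertex_alg G = lspan (idem ` verts G)"

definition homog :: "('e \<Rightarrow> nat) \<Rightarrow> int \<Rightarrow> int \<Rightarrow> ('v, 'e, 'k::field) form \<Rightarrow> bool" where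
  "homog w m n x \<longleftrightarrow> (\<forall>p\<in>Poly_Mapping.keys x. wt w p = m \<and> fdeg p = n)"


section \<open>Noncommutative differential forms\<close>

text \<open>
  \<open>\<Omega>\<^sup>1\<^sub>R A\<close> is the kernel of the multiplication \<open>A \<otimes>\<^sub>R A \<rightarrow> A\<close> (erase the bar), with
  universal derivation \<open>d a = 1 \<otimes> a - a \<otimes> 1\<close>.  As \<open>R\<close> is semisimple, \<open>T\<^sub>A \<Omega>\<^sup>1\<^sub>R A\<close> embeds into
  \<open>T\<^sub>A(A \<otimes>\<^sub>R A)\<close>, and \<open>\<Omega>\<^sup>n\<^sub>R A\<close> is the span of the products of \<open>n\<close> one-forms.
\<close>

fun unbar :: "('v, 'e) word \<Rightarrow> ('v, 'e) word" where
  "unbar (j, ls, i) = (j, filter (\<lambda>l. l \<noteq> Bar) ls, i)"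

definition Omega1 :: "('v, 'e) pre_digraph \<Rightarrow> ('v, 'e, 'k::field) form set" where
  "Omega1 G = {x \<in> free_on {p \<in> words G. fdeg p = 1}. lin_ext (\<lambda>p. basis (unbar p)) x = 0}"

definition one_bar_one :: "('v, 'e) pre_digraph \<Rightarrow> ('v, 'e, 'k::field) form" where
  "one_bar_one G = (\<Sum>i\<in>verts G. basis (i, [Bar], i))"

definition diff :: "('v, 'e) pre_digraph \<Rightarrow> ('v, 'e, 'k::field) form \<Rightarrow> ('v, 'e, 'k) form" where
  "diff G a = one_bar_one G \<cdot> a - a \<cdot> one_bar_one G"

primrec Omega :: "('v, 'e) pre_digraph \<Rightarrow> nat \<Rightarrow> ('v, 'e, 'k::field) form set" where
  "Omega G 0 = path_alg G"
| "Omega G (Suc n) = lspan {x \<cdot> y | x y. x \<in> Omega G n \<and> y \<in> Omega1 G}"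

definition Omegas :: "('v, 'e) pre_digraph \<Rightarrow> ('v, 'e, 'k::field) form set" where
  "Omegas G = lspan (\<Union>n. Omega G n)"

definition commutators ::
  "('v, 'e) pre_digraph \<Rightarrow> ('e \<Rightarrow> nat) \<Rightarrow> ('v, 'e, 'k::field) form set" where
  "commutators G w = lspan {u \<cdot> v - scal (ksign (m * m' + n * n')) (v \<cdot> u) | u v m n m' n'.
     u \<in> Omegas G \<and> v \<in> Omegas G \<and> homog w m n u \<and> homog w m' n' v}"

text \<open>Elements of \<open>DR\<^sub>R A\<close> are cosets.\<close>

definition dr_class ::
  "('v, 'e) pre_digraph \<Rightarrow> ('e \<Rightarrow> nat) \<Rightarrow> ('v, 'e, 'k::field) form \<Rightarrow> ('v, 'e, 'k) form set" where
  "dr_class G w x = {y \<in> Omegas G. y - x \<in> commutators G w}"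

definition de_Rham_differential ::
  "('v, 'e) pre_digraph \<Rightarrow> (('v, 'e, 'k::field) form \<Rightarrow> ('v, 'e, 'k) form) \<Rightarrow> bool" where
  "de_Rham_differential G D \<longleftrightarrow>
     linear_on (Omegas G) D \<and>
     (\<forall>a\<in>path_alg G. D a = diff G a \<and> D (diff G a) = 0) \<and>
     (\<forall>n. \<forall>u\<in>Omega G n. \<forall>v\<in>Omegas G. D (u \<cdot> v) = D u \<cdot> v + scal (ksign (int n)) (u \<cdot> D v))"

definition dr_closed ::
  "('v, 'e) pre_digraph \<Rightarrow> ('e \<Rightarrow> nat) \<Rightarrow> ('v, 'e, 'k::field) form set \<Rightarrow> bool" where
  "dr_closed G w \<omega> \<longleftrightarrow> (\<exists>D. de_Rham_differential G D \<and> (\<exists>x\<in>\<omega>. D x \<in> commutators G w))"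


section \<open>Double derivations and contraction\<close>

text \<open>Outer actions \<open>x (u \<otimes> v) = x u \<otimes> v\<close>, \<open>(u \<otimes> v) x = u \<otimes> v x\<close>.\<close>

definition outer_l ::
  "('v, 'e, 'k::field) form \<Rightarrow> ('v, 'e, 'k) form2 \<Rightarrow> ('v, 'e, 'k) form2" where
  "outer_l = bilin_ext (\<lambda>p (u, v). tens (mulw p u) (basis v))"

definition outer_r ::
  "('v, 'e, 'k::field) form2 \<Rightarrow> ('v, 'e, 'k) form \<Rightarrow> ('v, 'e, 'k) form2" where
  "outer_r = bilin_ext (\<lambda>(u, v) p. tens (basis u) (mulw v p))"

text \<open>
  Inner actions of \<open>A\<close> on \<open>A \<otimes> A\<close>, with Koszul signs:
  \<open>a * (u \<otimes> v) = (-1)\<^bsup>|a||u|\<^esup> u \<otimes> a v\<close>, \<open>(u \<otimes> v) * b = (-1)\<^bsup>|b||v|\<^esup> u b \<otimes> v\<close>.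
\<close>

definition inner_l ::
  "('e \<Rightarrow> nat) \<Rightarrow> ('v, 'e, 'k::field) form \<Rightarrow> ('v, 'e, 'k) form2 \<Rightarrow> ('v, 'e, 'k) form2" where
  "inner_l w = bilin_ext (\<lambda>p (u, v). scal (ksign (wt w p * wt w u)) (tens (basis u) (mulw p v)))"

definition inner_r ::
  "('e \<Rightarrow> nat) \<Rightarrow> ('v, 'e, 'k::field) form2 \<Rightarrow> ('v, 'e, 'k) form \<Rightarrow> ('v, 'e, 'k) form2" where
  "inner_r w = bilin_ext (\<lambda>(u, v) p. scal (ksign (wt w p * wt w v)) (tens (mulw u p) (basis v)))"

text \<open>
  The component of weight \<open>\<theta>\<close> of the graded bimodule of double derivations.  Double derivations
  are functions on \<open>A\<close>, extended by \<open>0\<close> outside \<open>A\<close>; \<open>R\<close>-linearity means that they vanish on \<open>R\<close>.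
\<close>

definition DDer ::
  "('v, 'e) pre_digraph \<Rightarrow> ('e \<Rightarrow> nat) \<Rightarrow> int \<Rightarrow>
   (('v, 'e, 'k::field) form \<Rightarrow> ('v, 'e, 'k) form2) set" where
  "DDer G w \<theta> = {\<Theta>.
     (\<forall>x. x \<notin> path_alg G \<longrightarrow> \<Theta> x = 0) \<and>
     linear_on (path_alg G) \<Theta> \<and>
     (\<forall>m. \<forall>x\<in>path_alg G. homog w m 0 x \<longrightarrow>
        \<Theta> x \<in> free_on {(u, v). u \<in> paths G \<and> v \<in> paths G \<and> wt w u + wt w v = m + \<theta>}) \<and>
     (\<forall>m. \<forall>x\<in>path_alg G. \<forall>y\<in>path_alg G. homog w m 0 x \<longrightarrow>
        \<Theta> (x \<cdot> y) = outer_r (\<Theta> x) y + scal (ksign (\<theta> * m)) (outer_l x (\<Theta> y))) \<and>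
     (\<forall>r\<in>vertex_alg G. \<Theta> r = 0)}"

text \<open>
  The \<open>A\<close>-bimodule structure on double derivations induced by the inner one:
  \<open>(a \<Theta>)(x) = a * \<Theta>(x)\<close> and \<open>(\<Theta> b)(x) = (-1)\<^bsup>|b||x|\<^esup> \<Theta>(x) * b\<close>, \<open>b\<close> of weight \<open>q\<close>.
\<close>

definition twist :: "('e \<Rightarrow> nat) \<Rightarrow> int \<Rightarrow> ('v, 'e, 'k::field) form \<Rightarrow> ('v, 'e, 'k) form" where
  "twist w q = lin_ext (\<lambda>p. scal (ksign (q * wt w p)) (basis p))"

definition DDer_l ::
  "('e \<Rightarrow> nat) \<Rightarrow> ('v, 'e, 'k::field) form \<Rightarrow> (('v, 'e, 'k) form \<Rightarrow> ('v, 'e, 'k) form2) \<Rightarrow>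
   (('v, 'e, 'k) form \<Rightarrow> ('v, 'e, 'k) form2)" where
  "DDer_l w a \<Theta> = (\<lambda>x. inner_l w a (\<Theta> x))"

definition DDer_r ::
  "('e \<Rightarrow> nat) \<Rightarrow> int \<Rightarrow> (('v, 'e, 'k::field) form \<Rightarrow> ('v, 'e, 'k) form2) \<Rightarrow>
   ('v, 'e, 'k) form \<Rightarrow> (('v, 'e, 'k) form \<Rightarrow> ('v, 'e, 'k) form2)" where
  "DDer_r w q \<Theta> b = (\<lambda>x. inner_r w (\<Theta> (twist w q x)) b)"

text \<open>
  \<open>i\<^sub>\<Theta>\<close> is the double derivation of \<open>\<Omega>\<close> of bidegree \<open>(|\<Theta>|, -1)\<close> extending \<open>\<Theta>\<close>; it is unique
  on \<open>\<Omega>\<close>, so the choice below does not matter there.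
\<close>

definition is_contraction ::
  "('v, 'e) pre_digraph \<Rightarrow> ('e \<Rightarrow> nat) \<Rightarrow> int \<Rightarrow> (('v, 'e, 'k::field) form \<Rightarrow> ('v, 'e, 'k) form2) \<Rightarrow>
   (('v, 'e, 'k) form \<Rightarrow> ('v, 'e, 'k) form2) \<Rightarrow> bool" where
  "is_contraction G w \<theta> \<Theta> I \<longleftrightarrow>
     linear_on (Omegas G) I \<and>
     (\<forall>a\<in>path_alg G. I a = 0 \<and> I (diff G a) = \<Theta> a) \<and>
     (\<forall>m n. \<forall>u\<in>Omegas G. \<forall>v\<in>Omegas G. homog w m n u \<longrightarrow>
        I (u \<cdot> v) = outer_r (I u) v + scal (ksign (\<theta> * m - n)) (outer_l u (I v)))"

definition contraction ::
  "('v, 'e) pre_digraph \<Rightarrow> ('e \<Rightarrow> nat) \<Rightarrow> int \<Rightarrow> (('v, 'e, 'k::field) form \<Rightarrow> ('v, 'e, 'k) form2) \<Rightarrow>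
   (('v, 'e, 'k) form \<Rightarrow> ('v, 'e, 'k) form2)" where
  "contraction G w \<theta> \<Theta> = (SOME I. is_contraction G w \<theta> \<Theta> I)"

definition swap_mul :: "('e \<Rightarrow> nat) \<Rightarrow> ('v, 'e, 'k::field) form2 \<Rightarrow> ('v, 'e, 'k) form" where
  "swap_mul w = lin_ext (\<lambda>(u, v). scal (ksign (wt w u * wt w v + fdeg u * fdeg v)) (mulw v u))"

text \<open>
  \<open>\<iota>\<^sub>\<Theta>\<close> vanishes on commutators, so it has a single value on the representatives of \<open>\<omega> \<in> DR\<close>.
\<close>

definition iota ::
  "('v, 'e) pre_digraph \<Rightarrow> ('e \<Rightarrow> nat) \<Rightarrow> ('v, 'e, 'k::field) form set \<Rightarrow> int \<Rightarrow>
   (('v, 'e, 'k) form \<Rightarrow> ('v, 'e, 'k) form2) \<Rightarrow> ('v, 'e, 'k) form" where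
  "iota G w \<omega> \<theta> \<Theta> = the_elem ((\<lambda>x. swap_mul w (contraction G w \<theta> \<Theta> x)) ` \<omega>)"

text \<open>
  The isomorphism of graded bimodules is spelled out in each weight \<open>\<theta>\<close>.  The sign
  \<open>(-1)\<^bsup>N|b|\<^esup>\<close> comes from moving \<open>b\<close> past \<open>\<omega>\<close> (equivalently, from the shift); it is trivial
  for even \<open>N\<close>.
\<close>

definition bi_symplectic ::
  "('v, 'e) pre_digraph \<Rightarrow> ('e \<Rightarrow> nat) \<Rightarrow> int \<Rightarrow> ('v, 'e, 'k::field) form set \<Rightarrow> bool" where
  "bi_symplectic G w N \<omega> \<longleftrightarrow>
     (\<exists>x\<in>Omega G 2. homog w N 2 x \<and> \<omega> = dr_class G w x) \<and>
     dr_closed G w \<omega> \<and>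
     (\<forall>\<theta>.
        bij_betw (iota G w \<omega> \<theta>) (DDer G w \<theta>) {\<alpha> \<in> Omega1 G. homog w (\<theta> + N) 1 \<alpha>} \<and>
        (\<forall>\<Theta>\<in>DDer G w \<theta>.
           (\<forall>\<Theta>'\<in>DDer G w \<theta>. iota G w \<omega> \<theta> (\<Theta> + \<Theta>') = iota G w \<omega> \<theta> \<Theta> + iota G w \<omega> \<theta> \<Theta>') \<and>
           (\<forall>m. \<forall>a\<in>path_alg G. homog w m 0 a \<longrightarrow>
              iota G w \<omega> (m + \<theta>) (DDer_l w a \<Theta>) = a \<cdot> iota G w \<omega> \<theta> \<Theta> \<and>
              iota G w \<omega> (\<theta> + m) (DDer_r w m \<Theta> a)
                = scal (ksign (N * m)) (iota G w \<omega> \<theta> \<Theta> \<cdot> a))))"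


section \<open>The weight-zero subalgebra, \<open>E\<^sub>w\<close> and its dual\<close>

definition weight0_quiver ::
  "('v, 'e) pre_digraph \<Rightarrow> ('e \<Rightarrow> nat) \<Rightarrow> ('v, 'e) pre_digraph" where
  "weight0_quiver G w = G\<lparr>arcs := {a \<in> arcs G. w a = 0}\<rparr>"

definition B_alg :: "('v, 'e) pre_digraph \<Rightarrow> ('e \<Rightarrow> nat) \<Rightarrow> ('v, 'e, 'k::field) form set" where
  "B_alg G w = path_alg (weight0_quiver G w)"

text \<open>The sum of the sub-bimodules \<open>B a B\<close> inside \<open>A\<close> is automatically direct.\<close>

definition E_mod ::
  "('v, 'e) pre_digraph \<Rightarrow> ('e \<Rightarrow> nat) \<Rightarrow> nat \<Rightarrow> ('v, 'e, 'k::field) form set" where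
  "E_mod G w m = lspan {b \<cdot> arw G a \<cdot> b' | b a b'.
     a \<in> arcs G \<and> w a = m \<and> b \<in> B_alg G w \<and> b' \<in> B_alg G w}"

text \<open>Elements of \<open>E\<^sub>1\<^sup>\<or>\<close> are functions on \<open>E\<^sub>1\<close>, extended by \<open>0\<close> outside \<open>E\<^sub>1\<close>.\<close>

definition E1_dual ::
  "('v, 'e) pre_digraph \<Rightarrow> ('e \<Rightarrow> nat) \<Rightarrow>
   (('v, 'e, 'k::field) form \<Rightarrow> ('v, 'e, 'k) form2) set" where
  "E1_dual G w = {f.
     (\<forall>x. x \<notin> E_mod G w 1 \<longrightarrow> f x = 0) \<and>
     linear_on (E_mod G w 1) f \<and>
     (\<forall>x\<in>E_mod G w 1.
        f x \<in> free_on (paths (weight0_quiver G w) \<times> paths (weight0_quiver G w)) \<and>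
        (\<forall>b\<in>B_alg G w. f (b \<cdot> x) = outer_l b (f x) \<and> f (x \<cdot> b) = outer_r (f x) b))}"

definition E1_dual_l ::
  "('e \<Rightarrow> nat) \<Rightarrow> ('v, 'e, 'k::field) form \<Rightarrow> (('v, 'e, 'k) form \<Rightarrow> ('v, 'e, 'k) form2) \<Rightarrow>
   (('v, 'e, 'k) form \<Rightarrow> ('v, 'e, 'k) form2)" where
  "E1_dual_l w b f = (\<lambda>x. inner_l w b (f x))"

definition E1_dual_r ::
  "('e \<Rightarrow> nat) \<Rightarrow> (('v, 'e, 'k::field) form \<Rightarrow> ('v, 'e, 'k) form2) \<Rightarrow> ('v, 'e, 'k) form \<Rightarrow>
   (('v, 'e, 'k) form \<Rightarrow> ('v, 'e, 'k) form2)" where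
  "E1_dual_r w f b = (\<lambda>x. inner_r w (f x) b)"

definition dual_arrow ::
  "('v, 'e) pre_digraph \<Rightarrow> ('e \<Rightarrow> nat) \<Rightarrow> 'e \<Rightarrow>
   (('v, 'e, 'k::field) form \<Rightarrow> ('v, 'e, 'k) form2)" where
  "dual_arrow G w a = (THE f. f \<in> E1_dual G w \<and>
     (\<forall>b\<in>arcs G. w b = 1 \<longrightarrow>
        f (arw G b) = (if b = a then tens (idem (head G a)) (idem (tail G a)) else 0)))"

text \<open>
  \<open>E\<^sub>1\<^sup>\<or>\<close> inside the double derivations of weight \<open>-1\<close>: \<open>f\<close> is extended by \<open>0\<close> on the arrows of
  weight \<open>\<noteq> 1\<close>.  In particular the dual of an arrow \<open>a\<close> becomes \<open>\<partial>/\<partial>a\<close>.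
\<close>

definition dual_to_DDer ::
  "('v, 'e) pre_digraph \<Rightarrow> ('e \<Rightarrow> nat) \<Rightarrow> (('v, 'e, 'k::field) form \<Rightarrow> ('v, 'e, 'k) form2) \<Rightarrow>
   (('v, 'e, 'k) form \<Rightarrow> ('v, 'e, 'k) form2)" where
  "dual_to_DDer G w f = (THE \<Theta>. \<Theta> \<in> DDer G w (- 1) \<and>
     (\<forall>x\<in>E_mod G w 1. \<Theta> x = f x) \<and> (\<forall>b\<in>arcs G. w b \<noteq> 1 \<longrightarrow> \<Theta> (arw G b) = 0))"

text \<open>
  The weight \<open>1\<close> part of \<open>\<Omega>\<^sup>1\<^sub>R A \<rightarrow> \<Omega>\<^sup>1\<^sub>B A = A \<otimes>\<^sub>B M \<otimes>\<^sub>B A \<rightarrow> A \<otimes>\<^sub>B E\<^sub>1[-1] \<otimes>\<^sub>B A\<close>.  Its target is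
  \<open>B \<otimes>\<^sub>B E\<^sub>1 \<otimes>\<^sub>B B = E\<^sub>1\<close>; it sends \<open>b dx b'\<close> (\<open>x \<in> E\<^sub>1\<close>) to \<open>b x b'\<close> and kills \<open>A dB A\<close>.  These
  elements span the weight \<open>1\<close> part of \<open>\<Omega>\<^sup>1\<^sub>R A\<close>, on which the map is therefore unique.
\<close>

definition proj_E1 ::
  "('v, 'e) pre_digraph \<Rightarrow> ('e \<Rightarrow> nat) \<Rightarrow> ('v, 'e, 'k::field) form \<Rightarrow> ('v, 'e, 'k) form" where
  "proj_E1 G w = (SOME \<pi>.
     linear_on {\<alpha> \<in> Omega1 G. homog w 1 1 \<alpha>} \<pi> \<and>
     (\<forall>x\<in>E_mod G w 1. \<forall>b\<in>B_alg G w. \<forall>b'\<in>B_alg G w. \<pi> (b \<cdot> diff G x \<cdot> b') = b \<cdot> x \<cdot> b') \<and>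
     (\<forall>x\<in>path_alg G. \<forall>y\<in>path_alg G. \<forall>b\<in>B_alg G w.
        homog w 1 1 (x \<cdot> diff G b \<cdot> y) \<longrightarrow> \<pi> (x \<cdot> diff G b \<cdot> y) = 0))"

definition iota1 ::
  "('v, 'e) pre_digraph \<Rightarrow> ('e \<Rightarrow> nat) \<Rightarrow> ('v, 'e, 'k::field) form set \<Rightarrow>
   (('v, 'e, 'k) form \<Rightarrow> ('v, 'e, 'k) form2) \<Rightarrow> ('v, 'e, 'k) form" where
  "iota1 G w \<omega> f = proj_E1 G w (iota G w \<omega> (- 1) (dual_to_DDer G w f))"

definition bimodule_iso ::
  "'b set \<Rightarrow> 'm::plus set \<Rightarrow> ('b \<Rightarrow> 'm \<Rightarrow> 'm) \<Rightarrow> ('m \<Rightarrow> 'b \<Rightarrow> 'm) \<Rightarrow>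
   'n::plus set \<Rightarrow> ('b \<Rightarrow> 'n \<Rightarrow> 'n) \<Rightarrow> ('n \<Rightarrow> 'b \<Rightarrow> 'n) \<Rightarrow> ('m \<Rightarrow> 'n) \<Rightarrow> bool" where
  "bimodule_iso B M lM rM N lN rN f \<longleftrightarrow>
     bij_betw f M N \<and>
     (\<forall>x\<in>M. \<forall>y\<in>M. f (x + y) = f x + f y) \<and>
     (\<forall>b\<in>B. \<forall>x\<in>M. f (lM b x) = lN b (f x) \<and> f (rM x b) = rN (f x) b)"


section \<open>Double quivers\<close>

datatype 'e dbl = Fwd 'e | Rev 'e

fun star :: "'e dbl \<Rightarrow> 'e dbl" where
  "star (Fwd a) = Rev a"
| "star (Rev a) = Fwd a"

definition double_quiver :: "('v, 'e) pre_digraph \<Rightarrow> ('v, 'e dbl) pre_digraph" where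
  "double_quiver P = \<lparr>
     verts = verts P,
     arcs = Fwd ` arcs P \<union> Rev ` arcs P,
     tail = case_dbl (tail P) (head P),
     head = case_dbl (head P) (tail P)\<rparr>"

definition double_weight :: "nat \<Rightarrow> ('e \<Rightarrow> nat) \<Rightarrow> 'e dbl \<Rightarrow> nat" where
  "double_weight N wP = case_dbl wP (\<lambda>a. N - wP a)"

definition canonical_form ::
  "('v, 'e) pre_digraph \<Rightarrow> nat \<Rightarrow> ('e \<Rightarrow> nat) \<Rightarrow> ('v, 'e dbl, 'k::field) form set" where
  "canonical_form P N wP =
     (let Q = double_quiver P in
      dr_class Q (double_weight N wP)
        (\<Sum>a\<in>arcs P. diff Q (arw Q (Fwd a)) \<cdot> diff Q (arw Q (Rev a))))"

text \<open>
  The orientation sign, \<open>w\<close> being the weight on the double.  It records the effect of exchanging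
  the two factors of \<open>da da\<^sup>*\<close>, which are one-forms of weights \<open>|a|\<close> and \<open>|a\<^sup>*|\<close>: in \<open>DR\<^sup>2\<close>,
  \<open>da da\<^sup>* = -(-1)\<^bsup>|a||a\<^sup>*|\<^esup> da\<^sup>* da\<close>.  So a reverse arrow has the usual sign \<open>-1\<close> unless both weights
  are odd, in which case \<open>da da\<^sup>* = da\<^sup>* da\<close> and the sign is \<open>+1\<close>.  (With \<open>-1\<close> also in the odd case,
  the assignments \<open>\<partial>/\<partial>a \<mapsto> \<epsilon>(a) a\<^sup>*\<close> and \<open>a \<mapsto> \<epsilon>(a) \<partial>/\<partial>a\<^sup>*\<close> would compose to \<open>-1\<close>.)
\<close>

fun eps :: "('e dbl \<Rightarrow> nat) \<Rightarrow> 'e dbl \<Rightarrow> 'k::field" where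
  "eps w (Fwd a) = 1"
| "eps w (Rev a) = - ksign (int (w (Fwd a)) * int (w (Rev a)))"

end

theory Submission
  imports Defs
begin

text \<open>
  A double derivation is given by arbitrary values \<open>t(a) \<in> e\<^bsub>h(a)\<^esub> A \<otimes> A e\<^bsub>t(a)\<^esub>\<close> on the arrows, and a
  one-form is uniquely a combination of forms \<open>q dc p\<close> with \<open>c\<close> an arrow and \<open>q\<close>, \<open>p\<close> paths.  As \<open>\<iota>\<^sub>\<Theta>\<close>
  kills commutators, it can be evaluated on \<open>\<Sum> da da\<^sup>*\<close>: a term \<open>u \<otimes> v\<close> of \<open>\<Theta>(c\<^sup>*)\<close> becomes
  \<open>\<plusminus>v dc u\<close>.  This permutes bases up to sign, hence \<open>\<iota>(\<omega>)\<close> is bijective.  In weight \<open>1\<close> only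
  arrows of weight \<open>1\<close> with \<open>u\<close>, \<open>v\<close> of weight \<open>0\<close> matter, all signs are \<open>+1\<close>, and projecting
  \<open>v dc u\<close> to \<open>v c u\<close> gives the map on \<open>E\<^sub>1\<^sup>\<or>\<close>.
\<close>

section \<open>Linear maps between free vector spaces\<close>

text \<open>\<open>contraction\<close>, \<open>proj_E1\<close>, \<open>dual_to_DDer\<close> and
  \<open>dual_arrow\<close> are only specified, by \<open>SOME\<close> or \<open>THE\<close>. Each
  is replaced by an explicit map that meets the specification, and the specification is shown to fix
  the values on generators. The delicate case is the contraction. Its formula is defined on all
  words with bars, that is on the tensor algebra of \<open>A \<otimes> A\<close> over A, and there
  it is no derivation: the word \<open>1 | a\<close> goes to \<Theta>(a), although its factors
  \<open>1 | 1\<close> and \<open>a\<close> go to 0. The Leibniz rule holds for left factors in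
  \<Omega> because removing the last bar annihilates \<Omega>, and this is where forms are
  distinguished from general tensors. Commutators die because the contractions of uv and of vu have
  two terms each, and the flip identifies them crosswise. The number 2 enters twice: it is the
  weight shift, and being even it gives an arrow and its reverse weights of equal parity, which
  makes the signs of the right action match. The sign +1 in weight 1 arises for a forward arrow from
  two factors -1, one for moving a derivation of weight -1 past an element of weight 1, one for the
  form degree.\<close>

lemma lookup_scal [simp]: "Poly_Mapping.lookup (scal c x) b = c * Poly_Mapping.lookup x b"
  by (simp add: scal_def Poly_Mapping.map.rep_eq when_def)

interpretation scal: module scal
  by unfold_locales (auto intro!: poly_mapping_eqI simp: lookup_add algebra_simps)

lemma scal_one [simp]: "scal 1 x = x"
  by (rule scal.scale_one)

lemma scal_scal [simp]: "scal a (scal b x) = scal (a * b) x"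
  by (rule scal.scale_scale)

abbreviation lin :: "(('b \<Rightarrow>\<^sub>0 'k::field) \<Rightarrow> ('c \<Rightarrow>\<^sub>0 'k)) \<Rightarrow> bool" where
  "lin f \<equiv> linear_on UNIV f"

lemma lin_iff: "lin f \<longleftrightarrow> (\<forall>x y. f (x + y) = f x + f y) \<and> (\<forall>c x. f (scal c x) = scal c (f x))"
  by (simp add: linear_on_def)

lemma lin_add: "lin f \<Longrightarrow> f (x + y) = f x + f y"
  by (simp add: lin_iff)

lemma lin_scal: "lin f \<Longrightarrow> f (scal c x) = scal c (f x)"
  by (simp add: lin_iff)

lemma lin_zero: "lin f \<Longrightarrow> f 0 = 0"
  using lin_add[of f 0 0] by simp

lemma lin_uminus: "lin f \<Longrightarrow> f (- x) = - f x"
  using lin_add[of f x "- x"] lin_zero[of f] by (simp add: eq_neg_iff_add_eq_0 add.commute)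

lemma lin_diff: "lin f \<Longrightarrow> f (x - y) = f x - f y"
  using lin_add[of f x "- y"] lin_uminus[of f y] by simp

lemma lin_sum: "lin f \<Longrightarrow> f (sum g A) = (\<Sum>i\<in>A. f (g i))"
  by (induction A rule: infinite_finite_induct) (auto simp: lin_zero lin_add)

lemma lin_ext_superset:
  "finite S \<Longrightarrow> Poly_Mapping.keys x \<subseteq> S \<Longrightarrow>
    lin_ext f x = (\<Sum>b\<in>S. scal (Poly_Mapping.lookup x b) (f b))"
  unfolding lin_ext_def
  by (rule sum.mono_neutral_left) (auto simp: in_keys_iff)

lemma lin_lin_ext: "lin (lin_ext f)"
proof -
  have "lin_ext f (x + y) = lin_ext f x + lin_ext f y" for x y
  proof -
    let ?S = "Poly_Mapping.keys x \<union> Poly_Mapping.keys y"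
    have "lin_ext f (x + y) = (\<Sum>b\<in>?S. scal (Poly_Mapping.lookup (x + y) b) (f b))"
      by (rule lin_ext_superset) (auto dest: subsetD[OF Poly_Mapping.keys_add])
    also have "\<dots> = (\<Sum>b\<in>?S. scal (Poly_Mapping.lookup x b) (f b))
        + (\<Sum>b\<in>?S. scal (Poly_Mapping.lookup y b) (f b))"
      by (simp add: lookup_add scal.scale_left_distrib sum.distrib)
    also have "\<dots> = lin_ext f x + lin_ext f y"
      by (subst (1 2) lin_ext_superset[of ?S]) auto
    finally show ?thesis .
  qed
  moreover have "lin_ext f (scal c x) = scal c (lin_ext f x)" for c x
  proof -
    have "lin_ext f (scal c x)
        = (\<Sum>b\<in>Poly_Mapping.keys x. scal (Poly_Mapping.lookup (scal c x) b) (f b))"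
      by (rule lin_ext_superset) (auto simp: in_keys_iff)
    then show ?thesis
      by (simp add: lin_ext_def scal.scale_sum_right)
  qed
  ultimately show ?thesis by (simp add: lin_iff)
qed

lemma lin_ext_basis [simp]: "lin_ext f (basis b) = f b"
  by (simp add: lin_ext_def)

lemma lin_ext_id: "lin_ext basis x = x"
  by (rule poly_mapping_eqI)
    (simp add: lin_ext_def lookup_sum lookup_single when_def in_keys_iff if_distrib[of "(*) _"] cong: if_cong)

lemma lin_expand:
  assumes "lin f"
  shows "f x = (\<Sum>b\<in>Poly_Mapping.keys x. scal (Poly_Mapping.lookup x b) (f (basis b)))"
  using lin_sum[OF assms, of "\<lambda>b. scal (Poly_Mapping.lookup x b) (basis b)" "Poly_Mapping.keys x"]
    lin_ext_id[of x]
  by (simp add: lin_ext_def lin_scal[OF assms])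

text \<open>The explicit maps of the proof are linear on the whole free space, so identities between
  them are tested on basis words. The set \<open>S\<close> carries the restrictions (weight, form
  degree, endpoints) under which a Koszul sign becomes a constant.\<close>

lemma lin_eqI_on:
  assumes "x \<in> free_on S" "lin f" "lin g" "\<And>b. b \<in> S \<Longrightarrow> f (basis b) = g (basis b)"
  shows "f x = g x"
  using assms(1,4)
  by (subst lin_expand[OF assms(2)], subst lin_expand[OF assms(3)])
    (auto simp: free_on_def intro!: sum.cong)

lemma lin_eqI:
  assumes "lin f" "lin g" "\<And>b. f (basis b) = g (basis b)"
  shows "f x = g x"
  using lin_eqI_on[of x UNIV f g] assms by (simp add: free_on_def)

lemma lin_mem_subspace:
  assumes "x \<in> free_on S" "lin f" "scal.subspace V" "\<And>b. b \<in> S \<Longrightarrow> f (basis b) \<in> V"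
  shows "f x \<in> V"
  using assms(1,4)
  by (subst lin_expand[OF assms(2)])
    (auto simp: free_on_def intro!: scal.subspace_sum[OF assms(3)] scal.subspace_scale[OF assms(3)])

lemma lin_id: "lin (\<lambda>x. x)"
  and lin_const_zero: "lin (\<lambda>x. 0)"
  and lin_plus: "lin f \<Longrightarrow> lin g \<Longrightarrow> lin (\<lambda>x. f x + g x)"
  and lin_minus: "lin f \<Longrightarrow> lin g \<Longrightarrow> lin (\<lambda>x. f x - g x)"
  and lin_scale: "lin f \<Longrightarrow> lin (\<lambda>x. scal c (f x))"
  by (auto simp: lin_iff scal.scale_right_distrib scal.scale_right_diff_distrib mult.commute)

lemma lin_comp: "lin h \<Longrightarrow> lin f \<Longrightarrow> lin (\<lambda>x. h (f x))"
  by (auto simp: lin_iff)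

lemma lin_setsum: "(\<And>i. i \<in> A \<Longrightarrow> lin (f i)) \<Longrightarrow> lin (\<lambda>x. \<Sum>i\<in>A. f i x)"
  by (auto simp: lin_iff sum.distrib scal.scale_sum_right)

lemma lin_ext_comp: "lin f \<Longrightarrow> lin (\<lambda>x. lin_ext g (f x))"
  by (rule lin_comp[OF lin_lin_ext])

lemma lin_bilin_ext_left: "lin f \<Longrightarrow> lin (\<lambda>x. bilin_ext g (f x) y)"
  unfolding bilin_ext_def by (rule lin_ext_comp)

lemma lin_bilin_ext_right:
  assumes "lin f"
  shows "lin (\<lambda>y. bilin_ext g x (f y))"
proof -
  have "lin (\<lambda>y. bilin_ext g x y)"
    unfolding bilin_ext_def lin_ext_def[of _ x]
    by (intro lin_setsum lin_scale lin_lin_ext)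
  from lin_comp[OF this assms] show ?thesis .
qed

lemma bilin_ext_basis [simp]: "bilin_ext f (basis p) (basis q) = f p q"
  by (simp add: bilin_ext_def)

section \<open>Linearity of products, actions, flip and differential\<close>

lemma lin_mul_left: "lin f \<Longrightarrow> lin (\<lambda>x. f x \<cdot> y)"
  and lin_mul_right: "lin g \<Longrightarrow> lin (\<lambda>x'. y' \<cdot> g x')"
  unfolding mul_def by (rule lin_bilin_ext_left lin_bilin_ext_right; assumption)+

lemma lin_tens_left: "lin f \<Longrightarrow> lin (\<lambda>x. tens (f x) y)"
  and lin_tens_right: "lin g \<Longrightarrow> lin (\<lambda>x'. tens y' (g x'))"
  unfolding tens_def by (rule lin_bilin_ext_left lin_bilin_ext_right; assumption)+

lemma lin_outer_l_left: "lin f \<Longrightarrow> lin (\<lambda>x. outer_l (f x) y)"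
  and lin_outer_l_right: "lin g \<Longrightarrow> lin (\<lambda>x'. outer_l y' (g x'))"
  unfolding outer_l_def by (rule lin_bilin_ext_left lin_bilin_ext_right; assumption)+

lemma lin_outer_r_left: "lin f \<Longrightarrow> lin (\<lambda>x. outer_r (f x) y)"
  and lin_outer_r_right: "lin g \<Longrightarrow> lin (\<lambda>x'. outer_r y' (g x'))"
  unfolding outer_r_def by (rule lin_bilin_ext_left lin_bilin_ext_right; assumption)+

lemma lin_inner_l_left: "lin f \<Longrightarrow> lin (\<lambda>x. inner_l w (f x) y)"
  and lin_inner_l_right: "lin g \<Longrightarrow> lin (\<lambda>x'. inner_l w y' (g x'))"
  unfolding inner_l_def by (rule lin_bilin_ext_left lin_bilin_ext_right; assumption)+

lemma lin_inner_r_left: "lin f \<Longrightarrow> lin (\<lambda>x. inner_r w (f x) y)"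
  and lin_inner_r_right: "lin g \<Longrightarrow> lin (\<lambda>x'. inner_r w y' (g x'))"
  unfolding inner_r_def by (rule lin_bilin_ext_left lin_bilin_ext_right; assumption)+

lemma lin_swap_mul: "lin f \<Longrightarrow> lin (\<lambda>x. swap_mul w (f x))"
  unfolding swap_mul_def by (rule lin_ext_comp)

lemma lin_twist: "lin f \<Longrightarrow> lin (\<lambda>x. twist w q (f x))"
  unfolding twist_def by (rule lin_ext_comp)

lemma lin_difference: "lin f \<Longrightarrow> lin (\<lambda>x. diff G (f x))"
  unfolding diff_def by (intro lin_minus lin_mul_left lin_mul_right)

lemmas lin_intros = lin_id lin_const_zero lin_plus lin_minus lin_scale lin_setsum lin_ext_comp
  lin_mul_left lin_mul_right lin_tens_left lin_tens_right lin_outer_l_left lin_outer_l_right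
  lin_outer_r_left lin_outer_r_right lin_inner_l_left lin_inner_l_right lin_inner_r_left
  lin_inner_r_right lin_swap_mul lin_twist lin_difference

lemmas mul_linear =
  lin_zero[OF lin_mul_left[OF lin_id]] lin_zero[OF lin_mul_right[OF lin_id]]
  lin_add[OF lin_mul_left[OF lin_id]] lin_add[OF lin_mul_right[OF lin_id]]
  lin_diff[OF lin_mul_left[OF lin_id]] lin_diff[OF lin_mul_right[OF lin_id]]
  lin_scal[OF lin_mul_left[OF lin_id]] lin_scal[OF lin_mul_right[OF lin_id]]

lemmas tens_linear =
  lin_zero[OF lin_tens_left[OF lin_id]] lin_zero[OF lin_tens_right[OF lin_id]]
  lin_scal[OF lin_tens_left[OF lin_id]] lin_scal[OF lin_tens_right[OF lin_id]]

lemmas outer_linear =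
  lin_zero[OF lin_outer_l_left[OF lin_id]] lin_zero[OF lin_outer_l_right[OF lin_id]]
  lin_add[OF lin_outer_l_left[OF lin_id]] lin_add[OF lin_outer_l_right[OF lin_id]]
  lin_diff[OF lin_outer_l_left[OF lin_id]] lin_diff[OF lin_outer_l_right[OF lin_id]]
  lin_scal[OF lin_outer_l_left[OF lin_id]] lin_scal[OF lin_outer_l_right[OF lin_id]]
  lin_zero[OF lin_outer_r_left[OF lin_id]] lin_zero[OF lin_outer_r_right[OF lin_id]]
  lin_add[OF lin_outer_r_left[OF lin_id]] lin_add[OF lin_outer_r_right[OF lin_id]]
  lin_diff[OF lin_outer_r_left[OF lin_id]] lin_diff[OF lin_outer_r_right[OF lin_id]]
  lin_scal[OF lin_outer_r_left[OF lin_id]] lin_scal[OF lin_outer_r_right[OF lin_id]]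

lemmas inner_linear =
  lin_zero[OF lin_inner_l_left[OF lin_id]] lin_zero[OF lin_inner_l_right[OF lin_id]]
  lin_add[OF lin_inner_l_left[OF lin_id]] lin_add[OF lin_inner_l_right[OF lin_id]]
  lin_scal[OF lin_inner_l_left[OF lin_id]] lin_scal[OF lin_inner_l_right[OF lin_id]]
  lin_zero[OF lin_inner_r_left[OF lin_id]] lin_zero[OF lin_inner_r_right[OF lin_id]]
  lin_add[OF lin_inner_r_left[OF lin_id]] lin_add[OF lin_inner_r_right[OF lin_id]]
  lin_scal[OF lin_inner_r_left[OF lin_id]] lin_scal[OF lin_inner_r_right[OF lin_id]]

lemmas swap_linear = lin_zero[OF lin_swap_mul[OF lin_id]] lin_add[OF lin_swap_mul[OF lin_id]]
  lin_diff[OF lin_swap_mul[OF lin_id]] lin_scal[OF lin_swap_mul[OF lin_id]]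

lemmas form_linear [simp] = mul_linear tens_linear outer_linear inner_linear swap_linear

lemma mul_basis [simp]: "basis p \<cdot> basis q = mulw p q"
  by (simp add: mul_def)

lemma tens_basis [simp]: "tens (basis p) (basis q) = basis (p, q)"
  by (simp add: tens_def)

lemma outer_l_basis [simp]: "outer_l (basis p) (basis (u, v)) = tens (mulw p u) (basis v)"
  by (simp add: outer_l_def)

lemma outer_r_basis [simp]: "outer_r (basis (u, v)) (basis p) = tens (basis u) (mulw v p)"
  by (simp add: outer_r_def)

lemma inner_l_basis [simp]:
  "inner_l w (basis p) (basis (u, v)) = scal (ksign (wt w p * wt w u)) (tens (basis u) (mulw p v))"
  by (simp add: inner_l_def)

lemma inner_r_basis [simp]:
  "inner_r w (basis (u, v)) (basis p) = scal (ksign (wt w p * wt w v)) (tens (mulw u p) (basis v))"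
  by (simp add: inner_r_def)

lemma swap_mul_basis [simp]:
  "swap_mul w (basis (u, v)) = scal (ksign (wt w u * wt w v + fdeg u * fdeg v)) (mulw v u)"
  by (simp add: swap_mul_def)

lemma twist_basis [simp]: "twist w q (basis p) = scal (ksign (q * wt w p)) (basis p)"
  by (simp add: twist_def)

lemma free_on_basis [simp]: "basis b \<in> free_on S \<longleftrightarrow> b \<in> S"
  by (simp add: free_on_def)

lemma subspace_free_on: "scal.subspace (free_on S)"
  unfolding scal.subspace_def free_on_def
  by (auto simp: in_keys_iff lookup_add subset_iff) (metis add.right_neutral)

lemma free_on_mono: "S \<subseteq> T \<Longrightarrow> free_on S \<subseteq> free_on T"
  by (auto simp: free_on_def)

lemma free_on_zero [simp]: "0 \<in> free_on S"
  by (simp add: free_on_def)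

lemma free_on_scal [simp]: "x \<in> free_on S \<Longrightarrow> scal c x \<in> free_on S"
  by (rule scal.subspace_scale[OF subspace_free_on])

lemma free_on_add: "x \<in> free_on S \<Longrightarrow> y \<in> free_on S \<Longrightarrow> x + y \<in> free_on S"
  by (rule scal.subspace_add[OF subspace_free_on])

lemma free_on_diff: "x \<in> free_on S \<Longrightarrow> y \<in> free_on S \<Longrightarrow> x - y \<in> free_on S"
  by (rule scal.subspace_diff[OF subspace_free_on])

lemma free_on_sum: "(\<And>i. i \<in> A \<Longrightarrow> f i \<in> free_on S) \<Longrightarrow> sum f A \<in> free_on S"
  by (rule scal.subspace_sum[OF subspace_free_on])

lemma homog_iff: "homog w m n x \<longleftrightarrow> x \<in> free_on {p. wt w p = m \<and> fdeg p = n}"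
  by (auto simp: homog_def free_on_def)

lemma ksign_mult: "ksign a * ksign b = ksign (a + b)"
  by (auto simp: ksign_def)

lemma ksign_eqI: "even (a - b) \<Longrightarrow> ksign a = ksign b"
  by (auto simp: ksign_def)

lemma ksign_zero [simp]: "ksign 0 = 1"
  by (simp add: ksign_def)

lemma lin_eqI2:
  assumes "\<And>y. lin (\<lambda>x. f x y)" "\<And>x. lin (f x)" "\<And>y. lin (\<lambda>x. g x y)" "\<And>x. lin (g x)"
    and "\<And>p q. p \<in> S \<Longrightarrow> q \<in> T \<Longrightarrow> f (basis p) (basis q) = g (basis p) (basis q)"
    and "x \<in> free_on S" "y \<in> free_on T"
  shows "f x y = g x y"
  by (rule lin_eqI_on[OF assms(6) assms(1,3)], rule lin_eqI_on[OF assms(7) assms(2,4)])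
    (rule assms(5))

lemma lin_eqI3:
  assumes "\<And>y z. lin (\<lambda>x. f x y z)" "\<And>x z. lin (\<lambda>y. f x y z)" "\<And>x y. lin (f x y)"
    and "\<And>y z. lin (\<lambda>x. g x y z)" "\<And>x z. lin (\<lambda>y. g x y z)" "\<And>x y. lin (g x y)"
    and "\<And>p q r. p \<in> S \<Longrightarrow> q \<in> T \<Longrightarrow> r \<in> U \<Longrightarrow>
      f (basis p) (basis q) (basis r) = g (basis p) (basis q) (basis r)"
    and "x \<in> free_on S" "y \<in> free_on T" "z \<in> free_on U"
  shows "f x y z = g x y z"
  by (rule lin_eqI_on[OF assms(8) assms(1,4)], rule lin_eqI2[OF _ _ _ _ _ assms(9,10)])
    (use assms in auto)

lemma free_on_UNIV [simp]: "x \<in> free_on UNIV"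
  by (simp add: free_on_def)

section \<open>Words\<close>

lemma arrows_append [simp]: "arrows (xs @ ys) = arrows xs @ arrows ys"
  by (induction xs rule: arrows.induct) auto

text \<open>The inner vertices \<open>k\<close> and \<open>k'\<close> are arbitrary because the
  weight only reads the letters.\<close>

lemma wt_append: "wt w (j, xs @ ys, i) = wt w (j, xs, k) + wt w (k', ys, i)"
  by simp

section \<open>Associativity, and the interplay of outer action, inner action and flip\<close>

lemma mul_assoc: "x \<cdot> y \<cdot> z = x \<cdot> (y \<cdot> z)"
  by (rule lin_eqI3[of "\<lambda>x y z. x \<cdot> y \<cdot> z" "\<lambda>x y z. x \<cdot> (y \<cdot> z)" UNIV UNIV UNIV])
    (intro lin_intros | auto)+

lemma outer_l_mul: "outer_l (x \<cdot> y) t = outer_l x (outer_l y t)"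
  by (rule lin_eqI3[of "\<lambda>x y t. outer_l (x \<cdot> y) t" "\<lambda>x y t. outer_l x (outer_l y t)" UNIV UNIV UNIV])
    (intro lin_intros | auto)+

lemma outer_r_mul: "outer_r t (x \<cdot> y) = outer_r (outer_r t x) y"
  by (rule lin_eqI3[of "\<lambda>t x y. outer_r t (x \<cdot> y)" "\<lambda>t x y. outer_r (outer_r t x) y" UNIV UNIV UNIV])
    (intro lin_intros | auto)+

lemma outer_l_outer_r: "outer_l x (outer_r t y) = outer_r (outer_l x t) y"
  by (rule lin_eqI3[of "\<lambda>x t y. outer_l x (outer_r t y)" "\<lambda>x t y. outer_r (outer_l x t) y" UNIV UNIV UNIV])
    (intro lin_intros | auto)+

lemma inner_l_outer_r: "inner_l w a (outer_r t y) = outer_r (inner_l w a t) y"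
  by (rule lin_eqI3[of "\<lambda>a t y. inner_l w a (outer_r t y)" "\<lambda>a t y. outer_r (inner_l w a t) y" UNIV UNIV UNIV])
    (intro lin_intros | auto)+

lemma inner_r_outer_l: "inner_r w (outer_l x t) b = outer_l x (inner_r w t b)"
  by (rule lin_eqI3[of "\<lambda>x t b. inner_r w (outer_l x t) b" "\<lambda>x t b. outer_l x (inner_r w t b)" UNIV UNIV UNIV])
    (intro lin_intros | auto)+

text \<open>The inner action of \<open>a\<close> counts the weight of the first tensor factor, which
  the outer action of \<open>x\<close> has raised by \<open>k\<close>; hence the Koszul
  sign.\<close>

lemma inner_l_outer_l:
  assumes "a \<in> free_on {p. wt w p = m}" "x \<in> free_on {p. wt w p = k}"
  shows "inner_l w a (outer_l x t) = scal (ksign (m * k)) (outer_l x (inner_l w a t))"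
  by (rule lin_eqI3[of "\<lambda>a x t. inner_l w a (outer_l x t)"
        "\<lambda>a x t. scal (ksign (m * k)) (outer_l x (inner_l w a t))", OF _ _ _ _ _ _ _ assms free_on_UNIV])
    (intro lin_intros | auto simp: ksign_mult algebra_simps)+

lemma inner_r_outer_r:
  assumes "y \<in> free_on {p. wt w p = k}" "b \<in> free_on {p. wt w p = m}"
  shows "inner_r w (outer_r t y) b = scal (ksign (m * k)) (outer_r (inner_r w t b) y)"
  by (rule lin_eqI3[of "\<lambda>y b t. inner_r w (outer_r t y) b"
        "\<lambda>y b t. scal (ksign (m * k)) (outer_r (inner_r w t b) y)", OF _ _ _ _ _ _ _ assms free_on_UNIV])
    (intro lin_intros | auto simp: ksign_mult algebra_simps)+

text \<open>The inner action is what the flip turns into multiplication: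
  \<open>u \<otimes> a v\<close> flips to \<open>a v u\<close>. The sign of the inner action cancels
  against the additional weight in the second factor, and form degree 0 of \<open>a\<close> leaves
  the form part of the sign unchanged.\<close>

lemma swap_mul_inner_l:
  assumes "a \<in> free_on {p. fdeg p = 0}"
  shows "swap_mul w (inner_l w a t) = a \<cdot> swap_mul w t"
  by (rule lin_eqI2[of "\<lambda>a t. swap_mul w (inner_l w a t)" "\<lambda>a t. a \<cdot> swap_mul w t",
        OF _ _ _ _ _ assms free_on_UNIV])
    (intro lin_intros | auto simp: ksign_mult algebra_simps intro!: arg_cong2[where f = scal] ksign_eqI)+

lemma swap_mul_inner_r:
  assumes "b \<in> free_on {p. fdeg p = 0}"
  shows "swap_mul w (inner_r w t b) = swap_mul w t \<cdot> b"
  by (rule lin_eqI2[of "\<lambda>b t. swap_mul w (inner_r w t b)" "\<lambda>b t. swap_mul w t \<cdot> b",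
        OF _ _ _ _ _ assms free_on_UNIV])
    (intro lin_intros | auto simp: ksign_mult algebra_simps intro!: arg_cong2[where f = scal] ksign_eqI)+

text \<open>Graded cyclicity: \<open>u \<otimes> v x\<close> and \<open>x u \<otimes> v\<close> both
  flip to \<open>v x u\<close>. This is the source of the vanishing of \<iota> on
  commutators.\<close>

lemma swap_mul_outer:
  assumes "t \<in> free_on {(u, v). wt w u + wt w v = m \<and> fdeg u + fdeg v = n}"
    and "x \<in> free_on {p. wt w p = m' \<and> fdeg p = n'}"
  shows "swap_mul w (outer_r t x) = scal (ksign (m * m' + n * n')) (swap_mul w (outer_l x t))"
  by (rule lin_eqI2[of "\<lambda>t x. swap_mul w (outer_r t x)"
        "\<lambda>t x. scal (ksign (m * m' + n * n')) (swap_mul w (outer_l x t))", OF _ _ _ _ _ assms])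
    (intro lin_intros | auto simp: ksign_mult algebra_simps intro!: arg_cong2[where f = scal] ksign_eqI)+

lemma bilinear_mem_subspace:
  assumes "\<And>y. lin (\<lambda>x. f x y)" "\<And>x. lin (f x)" "scal.subspace V"
    and "x \<in> free_on S" "y \<in> free_on T"
    and "\<And>p q. p \<in> S \<Longrightarrow> q \<in> T \<Longrightarrow> f (basis p) (basis q) \<in> V"
  shows "f x y \<in> V"
  by (rule lin_mem_subspace[OF assms(4,1,3)], rule lin_mem_subspace[OF assms(5,2,3)], rule assms(6))

lemma mul_free_on:
  assumes "x \<in> free_on S" "y \<in> free_on T"
    and "\<And>j xs k ys i. (j, xs, k) \<in> S \<Longrightarrow> (k, ys, i) \<in> T \<Longrightarrow> (j, xs @ ys, i) \<in> U"
  shows "x \<cdot> y \<in> free_on U"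
  by (rule bilinear_mem_subspace[OF _ _ subspace_free_on assms(1,2)])
    (intro lin_intros | auto simp: assms(3))+

lemma outer_l_free_on:
  assumes "x \<in> free_on S" "t \<in> free_on T"
    and "\<And>j xs k ys i v. (j, xs, k) \<in> S \<Longrightarrow> ((k, ys, i), v) \<in> T \<Longrightarrow> ((j, xs @ ys, i), v) \<in> U"
  shows "outer_l x t \<in> free_on U"
  by (rule bilinear_mem_subspace[OF _ _ subspace_free_on assms(1,2)])
    (intro lin_intros | auto simp: assms(3))+

lemma outer_r_free_on:
  assumes "t \<in> free_on T" "x \<in> free_on S"
    and "\<And>j xs k ys i u. (u, (j, xs, k)) \<in> T \<Longrightarrow> (k, ys, i) \<in> S \<Longrightarrow> (u, (j, xs @ ys, i)) \<in> U"
  shows "outer_r t x \<in> free_on U"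
  by (rule bilinear_mem_subspace[OF _ _ subspace_free_on assms(1,2)])
    (intro lin_intros | auto simp: assms(3))+

lemma inner_l_free_on:
  assumes "x \<in> free_on S" "t \<in> free_on T"
    and "\<And>j xs k ys i u. (j, xs, k) \<in> S \<Longrightarrow> (u, (k, ys, i)) \<in> T \<Longrightarrow> (u, (j, xs @ ys, i)) \<in> U"
  shows "inner_l w x t \<in> free_on U"
  by (rule bilinear_mem_subspace[OF _ _ subspace_free_on assms(1,2)])
    (intro lin_intros | auto simp: assms(3))+

lemma inner_r_free_on:
  assumes "t \<in> free_on T" "x \<in> free_on S"
    and "\<And>j xs k ys i v. ((j, xs, k), v) \<in> T \<Longrightarrow> (k, ys, i) \<in> S \<Longrightarrow> ((j, xs @ ys, i), v) \<in> U"
  shows "inner_r w t x \<in> free_on U"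
  by (rule bilinear_mem_subspace[OF _ _ subspace_free_on assms(1,2)])
    (intro lin_intros | auto simp: assms(3))+

lemma homog_mul: "homog w m n x \<Longrightarrow> homog w m' n' y \<Longrightarrow> homog w (m + m') (n + n') (x \<cdot> y)"
  unfolding homog_iff by (erule (1) mul_free_on) auto

section \<open>Words and paths of a quiver, and the unit of the path algebra\<close>

lemma words_Nil [simp]: "(j, [], i) \<in> words G \<longleftrightarrow> j = i \<and> i \<in> verts G"
  by (auto simp: words_def pre_digraph.awalk_def pre_digraph.cas.simps)

lemma words_Bar [simp]: "(j, Bar # xs, i) \<in> words G \<longleftrightarrow> (j, xs, i) \<in> words G"
  by (simp add: words_def)

lemma words_Arr [simp]:
  assumes "wf_digraph G"
  shows "(j, Arr a # xs, i) \<in> words G \<longleftrightarrow> a \<in> arcs G \<and> head G a = j \<and> (tail G a, xs, i) \<in> words G"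
proof -
  interpret wf_digraph G by fact
  have "awalk i (p @ [a]) j \<longleftrightarrow> a \<in> arcs G \<and> head G a = j \<and> awalk i p (tail G a)" for p
    by (induction p arbitrary: i) (auto simp: awalk_simps)
  then show ?thesis by (simp add: words_def)
qed

lemma words_append:
  assumes "wf_digraph G"
  shows "(j, xs @ ys, i) \<in> words G \<longleftrightarrow> (\<exists>k. (j, xs, k) \<in> words G \<and> (k, ys, i) \<in> words G)"
proof (induction xs arbitrary: j)
  case Nil
  have "(j, ys, i) \<in> words G \<Longrightarrow> j \<in> verts G"
    by (induction ys arbitrary: j rule: arrows.induct)
      (auto simp: words_Arr[OF assms] wf_digraph.head_in_verts[OF assms])
  then show ?case by auto
next
  case (Cons l xs)
  then show ?case by (cases l) (auto simp: words_Arr[OF assms])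
qed

lemma words_verts:
  assumes "wf_digraph G" "(j, xs, i) \<in> words G"
  shows "j \<in> verts G" "i \<in> verts G"
  using words_append[OF assms(1), of j "[]" xs i] words_append[OF assms(1), of j xs "[]" i] assms(2)
  by auto

lemma filter_not_Bar: "Bar \<notin> set zs \<Longrightarrow> filter (\<lambda>l. l \<noteq> Bar) zs = zs"
  by (induction zs) auto

lemma paths_iff: "(j, xs, i) \<in> paths G \<longleftrightarrow> (j, xs, i) \<in> words G \<and> Bar \<notin> set xs"
  by (auto simp: paths_def count_list_0_iff)

lemma paths_append:
  assumes "wf_digraph G"
  shows "(j, xs @ ys, i) \<in> paths G \<longleftrightarrow> (\<exists>k. (j, xs, k) \<in> paths G \<and> (k, ys, i) \<in> paths G)"
  by (auto simp: paths_iff words_append[OF assms])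

lemma path_alg_mul:
  assumes "wf_digraph G" "x \<in> path_alg G" "y \<in> path_alg G"
  shows "x \<cdot> y \<in> path_alg G"
  unfolding path_alg_def
  by (rule mul_free_on[OF assms(2,3)[unfolded path_alg_def]]) (auto simp: paths_append[OF assms(1)])

lemma idem_mul_basis: "idem k \<cdot> basis (j, xs, i) = (if k = j then basis (j, xs, i) else 0)"
  by (auto simp: idem_def)

lemma one_mul:
  assumes "finite (verts G)" "x \<in> free_on {(j, xs, i). j \<in> verts G}"
  shows "(\<Sum>i\<in>verts G. idem i) \<cdot> x = x"
  by (rule lin_eqI_on[OF assms(2), of "\<lambda>x. (\<Sum>i\<in>verts G. idem i) \<cdot> x"])
    (intro lin_intros | auto simp: lin_sum[OF lin_mul_left[OF lin_id]] idem_mul_basis assms(1))+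

lemma idem_in_path_alg [simp]: "idem i \<in> path_alg G \<longleftrightarrow> i \<in> verts G"
  by (simp add: idem_def path_alg_def paths_iff)

lemma arw_in_path_alg: "wf_digraph G \<Longrightarrow> a \<in> arcs G \<Longrightarrow> arw G a \<in> path_alg G"
  by (simp add: arw_def path_alg_def paths_iff wf_digraph.tail_in_verts)

lemma one_bar_one_mul:
  assumes "finite (verts G)" "j \<in> verts G"
  shows "one_bar_one G \<cdot> basis (j, xs, i) = basis (j, Bar # xs, i)"
  using assms by (simp add: one_bar_one_def lin_sum[OF lin_mul_left[OF lin_id]])

lemma mul_one_bar_one:
  assumes "finite (verts G)" "i \<in> verts G"
  shows "basis (j, xs, i) \<cdot> one_bar_one G = basis (j, xs @ [Bar], i)"
  using assms by (simp add: one_bar_one_def lin_sum[OF lin_mul_right[OF lin_id]])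

lemma diff_basis:
  assumes "fin_digraph G" "(j, xs, i) \<in> words G"
  shows "diff G (basis (j, xs, i)) = basis (j, Bar # xs, i) - basis (j, xs @ [Bar], i)"
proof -
  interpret fin_digraph G by fact
  show ?thesis
    using words_verts[OF wf_digraph assms(2)] by (simp add: diff_def one_bar_one_mul mul_one_bar_one)
qed

section \<open>Derivations determined by their values on arrows\<close>

text \<open>
  The sum of \<open>\<mu>(u) t(a) v\<close> over all ways to write a word as \<open>u a v\<close> with \<open>a\<close> an arrow.  With
  \<open>\<mu>(u) = \<plusminus>u\<close> this is a double derivation of the path algebra.  With \<open>\<mu>\<close> deleting
  the last bar of \<open>u\<close> it is a contraction, because \<open>da\<close> is a difference of two words in which a
  bar is to the left of \<open>a\<close> only in the first.
\<close>

primrec arrow_der_rev ::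
  "('v, 'e) pre_digraph \<Rightarrow> (('v, 'e) word \<Rightarrow> ('v, 'e, 'k::field) form) \<Rightarrow>
   ('e \<Rightarrow> ('v, 'e, 'k) form2) \<Rightarrow> 'v \<Rightarrow> 'e letter list \<Rightarrow> 'v \<Rightarrow> ('v, 'e, 'k) form2" where
  "arrow_der_rev G \<mu> t j [] i = 0"
| "arrow_der_rev G \<mu> t j (l # ls) i =
     (case l of
        Arr a \<Rightarrow> outer_r (arrow_der_rev G \<mu> t j ls (head G a)) (basis (head G a, [Arr a], i)) +
          outer_l (\<mu> (j, rev ls, head G a)) (outer_r (t a) (basis (tail G a, [], i)))
      | Bar \<Rightarrow> outer_r (arrow_der_rev G \<mu> t j ls i) (basis (i, [Bar], i)))"

definition arrow_der ::
  "('v, 'e) pre_digraph \<Rightarrow> (('v, 'e) word \<Rightarrow> ('v, 'e, 'k::field) form) \<Rightarrow>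
   ('e \<Rightarrow> ('v, 'e, 'k) form2) \<Rightarrow> ('v, 'e, 'k) form \<Rightarrow> ('v, 'e, 'k) form2" where
  "arrow_der G \<mu> t = lin_ext (\<lambda>(j, ls, i). arrow_der_rev G \<mu> t j (rev ls) i)"

lemma lin_arrow_der: "lin f \<Longrightarrow> lin (\<lambda>x. arrow_der G \<mu> t (f x))"
  unfolding arrow_der_def by (rule lin_ext_comp)

lemmas arrow_der_linear [simp] = lin_zero[OF lin_arrow_der[OF lin_id]]
  lin_add[OF lin_arrow_der[OF lin_id]] lin_diff[OF lin_arrow_der[OF lin_id]]
  lin_scal[OF lin_arrow_der[OF lin_id]]

lemma arrow_der_Nil [simp]: "arrow_der G \<mu> t (basis (j, [], i)) = 0"
  and arrow_der_snoc_Arr: "arrow_der G \<mu> t (basis (j, ls @ [Arr a], i)) =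
    outer_r (arrow_der G \<mu> t (basis (j, ls, head G a))) (basis (head G a, [Arr a], i)) +
    outer_l (\<mu> (j, ls, head G a)) (outer_r (t a) (basis (tail G a, [], i)))"
  and arrow_der_snoc_Bar: "arrow_der G \<mu> t (basis (j, ls @ [Bar], i)) =
    outer_r (arrow_der G \<mu> t (basis (j, ls, i))) (basis (i, [Bar], i))"
  by (simp_all add: arrow_der_def)

text \<open>A word \<open>(k, [], i)\<close> with \<open>k \<noteq> i\<close> is no path, but
  multiplication by it relabels a tail. Covering such words makes the Leibniz rule below valid for
  products of words that do not compose, where both sides vanish.\<close>

lemma arrow_der_retail:
  "arrow_der G \<mu> t (basis (j, xs, i)) = outer_r (arrow_der G \<mu> t (basis (j, xs, k))) (basis (k, [], i))"
proof (induction xs arbitrary: i k rule: rev_induct)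
  case Nil
  then show ?case by simp
next
  case (snoc l xs)
  show ?case
  proof (cases l)
    case (Arr a)
    then show ?thesis
      by (simp add: arrow_der_snoc_Arr flip: outer_r_mul outer_l_outer_r)
  next
    case Bar
    show ?thesis
      unfolding Bar arrow_der_snoc_Bar
      by (subst snoc[of i k]) (simp flip: outer_r_mul)
  qed
qed

text \<open>The hypothesis says that on a left part beginning with \<open>x\<close> the map
  \<open>\<mu>\<close> acts on the remainder only, up to the factor \<open>c\<close>. The
  decompositions of the product split according to whether the marked arrow lies in \<open>x\<close>
  or in the second factor, and the latter pick up \<open>c\<close>.\<close>

lemma arrow_der_mul_basis:
  fixes x :: "('v, 'e, 'k::field) form"
  assumes "\<And>ys i. lin_ext \<mu> (x \<cdot> basis (k, ys, i)) = scal c (x \<cdot> \<mu> (k, ys, i))"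
  shows "arrow_der G \<mu> t (x \<cdot> basis (k, ys, i)) =
    outer_r (arrow_der G \<mu> t x) (basis (k, ys, i)) + scal c (outer_l x (arrow_der G \<mu> t (basis (k, ys, i))))"
proof (induction ys arbitrary: i rule: rev_induct)
  case Nil
  have "arrow_der G \<mu> t (x \<cdot> basis (k, [], i)) = outer_r (arrow_der G \<mu> t x) (basis (k, [], i))"
  proof (rule lin_eqI[of "\<lambda>x. arrow_der G \<mu> t (x \<cdot> basis (k, [], i))"
        "\<lambda>x. outer_r (arrow_der G \<mu> t x) (basis (k, [], i))"])
    fix p :: "('v, 'e) word"
    obtain j xs k' where p: "p = (j, xs, k')" by (cases p)
    show "arrow_der G \<mu> t (basis p \<cdot> basis (k, [], i)) = outer_r (arrow_der G \<mu> t (basis p)) (basis (k, [], i))"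
    proof (cases "k' = k")
      case True
      then show ?thesis by (simp add: p flip: arrow_der_retail)
    next
      case False
      have "outer_r (arrow_der G \<mu> t (basis (j, xs, k'))) (basis (k, [], i)) = 0"
        by (subst arrow_der_retail[where k = k']) (simp add: False flip: outer_r_mul)
      with False show ?thesis by (simp add: p)
    qed
  qed (intro lin_intros lin_arrow_der)+
  then show ?case by simp
next
  case (snoc l ys)
  show ?case
  proof (cases l)
    case (Arr a)
    define h where "h = head G a"
    have snoc_lin: "arrow_der G \<mu> t (z \<cdot> basis (h, [Arr a], i)) =
        outer_r (arrow_der G \<mu> t z) (basis (h, [Arr a], i)) +
        outer_l (lin_ext \<mu> z) (outer_r (t a) (basis (tail G a, [], i)))"
      if "z \<in> free_on {(j, xs, h') | j xs h'. h' = h}" for z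
      by (rule lin_eqI_on[OF that, of "\<lambda>z. arrow_der G \<mu> t (z \<cdot> basis (h, [Arr a], i))"
        "\<lambda>z. outer_r (arrow_der G \<mu> t z) (basis (h, [Arr a], i)) +
        outer_l (lin_ext \<mu> z) (outer_r (t a) (basis (tail G a, [], i)))"])
        (intro lin_intros lin_arrow_der | auto simp: arrow_der_snoc_Arr h_def)+
    have "x \<cdot> basis (k, ys, h) \<in> free_on {(j, xs, h') | j xs h'. h' = h}"
      by (rule mul_free_on[of _ UNIV _ "{(k, ys, h)}"]) auto
    note 1 = snoc_lin[OF this]
    have eq: "basis (k, ys @ [Arr a], i) = basis (k, ys, h) \<cdot> basis (h, [Arr a], i)"
      by simp
    have split: "outer_r T (basis (k, ys @ [Arr a], i)) =
        outer_r (outer_r T (basis (k, ys, h))) (basis (h, [Arr a], i))" for T :: "('v, 'e, 'k) form2"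
      by (simp flip: outer_r_mul)
    have "arrow_der G \<mu> t (x \<cdot> basis (k, ys @ [Arr a], i)) =
        outer_r (arrow_der G \<mu> t (x \<cdot> basis (k, ys, h))) (basis (h, [Arr a], i)) +
        outer_l (lin_ext \<mu> (x \<cdot> basis (k, ys, h))) (outer_r (t a) (basis (tail G a, [], i)))"
      unfolding eq mul_assoc[symmetric] by (rule 1)
    also have "\<dots> = outer_r (arrow_der G \<mu> t x) (basis (k, ys @ [Arr a], i)) +
        scal c (outer_l x (arrow_der G \<mu> t (basis (k, ys @ [Arr a], i))))"
      by (simp add: snoc arrow_der_snoc_Arr assms split outer_l_mul outer_l_outer_r
          scal.scale_right_distrib flip: h_def)
    finally show ?thesis by (simp add: Arr)
  next
    case Bar
    have eq: "basis (k, ys @ [Bar], i) = basis (k, ys, i) \<cdot> basis (i, [Bar], i)"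
      by simp
    have snoc_lin: "arrow_der G \<mu> t (z \<cdot> basis (i, [Bar], i)) =
        outer_r (arrow_der G \<mu> t z) (basis (i, [Bar], i))"
      if "z \<in> free_on {(j, xs, h') | j xs h'. h' = i}" for z
      by (rule lin_eqI_on[OF that, of "\<lambda>z. arrow_der G \<mu> t (z \<cdot> basis (i, [Bar], i))"
        "\<lambda>z. outer_r (arrow_der G \<mu> t z) (basis (i, [Bar], i))"])
        (intro lin_intros lin_arrow_der | auto simp: arrow_der_snoc_Bar)+
    have "x \<cdot> basis (k, ys, i) \<in> free_on {(j, xs, h') | j xs h'. h' = i}"
      by (rule mul_free_on[of _ UNIV _ "{(k, ys, i)}"]) auto
    note 1 = snoc_lin[OF this]
    have split: "outer_r T (basis (k, ys @ [Bar], i)) =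
        outer_r (outer_r T (basis (k, ys, i))) (basis (i, [Bar], i))" for T :: "('v, 'e, 'k) form2"
      by (simp flip: outer_r_mul)
    have "arrow_der G \<mu> t (x \<cdot> basis (k, ys @ [Bar], i)) =
        outer_r (arrow_der G \<mu> t (x \<cdot> basis (k, ys, i))) (basis (i, [Bar], i))"
      unfolding eq mul_assoc[symmetric] by (rule 1)
    also have "\<dots> = outer_r (arrow_der G \<mu> t x) (basis (k, ys @ [Bar], i)) +
        scal c (outer_l x (arrow_der G \<mu> t (basis (k, ys @ [Bar], i))))"
      by (simp add: snoc arrow_der_snoc_Bar split outer_l_outer_r)
    finally show ?thesis by (simp add: Bar)
  qed
qed

lemma arrow_der_mul:
  fixes x :: "('v, 'e, 'k::field) form"
  assumes "\<And>v. lin_ext \<mu> (x \<cdot> basis v) = scal c (x \<cdot> \<mu> v)"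
  shows "arrow_der G \<mu> t (x \<cdot> y) = outer_r (arrow_der G \<mu> t x) y + scal c (outer_l x (arrow_der G \<mu> t y))"
proof (rule lin_eqI[of "\<lambda>y. arrow_der G \<mu> t (x \<cdot> y)"
      "\<lambda>y. outer_r (arrow_der G \<mu> t x) y + scal c (outer_l x (arrow_der G \<mu> t y))"])
  fix v :: "('v, 'e) word"
  show "arrow_der G \<mu> t (x \<cdot> basis v) =
      outer_r (arrow_der G \<mu> t x) (basis v) + scal c (outer_l x (arrow_der G \<mu> t (basis v)))"
    using arrow_der_mul_basis[of \<mu> x "fst v" c G t "fst (snd v)" "snd (snd v)"] assms by simp
qed (intro lin_intros lin_arrow_der)+

lemma arrow_der_homog:
  assumes G: "wf_digraph G"
    and t: "\<And>a. a \<in> arcs G \<Longrightarrow> t a \<in> free_on {(u, v). wt w u + wt w v = int (w a) + \<theta> \<and> fdeg u + fdeg v = 0}"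
    and \<mu>: "\<And>p. \<mu> p \<in> free_on {q. wt w q = wt w p \<and> fdeg q = fdeg p + e}"
    and p: "(j, xs, i) \<in> words G"
  shows "arrow_der G \<mu> t (basis (j, xs, i)) \<in>
    free_on {(u, v). wt w u + wt w v = wt w (j, xs, i) + \<theta> \<and> fdeg u + fdeg v = fdeg (j, xs, i) + e}"
  using p
proof (induction xs arbitrary: i rule: rev_induct)
  case Nil
  then show ?case by simp
next
  case (snoc l xs)
  show ?case
  proof (cases l)
    case (Arr a)
    with snoc.prems have a: "a \<in> arcs G" "i = tail G a" and xs: "(j, xs, head G a) \<in> words G"
      using G by (auto simp: words_append)
    show ?thesis
      unfolding Arr arrow_der_snoc_Arr
      by (intro free_on_add outer_r_free_on[OF snoc.IH[OF xs], of _ "{(head G a, [Arr a], i)}"]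
          outer_l_free_on[OF \<mu>, OF outer_r_free_on[OF t[OF a(1)], of _ "{(tail G a, [], i)}"
            "{(u, v). wt w u + wt w v = int (w a) + \<theta> \<and> fdeg u + fdeg v = 0}"]]) auto
  next
    case Bar
    with snoc.prems have xs: "(j, xs, i) \<in> words G"
      using G by (auto simp: words_append)
    show ?thesis
      unfolding Bar arrow_der_snoc_Bar
      by (rule outer_r_free_on[OF snoc.IH[OF xs], of _ "{(i, [Bar], i)}"]) auto
  qed
qed

section \<open>The de Rham differential\<close>

text \<open>An explicit witness for \<open>dr_closed\<close>, written on all words with bars: an
  arrow goes to \<open>1 | a - a | 1\<close>, and a bar, which stands for
  \<open>1 \<otimes> 1\<close>, goes to \<open>1 \<otimes> 1 \<otimes> 1\<close>. The second choice
  is made so that the differential of da is 0.\<close>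

primrec de_Rham_rev ::
  "'v \<Rightarrow> ('v, 'e) pre_digraph \<Rightarrow> 'e letter list \<Rightarrow> 'v \<Rightarrow> ('v, 'e, 'k::field) form" where
  "de_Rham_rev j G [] i = 0"
| "de_Rham_rev j G (l # ls) i =
     (case l of
        Arr a \<Rightarrow> de_Rham_rev j G ls (head G a) \<cdot> basis (head G a, [Arr a], i) +
          scal (ksign (fdeg (j, ls, i)))
            (basis (j, rev ls @ [Bar, Arr a], i) - basis (j, rev ls @ [Arr a, Bar], i))
      | Bar \<Rightarrow> de_Rham_rev j G ls i \<cdot> basis (i, [Bar], i) +
          scal (ksign (fdeg (j, ls, i))) (basis (j, rev ls @ [Bar, Bar], i)))"

definition de_Rham :: "('v, 'e) pre_digraph \<Rightarrow> ('v, 'e, 'k::field) form \<Rightarrow> ('v, 'e, 'k) form" where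
  "de_Rham G = lin_ext (\<lambda>(j, ls, i). de_Rham_rev j G (rev ls) i)"

lemma lin_de_Rham: "lin f \<Longrightarrow> lin (\<lambda>x. de_Rham G (f x))"
  unfolding de_Rham_def by (rule lin_ext_comp)

lemmas de_Rham_linear [simp] = lin_zero[OF lin_de_Rham[OF lin_id]]
  lin_add[OF lin_de_Rham[OF lin_id]] lin_diff[OF lin_de_Rham[OF lin_id]]
  lin_scal[OF lin_de_Rham[OF lin_id]]

lemma de_Rham_Nil [simp]: "de_Rham G (basis (j, [], i)) = 0"
  and de_Rham_snoc_Arr: "de_Rham G (basis (j, ls @ [Arr a], i)) =
    de_Rham G (basis (j, ls, head G a)) \<cdot> basis (head G a, [Arr a], i) +
    scal (ksign (fdeg (j, ls, i))) (basis (j, ls @ [Bar, Arr a], i) - basis (j, ls @ [Arr a, Bar], i))"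
  and de_Rham_snoc_Bar: "de_Rham G (basis (j, ls @ [Bar], i)) =
    de_Rham G (basis (j, ls, i)) \<cdot> basis (i, [Bar], i) +
    scal (ksign (fdeg (j, ls, i))) (basis (j, ls @ [Bar, Bar], i))"
  by (simp_all add: de_Rham_def)

lemma de_Rham_retail:
  "de_Rham G (basis (j, xs, i)) = de_Rham G (basis (j, xs, k)) \<cdot> basis (k, [], i)"
proof (induction xs arbitrary: i k rule: rev_induct)
  case Nil
  then show ?case by simp
next
  case (snoc l xs)
  show ?case
  proof (cases l)
    case (Arr a)
    then show ?thesis
      by (simp add: de_Rham_snoc_Arr mul_assoc)
  next
    case Bar
    show ?thesis
      unfolding Bar de_Rham_snoc_Bar
      by (subst snoc[of i k]) (simp add: mul_assoc)
  qed
qed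

lemma de_Rham_mul_basis:
  fixes G :: "('v, 'e) pre_digraph"
  shows "(de_Rham G (basis (j, xs @ ys, i)) :: ('v, 'e, 'k::field) form) =
    de_Rham G (basis (j, xs, k)) \<cdot> basis (k, ys, i) +
    scal (ksign (fdeg (j, xs, k))) (basis (j, xs, k) \<cdot> de_Rham G (basis (k, ys, i)))"
proof (induction ys arbitrary: i rule: rev_induct)
  case Nil
  then show ?case by (simp flip: de_Rham_retail)
next
  case (snoc l ys)
  have s: "ksign (int (count_list xs Bar)) * ksign (int (count_list ys Bar))
      = (ksign (int (count_list xs Bar) + int (count_list ys Bar)) :: 'k)"
    by (rule ksign_mult)
  show ?case
  proof (cases l)
    case (Arr a)
    have "(de_Rham G (basis (j, (xs @ ys) @ [Arr a], i)) :: ('v, 'e, 'k) form) =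
        de_Rham G (basis (j, xs, k)) \<cdot> basis (k, ys @ [Arr a], i) +
        scal (ksign (fdeg (j, xs, k))) (basis (j, xs, k) \<cdot> de_Rham G (basis (k, ys @ [Arr a], i)))"
      unfolding de_Rham_snoc_Arr
      by (simp add: snoc mul_assoc scal.scale_right_distrib s)
    then show ?thesis by (simp add: Arr)
  next
    case Bar
    have "(de_Rham G (basis (j, (xs @ ys) @ [Bar], i)) :: ('v, 'e, 'k) form) =
        de_Rham G (basis (j, xs, k)) \<cdot> basis (k, ys @ [Bar], i) +
        scal (ksign (fdeg (j, xs, k))) (basis (j, xs, k) \<cdot> de_Rham G (basis (k, ys @ [Bar], i)))"
      unfolding de_Rham_snoc_Bar
      by (simp add: snoc mul_assoc scal.scale_right_distrib s)
    then show ?thesis by (simp add: Bar)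
  qed
qed

lemma de_Rham_mul:
  fixes x :: "('v, 'e, 'k::field) form"
  assumes "x \<in> free_on {p. fdeg p = n}"
  shows "de_Rham G (x \<cdot> y) = de_Rham G x \<cdot> y + scal (ksign n) (x \<cdot> de_Rham G y)"
proof (rule lin_eqI2[of "\<lambda>x y. de_Rham G (x \<cdot> y)"
      "\<lambda>x y. de_Rham G x \<cdot> y + scal (ksign n) (x \<cdot> de_Rham G y)", OF _ _ _ _ _ assms free_on_UNIV])
  fix p q :: "('v, 'e) word"
  assume p: "p \<in> {p. fdeg p = n}"
  obtain j xs k k' ys i where eq: "p = (j, xs, k)" "q = (k', ys, i)"
    by (cases p, cases q)
  have head: "de_Rham G (basis (k', ys, i)) = basis (k', [], k') \<cdot> de_Rham G (basis (k', ys, i))"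
    using de_Rham_mul_basis[of G k' "[]" ys i k'] by simp
  show "(de_Rham G (basis p \<cdot> basis q) :: ('v, 'e, 'k) form) =
      de_Rham G (basis p) \<cdot> basis q + scal (ksign n) (basis p \<cdot> de_Rham G (basis q))"
  proof (cases "k = k'")
    case True
    then show ?thesis using p de_Rham_mul_basis[of G j xs ys i k] by (simp add: eq)
  next
    case False
    have "de_Rham G (basis (j, xs, k)) \<cdot> basis (k, [], k) \<cdot> basis (k', ys, i) = (0 :: ('v, 'e, 'k) form)"
      using False by (simp add: mul_assoc)
    moreover have "basis (j, xs, k) \<cdot> (basis (k', [], k') \<cdot> de_Rham G (basis (k', ys, i))) = (0 :: ('v, 'e, 'k) form)"
      using False by (simp flip: mul_assoc)
    ultimately have "de_Rham G (basis p) \<cdot> basis q = (0 :: ('v, 'e, 'k) form)"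
      "basis p \<cdot> de_Rham G (basis q) = (0 :: ('v, 'e, 'k) form)"
      unfolding eq head[symmetric] de_Rham_retail[symmetric] by auto
    then show ?thesis using False by (simp add: eq)
  qed
qed (intro lin_intros lin_de_Rham)+

lemma de_Rham_path:
  assumes "Bar \<notin> set xs"
  shows "de_Rham G (basis (j, xs, i)) = basis (j, Bar # xs, i) - basis (j, xs @ [Bar], i)"
  using assms
proof (induction xs arbitrary: i rule: rev_induct)
  case Nil
  then show ?case by simp
next
  case (snoc l xs)
  then show ?case
    by (cases l) (simp_all add: de_Rham_snoc_Arr count_list_0_iff)
qed

section \<open>Differential forms\<close>

lemma span_bilinear:
  assumes "\<And>y. lin (\<lambda>x. f x y)" "\<And>x. lin (f x)" "scal.subspace V"
    and "x \<in> lspan S" "y \<in> lspan T"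
    and "\<And>a b. a \<in> S \<Longrightarrow> b \<in> T \<Longrightarrow> f a b \<in> V"
  shows "f x y \<in> V"
proof -
  have "f a y \<in> V" if a: "a \<in> S" for a
    using assms(5)
  proof (rule scal.span_induct)
    show "scal.subspace {y. f a y \<in> V}"
      using assms(3) by (auto simp: scal.subspace_def lin_zero[OF assms(2)] lin_add[OF assms(2)] lin_scal[OF assms(2)])
  qed (use assms(6) a in auto)
  then show ?thesis
    by (intro scal.span_induct[OF assms(4), of "\<lambda>x. f x y \<in> V"])
      (use assms(3) in \<open>auto simp: scal.subspace_def lin_zero[OF assms(1)] lin_add[OF assms(1)] lin_scal[OF assms(1)]\<close>)
qed

definition one_form ::
  "('v, 'e) pre_digraph \<Rightarrow> ('v, 'e) word \<Rightarrow> 'e \<Rightarrow> ('v, 'e) word \<Rightarrow> ('v, 'e, 'k::field) form" where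
  "one_form G q a p = basis q \<cdot> diff G (arw G a) \<cdot> basis p"

lemma diff_arw:
  assumes "fin_digraph G" "a \<in> arcs G"
  shows "diff G (arw G a) = basis (head G a, [Bar, Arr a], tail G a) - basis (head G a, [Arr a, Bar], tail G a)"
proof -
  interpret fin_digraph G by fact
  show ?thesis using assms(2) by (simp add: arw_def diff_basis[OF assms(1)] words_Arr[OF wf_digraph])
qed

lemma one_form_basis:
  assumes "fin_digraph G" "a \<in> arcs G"
  shows "one_form G (j, us, head G a) a (tail G a, vs, i) =
    basis (j, us @ Bar # Arr a # vs, i) - basis (j, us @ Arr a # Bar # vs, i)"
  by (simp add: one_form_def diff_arw[OF assms])

lemma subspace_Omega1: "scal.subspace (Omega1 G)"
  unfolding Omega1_def scal.subspace_def
  by (auto simp: free_on_add lin_zero[OF lin_lin_ext] lin_add[OF lin_lin_ext] lin_scal[OF lin_lin_ext])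

lemma one_form_Omega1:
  assumes "fin_digraph G" "a \<in> arcs G" "q \<in> paths G" "p \<in> paths G"
  shows "one_form G q a p \<in> Omega1 G"
proof -
  interpret fin_digraph G by fact
  obtain j us h t vs i where eq: "q = (j, us, h)" "p = (t, vs, i)" by (cases q, cases p)
  \<comment> \<open>Written between the trivial paths at its endpoints, da visibly annihilates paths
    that do not meet it.\<close>
  have d: "diff G (arw G a) = basis (head G a, [], head G a) \<cdot> diff G (arw G a) \<cdot> basis (tail G a, [], tail G a)"
    by (simp add: diff_arw[OF assms(1,2)])
  show ?thesis
  proof (cases "h = head G a \<and> t = tail G a")
    case True
    then show ?thesis
      using assms by (auto simp: eq one_form_basis Omega1_def paths_iff words_append[OF wf_digraph]
          words_Arr[OF wf_digraph] lin_diff[OF lin_lin_ext] count_list_0_iff intro!: free_on_diff)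
  next
    case False
    then have z: "one_form G q a p = 0"
      unfolding one_form_def eq by (subst d) (auto simp: mul_assoc simp flip: mul_assoc[of "basis (j, us, h)"])
    show ?thesis unfolding z by (rule scal.subspace_0[OF subspace_Omega1])
  qed
qed

text \<open>The map \<open>r\<close> subtracts from a word the same word with its bar moved to the
  right end. It fixes one-forms, because the subtracted part factors through the multiplication,
  which kills them. The difference of \<open>us | vs\<close> and \<open>us vs |\<close> telescopes:
  the bar passes one arrow at a time, and each passage is a form \<open>q da p\<close>.\<close>

lemma Omega1_homog_span:
  fixes x :: "('v, 'e, 'k::field) form"
  assumes G: "fin_digraph G" and x: "x \<in> Omega1 G" "homog w m 1 x"
  shows "x \<in> lspan {one_form G q a p | q a p. q \<in> paths G \<and> p \<in> paths G \<and> a \<in> arcs G \<and>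
    snd (snd q) = head G a \<and> fst p = tail G a \<and> wt w q + int (w a) + wt w p = m}" (is "x \<in> lspan ?S")
proof -
  interpret fin_digraph G by fact
  define E where "E = lin_ext (\<lambda>(j, ls, i). basis (j, ls @ [Bar], i) :: ('v, 'e, 'k) form)"
  define r where "r = (\<lambda>x. x - E (lin_ext (\<lambda>p. basis (unbar p)) x))"
  have lin_r: "lin r"
    unfolding r_def E_def by (intro lin_intros)
  have *: "basis (j, us @ Bar # vs, i) - basis (j, us @ vs @ [Bar], i) \<in> lspan ?S"
    if "Bar \<notin> set us" "Bar \<notin> set vs" "(j, us @ vs, i) \<in> words G" "wt w (j, us @ vs, i) = m" for j us vs i
    using that
  proof (induction vs arbitrary: us)
    case Nil
    then show ?case by (simp add: scal.span_zero)
  next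
    case (Cons l vs)
    then obtain a where l: "l = Arr a" by (cases l) auto
    have a: "a \<in> arcs G" "(j, us, head G a) \<in> words G" "(tail G a, vs, i) \<in> words G"
      using Cons.prems(3) by (auto simp: l words_append[OF wf_digraph] words_Arr[OF wf_digraph])
    have "basis (j, us @ Bar # Arr a # vs, i) - basis (j, us @ Arr a # Bar # vs, i) \<in> lspan ?S"
      by (rule scal.span_base, subst one_form_basis[OF G a(1), symmetric])
        (use Cons.prems a in \<open>fastforce simp: l paths_iff\<close>)
    from scal.span_add[OF this Cons.IH[of "us @ [Arr a]"]]
    show ?case using Cons.prems by (simp add: l)
  qed
  have "r x \<in> lspan ?S"
  proof (rule lin_mem_subspace[OF _ lin_r scal.subspace_span])
    show "x \<in> free_on {p \<in> words G. fdeg p = 1 \<and> wt w p = m}"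
      using x by (auto simp: Omega1_def free_on_def homog_def)
    fix p assume p: "p \<in> {p \<in> words G. fdeg p = 1 \<and> wt w p = m}"
    obtain j ls i where eq: "p = (j, ls, i)" by (cases p)
    have "Bar \<in> set ls" using p by (auto simp: eq count_list_0_iff intro: ccontr)
    then obtain us vs where ls: "ls = us @ Bar # vs" "Bar \<notin> set us"
      by (meson split_list_first)
    with p have vs: "Bar \<notin> set vs" by (auto simp: eq count_list_0_iff)
    show "r (basis p) \<in> lspan ?S"
      using *[OF ls(2) vs, of j i] p
      by (auto simp: r_def E_def eq ls filter_not_Bar[OF ls(2)] filter_not_Bar[OF vs] words_append[OF wf_digraph])
  qed
  moreover have "r x = x"
    using x by (simp add: r_def Omega1_def E_def lin_zero[OF lin_lin_ext])
  ultimately show ?thesis by simp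
qed

lemma path_alg_expand: "path_alg G \<subseteq> lspan (basis ` paths G)"
proof
  fix x :: "('a, 'b, 'c) form"
  assume "x \<in> path_alg G"
  then show "x \<in> lspan (basis ` paths G)"
    unfolding path_alg_def
    by (rule lin_mem_subspace[OF _ lin_id scal.subspace_span]) (simp add: scal.span_base)
qed

text \<open>A spanning set of \<open>Omega G n\<close> made of bihomogeneous elements, as the
  Leibniz rule for a contraction is imposed for bihomogeneous left factors.\<close>

primrec monomials :: "('v, 'e) pre_digraph \<Rightarrow> nat \<Rightarrow> ('v, 'e, 'k::field) form set" where
  "monomials G 0 = basis ` paths G"
| "monomials G (Suc n) = {x \<cdot> one_form G q a p | x q a p. x \<in> monomials G n \<and>
     q \<in> paths G \<and> p \<in> paths G \<and> a \<in> arcs G \<and> snd (snd q) = head G a \<and> fst p = tail G a}"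

lemma Omega_subset_monomials:
  assumes "fin_digraph G"
  shows "Omega G n \<subseteq> lspan (monomials G n)"
proof (induction n)
  case 0
  then show ?case by (simp add: path_alg_expand)
next
  case (Suc n)
  have "x \<cdot> y \<in> lspan (monomials G (Suc n))" if "x \<in> Omega G n" "y \<in> Omega1 G" for x y :: "('a, 'b, 'c) form"
  proof -
    \<comment> \<open>For the zero weight every one-form is homogeneous, so the spanning lemma
      applies to \<open>y\<close> without splitting it into weight components.\<close>
    have "homog (\<lambda>_. 0) 0 1 y"
      using that by (auto simp: homog_def Omega1_def free_on_def)
    from Omega1_homog_span[OF assms that(2) this] that(1) Suc show ?thesis
      by (intro span_bilinear[of "\<lambda>x y. x \<cdot> y", OF _ _ _ subsetD[OF Suc that(1)]])
        (assumption | intro lin_intros scal.subspace_span scal.span_base | force)+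
  qed
  then have "{x \<cdot> y | x y. x \<in> Omega G n \<and> y \<in> Omega1 G} \<subseteq>
      (lspan (monomials G (Suc n)) :: ('a, 'b, 'c) form set)"
    by blast
  from scal.span_minimal[OF this scal.subspace_span] show ?case by (simp only: Omega.simps)
qed

lemma Omega_free_on: "wf_digraph G \<Longrightarrow> Omega G n \<subseteq> free_on {p \<in> words G. fdeg p = int n}"
proof (induction n)
  case 0
  then show ?case by (simp add: path_alg_def paths_def)
next
  case (Suc n)
  have "x \<cdot> y \<in> free_on {p \<in> words G. fdeg p = int (Suc n)}" if "x \<in> Omega G n" "y \<in> Omega1 G" for x y :: "('a, 'b, 'c) form"
    by (rule mul_free_on[of x "{p \<in> words G. fdeg p = int n}" y "{p \<in> words G. fdeg p = 1}"])
      (use that Suc in \<open>auto simp: Omega1_def words_append\<close>)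
  then have "{x \<cdot> y | x y. x \<in> Omega G n \<and> y \<in> Omega1 G} \<subseteq>
      (free_on {p \<in> words G. fdeg p = int (Suc n)} :: ('a, 'b, 'c) form set)"
    by blast
  from scal.span_minimal[OF this subspace_free_on] show ?case by simp
qed

lemma subspace_Omega: "scal.subspace (Omega G n)"
  by (cases n) (auto simp: path_alg_def subspace_free_on)

lemma subspace_Omegas: "scal.subspace (Omegas G)"
  by (simp add: Omegas_def)

lemma Omega_Omegas: "Omega G n \<subseteq> Omegas G"
  unfolding Omegas_def by (auto intro: scal.span_base)

lemma path_alg_Omegas: "path_alg G \<subseteq> Omegas G"
  using Omega_Omegas[of G 0] by simp

lemma mul_Omega_Omega1: "x \<in> Omega G n \<Longrightarrow> y \<in> Omega1 G \<Longrightarrow> x \<cdot> y \<in> Omega G (Suc n)"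
  by (auto intro!: scal.span_base)

lemma Omega1_Omega_1:
  assumes "fin_digraph G"
  shows "Omega1 G \<subseteq> Omega G (Suc 0)"
proof
  fix x :: "('a, 'b, 'c) form"
  assume x: "x \<in> Omega1 G"
  interpret fin_digraph G by fact
  \<comment> \<open>The sum of the trivial paths is the unit of the path algebra; it serves as the
    factor from \<open>Omega G 0\<close>.\<close>
  have "(\<Sum>i\<in>verts G. idem i) \<cdot> x = x"
    using x words_verts[OF wf_digraph] by (intro one_mul) (auto simp: Omega1_def free_on_def)
  moreover have "(\<Sum>i\<in>verts G. idem i) \<in> (path_alg G :: ('a, 'b, 'c) form set)"
    by (rule scal.subspace_sum) (auto simp: path_alg_def[symmetric] intro: subspace_Omega[of G 0, simplified])
  ultimately show "x \<in> Omega G (Suc 0)"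
    using x mul_Omega_Omega1[of "\<Sum>i\<in>verts G. idem i" G 0 x] by simp
qed

lemma Omega1_Omegas: "fin_digraph G \<Longrightarrow> Omega1 G \<subseteq> Omegas G"
  using Omega1_Omega_1 Omega_Omegas by blast

lemma monomials_Omega:
  assumes "fin_digraph G"
  shows "monomials G n \<subseteq> Omega G n"
proof (induction n)
  case 0
  then show ?case by (auto simp: path_alg_def)
next
  case (Suc n)
  show ?case
    by (clarsimp, rule scal.span_base) (use Suc assms in \<open>auto intro!: one_form_Omega1\<close>)
qed

lemma monomials_homog:
  assumes "fin_digraph G" "x \<in> monomials G n"
  shows "\<exists>m. homog w m (int n) x"
  using assms(2)
proof (induction n arbitrary: x)
  case 0
  then show ?case by (auto simp: homog_iff paths_def)
next
  case (Suc n)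
  then obtain y q a p where x: "x = y \<cdot> one_form G q a p" and y: "y \<in> monomials G n"
    and *: "q \<in> paths G" "p \<in> paths G" "a \<in> arcs G" "snd (snd q) = head G a" "fst p = tail G a"
    by auto
  obtain m where m: "homog w m (int n) y" using Suc.IH[OF y] by auto
  have "homog w (wt w q + int (w a) + wt w p) 1 (one_form G q a p)"
  proof -
    obtain j us vs i where "q = (j, us, head G a)" "p = (tail G a, vs, i)"
      using * by (cases q, cases p) auto
    with * show ?thesis
      by (auto simp: homog_iff one_form_basis[OF assms(1)] paths_iff count_list_0_iff intro!: free_on_diff)
  qed
  from homog_mul[OF m this] show ?case by (auto simp: x add.commute)
qed

section \<open>Contraction\<close>

text \<open>The letters are reversed around \<open>remove1\<close> because the rightmost bar has to
  go: in the term of a contraction at some arrow this is the bar nearest to the left of that arrow.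
  On tensors the map multiplies the last two factors.\<close>

fun del_bar :: "('v, 'e) word \<Rightarrow> ('v, 'e, 'k::field) form" where
  "del_bar (j, ls, i) = (if Bar \<in> set ls then basis (j, rev (remove1 Bar (rev ls)), i) else 0)"

text \<open>The last bar of a product lies in the right factor if that has a bar, and in the left
  one otherwise. The second case yields \<open>lin_ext del_bar x\<close> times a path, which is 0 by
  hypothesis, just as \<open>del_bar\<close> of the right factor is.\<close>

lemma lin_ext_del_bar_mul:
  fixes x :: "('v, 'e, 'k::field) form"
  assumes "lin_ext del_bar x = 0"
  shows "lin_ext del_bar (x \<cdot> y) = x \<cdot> lin_ext del_bar y"
proof -
  have del_bar_mul: "lin_ext del_bar (basis u \<cdot> basis v) =
      (if Bar \<in> set (fst (snd v)) then basis u \<cdot> del_bar v else del_bar u \<cdot> (basis v :: ('v, 'e, 'k) form))"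
    for u v :: "('v, 'e) word"
    by (cases u; cases v) (auto simp: remove1_append lin_zero[OF lin_lin_ext])
  have "lin_ext del_bar (x \<cdot> basis v) = x \<cdot> del_bar v" for v :: "('v, 'e) word"
  proof (cases "Bar \<in> set (fst (snd v))")
    case True
    have l: "lin (\<lambda>x :: ('v, 'e, 'k) form. lin_ext del_bar (x \<cdot> basis v))"
      "lin (\<lambda>x :: ('v, 'e, 'k) form. x \<cdot> del_bar v)"
      by (intro lin_intros)+
    show ?thesis
      by (rule lin_eqI[OF l]) (simp only: del_bar_mul True if_True)
  next
    case False
    have l: "lin (\<lambda>x :: ('v, 'e, 'k) form. lin_ext del_bar (x \<cdot> basis v))"
      "lin (\<lambda>x :: ('v, 'e, 'k) form. lin_ext del_bar x \<cdot> basis v)"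
      by (intro lin_intros)+
    have "lin_ext del_bar (x \<cdot> basis v) = lin_ext del_bar x \<cdot> basis v"
      by (rule lin_eqI[OF l]) (simp only: del_bar_mul False if_False lin_ext_basis)
    then show ?thesis using False by (cases v) (simp add: assms)
  qed
  then have *: "lin_ext del_bar (x \<cdot> basis v) = x \<cdot> lin_ext del_bar (basis v)" for v :: "('v, 'e) word"
    by simp
  have l: "lin (\<lambda>y :: ('v, 'e, 'k) form. lin_ext del_bar (x \<cdot> y))"
    "lin (\<lambda>y :: ('v, 'e, 'k) form. x \<cdot> lin_ext del_bar y)"
    by (intro lin_intros)+
  show ?thesis
    by (rule lin_eqI[OF l *])
qed

text \<open>With a single bar, deleting the last bar is the multiplication map whose kernel is
  \<open>Omega1\<close>.\<close>

lemma del_bar_Omega1: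
  assumes "x \<in> Omega1 G"
  shows "lin_ext del_bar x = 0"
proof -
  have "lin_ext del_bar x = lin_ext (\<lambda>p. basis (unbar p)) x"
  proof (rule lin_eqI_on[OF _ lin_lin_ext lin_lin_ext])
    show "x \<in> free_on {p. fdeg p = 1}"
      using assms by (auto simp: Omega1_def free_on_def)
    fix p :: "('a, 'b) word" assume p: "p \<in> {p. fdeg p = 1}"
    obtain j ls i where eq: "p = (j, ls, i)" by (cases p)
    have "Bar \<in> set ls" using p by (auto simp: eq count_list_0_iff intro: ccontr)
    then obtain us vs where ls: "ls = us @ Bar # vs" "Bar \<notin> set vs"
      by (meson split_list_last)
    with p have us: "Bar \<notin> set us" by (auto simp: eq count_list_0_iff)
    show "lin_ext del_bar (basis p) = lin_ext (\<lambda>p. basis (unbar p)) (basis p)"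
      using ls us by (simp add: eq remove1_append filter_not_Bar)
  qed
  then show ?thesis using assms by (simp add: Omega1_def)
qed

lemma del_bar_path_alg:
  assumes "x \<in> path_alg G"
  shows "lin_ext del_bar x = 0"
  by (rule lin_eqI_on[OF assms[unfolded path_alg_def] lin_lin_ext lin_const_zero])
    (auto simp: paths_iff)

text \<open>A product of one-forms ends in a one-form, and there the last bar is multiplied out to
  0. The Leibniz rule for the contraction rests on this property.\<close>

lemma del_bar_Omegas:
  assumes "x \<in> Omegas G"
  shows "lin_ext del_bar x = 0"
proof -
  have sub: "scal.subspace {x :: ('a, 'b, 'c) form. lin_ext del_bar x = 0}"
    by (auto simp: scal.subspace_def lin_zero[OF lin_lin_ext] lin_add[OF lin_lin_ext] lin_scal[OF lin_lin_ext])
  have "Omega G n \<subseteq> {x :: ('a, 'b, 'c) form. lin_ext del_bar x = 0}" for n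
  proof (induction n)
    case 0
    then show ?case by (auto simp: del_bar_path_alg)
  next
    case (Suc n)
    have "{x \<cdot> y | x y. x \<in> Omega G n \<and> y \<in> Omega1 G} \<subseteq> {x :: ('a, 'b, 'c) form. lin_ext del_bar x = 0}"
      using Suc by (auto simp: lin_ext_del_bar_mul del_bar_Omega1)
    from scal.span_minimal[OF this sub] show ?case by simp
  qed
  then have "(\<Union>n. Omega G n) \<subseteq> {x :: ('a, 'b, 'c) form. lin_ext del_bar x = 0}"
    by blast
  from scal.span_minimal[OF this sub] assms show ?thesis
    by (auto simp: Omegas_def)
qed

text \<open>The Koszul sign for moving a map of bidegree \<open>(\<theta>, -1)\<close> past the left
  part, taken after the last bar is gone; hence the form degree \<open>fdeg p - 1\<close>.\<close>

definition contr_coeff :: "('e \<Rightarrow> nat) \<Rightarrow> int \<Rightarrow> ('v, 'e) word \<Rightarrow> ('v, 'e, 'k::field) form" where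
  "contr_coeff w \<theta> p = scal (ksign (\<theta> * wt w p - (fdeg p - 1))) (del_bar p)"

definition path_coeff :: "('e \<Rightarrow> nat) \<Rightarrow> int \<Rightarrow> ('v, 'e) word \<Rightarrow> ('v, 'e, 'k::field) form" where
  "path_coeff w \<theta> p = scal (ksign (\<theta> * wt w p)) (basis p)"

lemma lin_ext_scal_homog:
  assumes "homog w m n x"
  shows "lin_ext (\<lambda>p. scal (c (wt w p) (fdeg p)) (f p)) x = scal (c m n) (lin_ext f x)"
  by (rule lin_eqI_on[OF assms[unfolded homog_iff], of "lin_ext (\<lambda>p. scal (c (wt w p) (fdeg p)) (f p))"
      "\<lambda>x. scal (c m n) (lin_ext f x)"]) (intro lin_intros lin_lin_ext | simp)+

lemma contr_der_mul:
  fixes x :: "('v, 'e, 'k::field) form"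
  assumes x: "x \<in> Omegas G" "homog w m n x"
  shows "arrow_der G (contr_coeff w \<theta>) t (x \<cdot> y) =
    outer_r (arrow_der G (contr_coeff w \<theta>) t x) y +
    scal (ksign (\<theta> * m - n)) (outer_l x (arrow_der G (contr_coeff w \<theta>) t y))"
proof (rule arrow_der_mul)
  fix v :: "('v, 'e) word"
  have v: "homog w (wt w v) (fdeg v) (basis v)" by (simp add: homog_iff)
  have "lin_ext (contr_coeff w \<theta>) (x \<cdot> basis v) =
      scal (ksign (\<theta> * (m + wt w v) - (n + fdeg v - 1))) (lin_ext del_bar (x \<cdot> basis v))"
    unfolding contr_coeff_def[abs_def]
    by (rule lin_ext_scal_homog[OF homog_mul[OF x(2) v], of "\<lambda>m n. ksign (\<theta> * m - (n - 1))"])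
  then show "lin_ext (contr_coeff w \<theta>) (x \<cdot> basis v) = scal (ksign (\<theta> * m - n)) (x \<cdot> contr_coeff w \<theta> v)"
    by (simp add: lin_ext_del_bar_mul[OF del_bar_Omegas[OF x(1)]] contr_coeff_def ksign_mult algebra_simps)
qed

lemma path_der_mul:
  fixes x :: "('v, 'e, 'k::field) form"
  assumes x: "homog w m n x"
  shows "arrow_der G (path_coeff w \<theta>) t (x \<cdot> y) =
    outer_r (arrow_der G (path_coeff w \<theta>) t x) y +
    scal (ksign (\<theta> * m)) (outer_l x (arrow_der G (path_coeff w \<theta>) t y))"
proof (rule arrow_der_mul)
  fix v :: "('v, 'e) word"
  have v: "homog w (wt w v) (fdeg v) (basis v)" by (simp add: homog_iff)
  have "lin_ext (path_coeff w \<theta>) (x \<cdot> basis v) =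
      scal (ksign (\<theta> * (m + wt w v))) (lin_ext basis (x \<cdot> basis v))"
    unfolding path_coeff_def[abs_def]
    by (rule lin_ext_scal_homog[OF homog_mul[OF x(1) v], of "\<lambda>m n. ksign (\<theta> * m)"])
  then show "lin_ext (path_coeff w \<theta>) (x \<cdot> basis v) = scal (ksign (\<theta> * m)) (x \<cdot> path_coeff w \<theta> v)"
    by (simp add: lin_ext_id path_coeff_def ksign_mult algebra_simps)
qed

text \<open>A path offers no bar to delete. In \<open>1 | xs\<close> the only bar stands to the left
  of all arrows, and its removal leaves the coefficients of the double derivation. Since a bar at
  the right end contributes nothing, d xs is contracted to the value of the derivation on
  xs.\<close>

lemma contr_der_path:
  fixes t :: "'e \<Rightarrow> ('v, 'e, 'k::field) form2"
  assumes "Bar \<notin> set xs"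
  shows "arrow_der G (contr_coeff w \<theta>) t (basis (j, xs, i)) = 0"
    and "arrow_der G (contr_coeff w \<theta>) t (basis (j, Bar # xs, i)) =
      arrow_der G (path_coeff w \<theta>) t (basis (j, xs, i))"
proof -
  show "arrow_der G (contr_coeff w \<theta>) t (basis (j, xs, i)) = 0"
    using assms
  proof (induction xs arbitrary: i rule: rev_induct)
    case (snoc l xs)
    then show ?case by (cases l) (auto simp: arrow_der_snoc_Arr contr_coeff_def)
  qed simp
  show "arrow_der G (contr_coeff w \<theta>) t (basis (j, Bar # xs, i)) =
      arrow_der G (path_coeff w \<theta>) t (basis (j, xs, i))"
    using assms
  proof (induction xs arbitrary: i rule: rev_induct)
    case Nil
    then show ?case using arrow_der_snoc_Bar[of G "contr_coeff w \<theta>" t j "[]"] by simp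
  next
    case (snoc l xs)
    then obtain a where l: "l = Arr a" by (cases l) auto
    have "remove1 Bar (rev xs @ [Bar]) = rev xs" using snoc.prems by (simp add: remove1_append)
    with snoc.prems have "contr_coeff w \<theta> (j, Bar # xs, head G a) =
        (path_coeff w \<theta> (j, xs, head G a) :: ('v, 'e, 'k) form)"
      by (simp add: contr_coeff_def path_coeff_def count_list_0_iff)
    with snoc show ?case
      using arrow_der_snoc_Arr[of G "contr_coeff w \<theta>" t j "Bar # xs" a i]
      by (simp add: l arrow_der_snoc_Arr)
  qed
qed

lemma contr_der_path_alg:
  assumes "x \<in> path_alg G"
  shows "arrow_der G (contr_coeff w \<theta>) t x = 0"
  by (rule lin_eqI_on[OF assms[unfolded path_alg_def] lin_arrow_der[OF lin_id] lin_const_zero])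
    (auto simp: paths_iff contr_der_path)

lemma contr_der_diff:
  assumes "fin_digraph G" "x \<in> path_alg G"
  shows "arrow_der G (contr_coeff w \<theta>) t (diff G x) = arrow_der G (path_coeff w \<theta>) t x"
  by (rule lin_eqI_on[OF assms(2)[unfolded path_alg_def], of "\<lambda>x. arrow_der G (contr_coeff w \<theta>) t (diff G x)"])
    (intro lin_intros lin_arrow_der
      | auto simp: paths_iff diff_basis[OF assms(1)] arrow_der_snoc_Bar contr_der_path)+

text \<open>Basis of the values of weight \<open>m\<close> that a double derivation can take on an
  arrow from \<open>t\<close> to \<open>h\<close>.\<close>

definition path_pairs ::
  "('v, 'e) pre_digraph \<Rightarrow> ('e \<Rightarrow> nat) \<Rightarrow> 'v \<Rightarrow> 'v \<Rightarrow> int \<Rightarrow> (('v, 'e) word \<times> ('v, 'e) word) set" where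
  "path_pairs G w h t m = {(u, v). u \<in> paths G \<and> v \<in> paths G \<and> wt w u + wt w v = m \<and>
     fst u = h \<and> snd (snd v) = t}"

lemma path_pairs_idem:
  assumes "T \<in> free_on (path_pairs G w h t m)"
  shows "outer_l (basis (h, [], h)) T = T" "outer_r T (basis (t, [], t)) = T"
proof -
  show "outer_l (basis (h, [], h)) T = T"
    by (rule lin_eqI_on[OF assms, of "\<lambda>T. outer_l (basis (h, [], h)) T"])
      (intro lin_intros | force simp: path_pairs_def)+
  show "outer_r T (basis (t, [], t)) = T"
    by (rule lin_eqI_on[OF assms, of "\<lambda>T. outer_r T (basis (t, [], t))"])
      (intro lin_intros | force simp: path_pairs_def)+
qed

lemma path_der_arw:
  assumes "t a \<in> free_on (path_pairs G w (head G a) (tail G a) m)"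
  shows "arrow_der G (path_coeff w \<theta>) t (arw G a) = t a"
  using arrow_der_snoc_Arr[of G "path_coeff w \<theta>" t "head G a" "[]" a "tail G a"]
  by (simp add: arw_def path_coeff_def path_pairs_idem[OF assms])

text \<open>Trivial paths have derivative 0, so the Leibniz rule for the products of the arrow with
  the trivial paths at its head and tail shows that its derivative is fixed by their outer
  actions.\<close>

lemma DDer_arw:
  assumes G: "fin_digraph G" and T: "T \<in> DDer G w \<theta>" and a: "a \<in> arcs G"
  shows "T (arw G a) \<in> free_on (path_pairs G w (head G a) (tail G a) (int (w a) + \<theta>))"
proof -
  interpret fin_digraph G by fact
  have idem0: "T (idem i) = 0" if "i \<in> verts G" for i
    using T that by (auto simp: DDer_def vertex_alg_def intro!: scal.span_base)
  have hom: "homog w (int (w a)) 0 (arw G a)" "homog w 0 0 (idem i)" for i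
    by (auto simp: homog_iff arw_def idem_def)
  have alg: "arw G a \<in> path_alg G" "idem (head G a) \<in> path_alg G" "idem (tail G a) \<in> path_alg G"
    using a arw_in_path_alg[OF wf_digraph a] by auto
  have L: "T (x \<cdot> y) = outer_r (T x) y + scal (ksign (\<theta> * m)) (outer_l x (T y))"
    if "x \<in> path_alg G" "y \<in> path_alg G" "homog w m 0 x" for x y m
    using T that by (auto simp: DDer_def)
  have l: "outer_l (idem (head G a)) (T (arw G a)) = T (arw G a)"
    using L[OF alg(2,1) hom(2)] idem0 a by (simp add: arw_def idem_def)
  have r: "outer_r (T (arw G a)) (idem (tail G a)) = T (arw G a)"
    using L[OF alg(1,3) hom(1)] idem0 a by (simp add: arw_def idem_def)
  have "T (arw G a) \<in> free_on {(u, v). u \<in> paths G \<and> v \<in> paths G \<and> wt w u + wt w v = int (w a) + \<theta>}"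
    using T alg(1) hom(1) by (auto simp: DDer_def)
  then have "outer_l (idem (head G a)) (outer_r (T (arw G a)) (idem (tail G a))) \<in>
      free_on (path_pairs G w (head G a) (tail G a) (int (w a) + \<theta>))"
    unfolding idem_def
    by (intro outer_l_free_on[of _ "{(head G a, [], head G a)}" _
          "{(u, v). u \<in> paths G \<and> v \<in> paths G \<and> wt w u + wt w v = int (w a) + \<theta> \<and> snd (snd v) = tail G a}"]
        outer_r_free_on[of _ _ _ "{(tail G a, [], tail G a)}"]) (auto simp: path_pairs_def)
  then show ?thesis by (simp add: l r)
qed

lemma DDer_eq_path_der:
  fixes T :: "('v, 'e, 'k::field) form \<Rightarrow> ('v, 'e, 'k) form2"
  assumes G: "fin_digraph G" and T: "T \<in> DDer G w \<theta>" and x: "x \<in> path_alg G"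
  shows "T x = arrow_der G (path_coeff w \<theta>) (\<lambda>a. T (arw G a)) x"
proof -
  interpret fin_digraph G by fact
  have L: "T (x \<cdot> y) = outer_r (T x) y + scal (ksign (\<theta> * m)) (outer_l x (T y))"
    if "x \<in> path_alg G" "y \<in> path_alg G" "homog w m 0 x" for x y m
    using T that by (auto simp: DDer_def)
  have basis: "T (basis (j, xs, i)) = arrow_der G (path_coeff w \<theta>) (\<lambda>a. T (arw G a)) (basis (j, xs, i))"
    if "(j, xs, i) \<in> paths G" for j xs i
    using that
  proof (induction xs arbitrary: i rule: rev_induct)
    case Nil
    then have "basis (j, [], i) \<in> (vertex_alg G :: ('v, 'e, 'k) form set)"
      by (auto simp: paths_iff vertex_alg_def idem_def intro!: scal.span_base)
    then show ?case using T by (simp add: DDer_def)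
  next
    case (snoc l xs)
    then obtain a where l: "l = Arr a" by (cases l) (auto simp: paths_iff)
    have a: "a \<in> arcs G" "i = tail G a" "(j, xs, head G a) \<in> paths G"
      using snoc.prems by (auto simp: l paths_iff words_append[OF wf_digraph] words_Arr[OF wf_digraph])
    have "T (basis (j, xs, head G a) \<cdot> arw G a) = outer_r (T (basis (j, xs, head G a))) (arw G a) +
        scal (ksign (\<theta> * wt w (j, xs, head G a))) (outer_l (basis (j, xs, head G a)) (T (arw G a)))"
      using a by (intro L arw_in_path_alg[OF wf_digraph])
        (auto simp: path_alg_def homog_iff paths_iff count_list_0_iff)
    then show ?case
      using snoc.IH[OF a(3)]
      by (simp add: l a(2) arrow_der_snoc_Arr path_coeff_def path_pairs_idem(2)[OF DDer_arw[OF G T a(1)]])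
         (simp add: arw_def)
  qed
  have lin: "linear_on (path_alg G) T" using T by (simp add: DDer_def)
  let ?S = "{x \<in> path_alg G. T x = arrow_der G (path_coeff w \<theta>) (\<lambda>a. T (arw G a)) x}"
  have z: "0 \<in> path_alg G" by (simp add: path_alg_def)
  have "T 0 = 0" using lin z scal.scale_zero_left[of 0] unfolding linear_on_def by (metis scal.scale_zero_left)
  then have "scal.subspace ?S"
    using lin by (auto simp: scal.subspace_def linear_on_def path_alg_def free_on_add)
  moreover have "basis ` paths G \<subseteq> ?S" using basis by (auto simp: path_alg_def)
  ultimately have "lspan (basis ` paths G) \<subseteq> ?S" by (intro scal.span_minimal)
  then show ?thesis using x path_alg_expand by blast
qed

lemma contr_der_is_contraction:
  assumes "fin_digraph G" "T \<in> DDer G w \<theta>"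
  shows "is_contraction G w \<theta> T (arrow_der G (contr_coeff w \<theta>) (\<lambda>a. T (arw G a)))"
  unfolding is_contraction_def
  using assms by (auto simp: linear_on_def contr_der_path_alg contr_der_diff contr_der_mul DDer_eq_path_der[OF assms])

section \<open>Contraction of one-forms, and uniqueness of the contraction\<close>

lemma diff_arw_homog:
  assumes "fin_digraph G" "a \<in> arcs G"
  shows "homog w (int (w a)) 1 (diff G (arw G a))"
  unfolding diff_arw[OF assms] homog_iff by (intro free_on_diff) auto

lemma diff_arw_eq_one_form:
  assumes "fin_digraph G" "a \<in> arcs G"
  shows "diff G (arw G a) = one_form G (head G a, [], head G a) a (tail G a, [], tail G a)"
  by (simp add: diff_arw[OF assms] one_form_basis[OF assms])

lemma diff_arw_Omega1:
  assumes "fin_digraph G" "a \<in> arcs G"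
  shows "diff G (arw G a) \<in> Omega1 G"
proof -
  interpret fin_digraph G by fact
  show ?thesis
    unfolding diff_arw_eq_one_form[OF assms]
    by (rule one_form_Omega1[OF assms]) (use assms in \<open>auto simp: paths_iff\<close>)
qed

text \<open>Both \<open>q\<close> and \<open>p\<close> are contracted to 0, so of the three Leibniz
  terms only the one at da survives.\<close>

lemma contraction_one_form:
  fixes T :: "('v, 'e, 'k::field) form \<Rightarrow> ('v, 'e, 'k) form2"
  assumes G: "fin_digraph G" and I: "is_contraction G w \<theta> T I"
    and *: "a \<in> arcs G" "q \<in> paths G" "p \<in> paths G"
  shows "I (one_form G q a p) = scal (ksign (\<theta> * wt w q)) (outer_r (outer_l (basis q) (T (arw G a))) (basis p))"
proof -
  interpret fin_digraph G by fact
  have alg: "basis q \<in> path_alg G" "basis p \<in> path_alg G" "arw G a \<in> path_alg G"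
    using * arw_in_path_alg[OF wf_digraph] by (auto simp: path_alg_def)
  have I0: "I (basis q) = 0" "I (basis p) = 0" "I (diff G (arw G a)) = T (arw G a)"
    using I alg by (auto simp: is_contraction_def)
  have L: "I (u \<cdot> v) = outer_r (I u) v + scal (ksign (\<theta> * m - n)) (outer_l u (I v))"
    if "u \<in> Omegas G" "v \<in> Omegas G" "homog w m n u" for u v m n
    using I that by (auto simp: is_contraction_def)
  have q: "homog w (wt w q) 0 (basis q)" "basis q \<in> Omegas G"
    using *(2) path_alg_Omegas alg by (auto simp: homog_iff paths_def)
  note d = diff_arw_homog[OF G *(1), of w] diff_arw_Omega1[OF G *(1)]
  \<comment> \<open>The Leibniz rule requires the left factor q da to lie in \<open>Omegas\<close>;
    inserting the trivial path at the tail exhibits it as a one-form.\<close>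
  have "one_form G q a (tail G a, [], tail G a) = (basis q \<cdot> diff G (arw G a) :: ('v, 'e, 'k) form)"
    by (cases q) (simp add: one_form_def mul_assoc diff_arw[OF G *(1)])
  moreover have "one_form G q a (tail G a, [], tail G a) \<in> (Omegas G :: ('v, 'e, 'k) form set)"
    using *(1) by (intro subsetD[OF Omega1_Omegas[OF G] one_form_Omega1[OF G *(1,2)]]) (simp add: paths_iff)
  ultimately have qd: "basis q \<cdot> diff G (arw G a) \<in> (Omegas G :: ('v, 'e, 'k) form set)"
    by simp
  have "I (basis q \<cdot> diff G (arw G a)) = scal (ksign (\<theta> * wt w q)) (outer_l (basis q) (T (arw G a)))"
    using L[OF q(2) subsetD[OF Omega1_Omegas[OF G] d(2)] q(1)] by (simp add: I0)
  then show ?thesis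
    using L[OF qd subsetD[OF path_alg_Omegas alg(2)] homog_mul[OF q(1) d(1)]]
    by (simp add: one_form_def I0)
qed

text \<open>Agreement on the forms q da p propagates along \<open>monomials\<close> by the Leibniz
  rule. This makes the choice in \<open>contraction\<close> immaterial on forms.\<close>

lemma contraction_unique:
  fixes T :: "('v, 'e, 'k::field) form \<Rightarrow> ('v, 'e, 'k) form2"
  assumes G: "fin_digraph G" and I: "is_contraction G w \<theta> T I" and J: "is_contraction G w \<theta> T J"
    and x: "x \<in> Omegas G"
  shows "I x = J x"
proof -
  interpret fin_digraph G by fact
  have mon: "I x = J x" if "x \<in> monomials G n" for x n
    using that
  proof (induction n arbitrary: x)
    case 0
    then have "x \<in> path_alg G" by (auto simp: path_alg_def)
    then show ?case using I J by (simp add: is_contraction_def)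
  next
    case (Suc n)
    then obtain y q a p where x: "x = y \<cdot> one_form G q a p" and y: "y \<in> monomials G n"
      and *: "a \<in> arcs G" "q \<in> paths G" "p \<in> paths G"
      by auto
    obtain m where m: "homog w m (int n) y" using monomials_homog[OF G y] by auto
    have "y \<in> Omegas G" "one_form G q a p \<in> (Omegas G :: ('v, 'e, 'k) form set)"
      using monomials_Omega[OF G] y Omega_Omegas Omega1_Omegas[OF G] one_form_Omega1[OF G *] by blast+
    then have L: "A (y \<cdot> one_form G q a p) =
        outer_r (A y) (one_form G q a p) + scal (ksign (\<theta> * m - int n)) (outer_l y (A (one_form G q a p)))"
      if "is_contraction G w \<theta> T A" for A
      using that m by (auto simp: is_contraction_def)
    show ?case
      by (simp add: x L[OF I] L[OF J] Suc.IH[OF y] contraction_one_form[OF G I *] contraction_one_form[OF G J *])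
  qed
  have lin: "linear_on (Omegas G) I" "linear_on (Omegas G) J"
    using I J by (auto simp: is_contraction_def)
  have z: "0 \<in> path_alg G" by (simp add: path_alg_def)
  have z': "I 0 = 0" "J 0 = 0" using I J z by (auto simp: is_contraction_def)
  let ?S = "{x \<in> Omegas G. I x = J x}"
  have sub: "scal.subspace ?S"
    using lin z' subspace_Omegas[of G] by (auto simp: scal.subspace_def linear_on_def)
  have "monomials G n \<subseteq> ?S" for n
    using mon monomials_Omega[OF G, of n] Omega_Omegas[of G n] by blast
  then have "Omega G n \<subseteq> ?S" for n
    using scal.span_minimal[OF _ sub, of "monomials G n"] Omega_subset_monomials[OF G, of n] by blast
  then have "(\<Union>n. Omega G n) \<subseteq> ?S"
    by blast
  from scal.span_minimal[OF this sub] have "Omegas G \<subseteq> ?S"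
    by (simp only: Omegas_def[symmetric])
  then show ?thesis using x by blast
qed

lemma contraction_eq:
  assumes "fin_digraph G" "T \<in> DDer G w \<theta>" "x \<in> Omegas G"
  shows "contraction G w \<theta> T x = arrow_der G (contr_coeff w \<theta>) (\<lambda>a. T (arw G a)) x"
proof -
  note c = contr_der_is_contraction[OF assms(1,2)]
  have "is_contraction G w \<theta> T (contraction G w \<theta> T)"
    unfolding contraction_def by (rule someI[of "is_contraction G w \<theta> T", OF c])
  from contraction_unique[OF assms(1) this c assms(3)] show ?thesis .
qed

lemma contr_der_homog:
  fixes x :: "('v, 'e, 'k::field) form"
  assumes G: "wf_digraph G"
    and t: "\<And>a. a \<in> arcs G \<Longrightarrow> t a \<in> free_on (path_pairs G w (head G a) (tail G a) (int (w a) + \<theta>))"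
    and x: "x \<in> free_on (words G)" "homog w m n x"
  shows "arrow_der G (contr_coeff w \<theta>) t x \<in>
    free_on {(u, v). wt w u + wt w v = m + \<theta> \<and> fdeg u + fdeg v = n - 1}"
proof (rule lin_mem_subspace[OF _ lin_arrow_der[OF lin_id] subspace_free_on])
  show "x \<in> free_on {p \<in> words G. wt w p = m \<and> fdeg p = n}"
    using x by (auto simp: free_on_def homog_def)
  fix p assume p: "p \<in> {p \<in> words G. wt w p = m \<and> fdeg p = n}"
  obtain j xs i where eq: "p = (j, xs, i)" by (cases p)
  have bars: "contr_coeff w \<theta> q \<in> (free_on {r. wt w r = wt w q \<and> fdeg r = fdeg q + - 1} :: ('v, 'e, 'k) form set)" for q
  proof -
    obtain j ls i where q: "q = (j, ls, i)" by (cases q)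
    show ?thesis
    proof (cases "Bar \<in> set ls")
      case True
      then obtain us vs where "ls = us @ Bar # vs" "Bar \<notin> set vs"
        by (meson split_list_last)
      then show ?thesis by (simp add: q contr_coeff_def remove1_append)
    qed (simp add: q contr_coeff_def)
  qed
  have t': "t a \<in> free_on {(u, v). wt w u + wt w v = int (w a) + \<theta> \<and> fdeg u + fdeg v = 0}" if "a \<in> arcs G" for a
    by (rule subsetD[OF free_on_mono t[OF that]]) (auto simp: path_pairs_def paths_def)
  show "arrow_der G (contr_coeff w \<theta>) t (basis p) \<in>
      free_on {(u, v). wt w u + wt w v = m + \<theta> \<and> fdeg u + fdeg v = n - 1}"
    using arrow_der_homog[OF G t' bars, of j xs i] p by (simp add: eq)
qed

lemma Omegas_words:
  assumes "wf_digraph G"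
  shows "Omegas G \<subseteq> free_on (words G)"
  unfolding Omegas_def
  using Omega_free_on[OF assms] free_on_mono[of "{p \<in> words G. fdeg p = n}" "words G" for n]
  by (intro scal.span_minimal subspace_free_on) blast

text \<open>Each of \<open>u \<cdot> v\<close> and \<open>v \<cdot> u\<close> gives one term
  containing the contraction of \<open>u\<close> and one containing that of \<open>v\<close>. By
  cyclicity of the flip the terms agree in pairs; \<open>e1\<close> and \<open>e2\<close> compare
  their signs.\<close>

lemma swap_contr_commutator:
  assumes G: "fin_digraph G"
    and t: "\<And>a. a \<in> arcs G \<Longrightarrow> t a \<in> free_on (path_pairs G w (head G a) (tail G a) (int (w a) + \<theta>))"
    and x: "x \<in> commutators G w"
  shows "swap_mul w (arrow_der G (contr_coeff w \<theta>) t x) = 0"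
proof -
  interpret fin_digraph G by fact
  let ?K = "arrow_der G (contr_coeff w \<theta>) t"
  have gen: "swap_mul w (?K (u \<cdot> v - scal (ksign (m * m' + n * n')) (v \<cdot> u))) = 0"
    if u: "u \<in> Omegas G" "homog w m n u" and v: "v \<in> Omegas G" "homog w m' n' v" for u v m n m' n'
  proof -
    have K: "?K u \<in> free_on {(u, v). wt w u + wt w v = m + \<theta> \<and> fdeg u + fdeg v = n - 1}"
      "?K v \<in> free_on {(u, v). wt w u + wt w v = m' + \<theta> \<and> fdeg u + fdeg v = n' - 1}"
      using u v Omegas_words[OF wf_digraph] by (auto intro!: contr_der_homog[OF wf_digraph t])
    note s = swap_mul_outer[OF K(1) v(2)[unfolded homog_iff]] swap_mul_outer[OF K(2) u(2)[unfolded homog_iff]]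
    have e1: "ksign ((m + \<theta>) * m' + (n - 1) * n') =
        (ksign (m * m' + n * n' + (\<theta> * m' - n')) :: 'c)"
      by (rule arg_cong[where f = ksign]) (simp add: algebra_simps)
    have e2: "ksign (m * m' + n * n' + ((m' + \<theta>) * m + (n' - 1) * n)) = (ksign (\<theta> * m - n) :: 'c)"
      by (rule ksign_eqI) (simp add: algebra_simps)
    show ?thesis
      by (simp add: contr_der_mul[OF u] contr_der_mul[OF v] s scal.scale_right_distrib ksign_mult e1 e2)
  qed
  have l: "lin (\<lambda>x. swap_mul w (?K x))"
    by (intro lin_intros lin_arrow_der)
  have sub: "scal.subspace {x. swap_mul w (?K x) = 0}"
    by (auto simp: scal.subspace_def)
  have "commutators G w \<subseteq> {x. swap_mul w (?K x) = 0}"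
    unfolding commutators_def by (rule scal.span_minimal[OF _ sub]) (use gen in blast)
  with x show ?thesis by blast
qed

lemma iota_dr_class:
  assumes G: "fin_digraph G" and T: "T \<in> DDer G w \<theta>" and x: "x \<in> Omegas G"
  shows "iota G w (dr_class G w x) \<theta> T =
    swap_mul w (arrow_der G (contr_coeff w \<theta>) (\<lambda>a. T (arw G a)) x)"
proof -
  let ?K = "arrow_der G (contr_coeff w \<theta>) (\<lambda>a. T (arw G a))"
  have "swap_mul w (contraction G w \<theta> T y) = swap_mul w (?K x)" if "y \<in> dr_class G w x" for y
  proof -
    have y: "y \<in> Omegas G" "y - x \<in> commutators G w" using that by (auto simp: dr_class_def)
    have "swap_mul w (?K (y - x)) = 0"
      by (rule swap_contr_commutator[OF G DDer_arw[OF G T] y(2)])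
    then show ?thesis by (simp add: contraction_eq[OF G T y(1)])
  qed
  moreover have "x \<in> dr_class G w x"
    using x by (simp add: dr_class_def commutators_def scal.span_zero)
  \<comment> \<open>The image is a singleton, which is what gives \<open>the_elem\<close> in
    \<open>iota\<close> its meaning.\<close>
  ultimately have "(\<lambda>x. swap_mul w (contraction G w \<theta> T x)) ` dr_class G w x = {swap_mul w (?K x)}"
    by force
  then show ?thesis by (simp add: iota_def)
qed

lemma contr_der_diff_mul_diff:
  assumes G: "fin_digraph G" and ab: "a \<in> arcs G" "b \<in> arcs G"
    and t: "\<And>a. a \<in> arcs G \<Longrightarrow> t a \<in> free_on (path_pairs G w (head G a) (tail G a) (int (w a) + \<theta>))"
  shows "arrow_der G (contr_coeff w \<theta>) t (diff G (arw G a) \<cdot> diff G (arw G b)) =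
    outer_r (t a) (diff G (arw G b)) +
    scal (ksign (\<theta> * int (w a) - 1)) (outer_l (diff G (arw G a)) (t b))"
proof -
  interpret fin_digraph G by fact
  have d: "arrow_der G (contr_coeff w \<theta>) t (diff G (arw G c)) = t c" if "c \<in> arcs G" for c
    by (rule trans[OF contr_der_diff[OF G arw_in_path_alg[OF wf_digraph that]]
          path_der_arw[of t c G, OF t[OF that]]])
  show ?thesis
    by (subst contr_der_mul[OF subsetD[OF Omega1_Omegas[OF G] diff_arw_Omega1[OF G ab(1)]] diff_arw_homog[OF G ab(1)]])
      (simp add: d ab)
qed

section \<open>The bimodule of double derivations\<close>

text \<open>The weight shift \<open>\<theta>\<close> of the values and the sign parameter
  \<open>\<theta>'\<close> are kept apart: elements of the dual of \<open>E_mod G w 1\<close> are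
  later built with shift -1 and sign parameter 0.\<close>

lemma path_der_free_on:
  fixes t :: "'e \<Rightarrow> ('v, 'e, 'k::field) form2"
  assumes G: "wf_digraph G"
    and t: "\<And>a. a \<in> arcs G \<Longrightarrow> t a \<in> free_on (path_pairs G w (head G a) (tail G a) (int (w a) + \<theta>))"
    and p: "(j, xs, i) \<in> paths G"
  shows "arrow_der G (path_coeff w \<theta>') t (basis (j, xs, i)) \<in>
    free_on (path_pairs G w j i (wt w (j, xs, i) + \<theta>))"
  using p
proof (induction xs arbitrary: i rule: rev_induct)
  case Nil
  then show ?case by simp
next
  case (snoc l xs)
  then obtain a where l: "l = Arr a" by (cases l) (auto simp: paths_iff)
  have a: "a \<in> arcs G" "i = tail G a" "(j, xs, head G a) \<in> paths G" "head G a \<in> verts G" "tail G a \<in> verts G"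
    using snoc.prems words_verts[OF G, of j xs "head G a"]
    by (auto simp: l paths_iff words_append[OF G] words_Arr[OF G] wf_digraph.tail_in_verts[OF G])
  have 1: "outer_r (arrow_der G (path_coeff w \<theta>') t (basis (j, xs, head G a))) (basis (head G a, [Arr a], i)) \<in>
      free_on (path_pairs G w j i (wt w (j, xs @ [l], i) + \<theta>))"
    by (rule outer_r_free_on[OF snoc.IH[OF a(3)], of _ "{(head G a, [Arr a], i)}"])
      (use a in \<open>auto simp: path_pairs_def l paths_iff words_Arr[OF G] words_append[OF G]\<close>)
  have 2: "outer_l (path_coeff w \<theta>' (j, xs, head G a)) (t a) \<in>
      free_on (path_pairs G w j i (wt w (j, xs @ [l], i) + \<theta>))"
    by (rule outer_l_free_on[OF _ t[OF a(1)], of _ "{(j, xs, head G a)}"])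
      (use a in \<open>auto simp: path_coeff_def path_pairs_def paths_append[OF G] l\<close>)
  show ?case
    unfolding l arrow_der_snoc_Arr a(2) path_pairs_idem(2)[OF t[OF a(1)]]
    using free_on_add[OF 1 2] by (simp add: l a(2))
qed

definition path_double_der ::
  "('v, 'e) pre_digraph \<Rightarrow> ('e \<Rightarrow> nat) \<Rightarrow> int \<Rightarrow> ('e \<Rightarrow> ('v, 'e, 'k::field) form2) \<Rightarrow>
   (('v, 'e, 'k) form \<Rightarrow> ('v, 'e, 'k) form2)" where
  "path_double_der G w \<theta> t x = (if x \<in> path_alg G then arrow_der G (path_coeff w \<theta>) t x else 0)"

lemma path_double_der_DDer:
  fixes t :: "'e \<Rightarrow> ('v, 'e, 'k::field) form2"
  assumes G: "wf_digraph G"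
    and t: "\<And>a. a \<in> arcs G \<Longrightarrow> t a \<in> free_on (path_pairs G w (head G a) (tail G a) (int (w a) + \<theta>))"
  shows "path_double_der G w \<theta> t \<in> DDer G w \<theta>"
proof -
  let ?K = "arrow_der G (path_coeff w \<theta>) t"
  have sub: "x + y \<in> path_alg G" "scal c x \<in> path_alg G" if "x \<in> path_alg G" "y \<in> path_alg G"
    for x y :: "('v, 'e, 'k) form" and c
    using that by (auto simp: path_alg_def free_on_add)
  have wts: "?K x \<in> free_on {(u, v). u \<in> paths G \<and> v \<in> paths G \<and> wt w u + wt w v = m + \<theta>}"
    if x: "x \<in> path_alg G" "homog w m 0 x" for x m
  proof (rule lin_mem_subspace[OF _ lin_arrow_der[OF lin_id] subspace_free_on])
    show "x \<in> free_on {p \<in> paths G. wt w p = m}"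
      using x by (auto simp: path_alg_def free_on_def homog_def)
    fix p assume p: "p \<in> {p \<in> paths G. wt w p = m}"
    obtain j xs i where eq: "p = (j, xs, i)" by (cases p)
    have "?K (basis p) \<in> free_on (path_pairs G w j i (wt w (j, xs, i) + \<theta>))"
      unfolding eq by (rule path_der_free_on[OF G t]) (use p in \<open>auto simp: eq\<close>)
    then show "?K (basis p) \<in> free_on {(u, v). u \<in> paths G \<and> v \<in> paths G \<and> wt w u + wt w v = m + \<theta>}"
      by (rule subsetD[OF free_on_mono, rotated]) (use p in \<open>auto simp: path_pairs_def eq\<close>)
  qed
  have "vertex_alg G \<subseteq> {x \<in> path_alg G. ?K x = 0}"
    unfolding vertex_alg_def
  proof (rule scal.span_minimal)
    show "scal.subspace {x \<in> path_alg G. ?K x = 0}"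
      using sub by (auto simp: scal.subspace_def path_alg_def)
  qed (auto, simp add: idem_def)
  then have "path_double_der G w \<theta> t r = 0" if "r \<in> vertex_alg G" for r
    using that by (auto simp: path_double_der_def)
  with wts show ?thesis
    by (auto simp: DDer_def path_double_der_def linear_on_def sub path_alg_mul[OF G] path_der_mul)
qed

lemma path_double_der_arw:
  fixes t :: "'e \<Rightarrow> ('v, 'e, 'k::field) form2"
  assumes "wf_digraph G" "a \<in> arcs G"
    and "t a \<in> free_on (path_pairs G w (head G a) (tail G a) m)"
  shows "path_double_der G w \<theta> t (arw G a) = t a"
  by (simp add: path_double_der_def arw_in_path_alg[OF assms(1,2)] path_der_arw[of t a G, OF assms(3)])

lemma DDer_eqI:
  assumes "fin_digraph G" "T \<in> DDer G w \<theta>" "T' \<in> DDer G w \<theta>"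
    and "\<And>a. a \<in> arcs G \<Longrightarrow> T (arw G a) = T' (arw G a)"
  shows "T = T'"
proof
  fix x
  interpret fin_digraph G by fact
  have basis: "arrow_der G \<mu> t (basis (j, xs, i)) = arrow_der G \<mu> t' (basis (j, xs, i))"
    if "\<And>a. a \<in> arcs G \<Longrightarrow> t a = t' a" "(j, xs, i) \<in> words G" for \<mu> t t' j xs i
    using that(2)
  proof (induction xs arbitrary: i rule: rev_induct)
    case (snoc l xs)
    then show ?case
      by (cases l) (auto simp: arrow_der_snoc_Arr arrow_der_snoc_Bar that(1) words_append[OF wf_digraph] words_Arr[OF wf_digraph])
  qed simp
  show "T x = T' x"
  proof (cases "x \<in> path_alg G")
    case True
    have "arrow_der G (path_coeff w \<theta>) (\<lambda>a. T (arw G a)) x = arrow_der G (path_coeff w \<theta>) (\<lambda>a. T' (arw G a)) x"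
      by (rule lin_eqI_on[OF True[unfolded path_alg_def] lin_arrow_der[OF lin_id] lin_arrow_der[OF lin_id]])
        (auto simp: paths_iff intro!: basis assms(4))
    then show ?thesis
      using True DDer_eq_path_der[OF assms(1,2)] DDer_eq_path_der[OF assms(1,3)] by simp
  next
    case False
    then show ?thesis using assms(2,3) by (auto simp: DDer_def)
  qed
qed

lemma DDer_add:
  assumes "T \<in> DDer G w \<theta>" "T' \<in> DDer G w \<theta>"
  shows "T + T' \<in> DDer G w \<theta>"
  using assms
  by (auto simp: DDer_def linear_on_def scal.scale_right_distrib free_on_add)

lemma DDer_l_DDer:
  assumes G: "wf_digraph G" and T: "T \<in> DDer G w \<theta>" and a: "a \<in> path_alg G" "homog w m 0 a"
  shows "DDer_l w a T \<in> DDer G w (m + \<theta>)"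
proof -
  have a': "a \<in> free_on {p \<in> paths G. wt w p = m}" "a \<in> free_on {p. wt w p = m}"
    using a by (auto simp: path_alg_def free_on_def homog_def)
  have wts: "inner_l w a (T x) \<in> free_on {(u, v). u \<in> paths G \<and> v \<in> paths G \<and> wt w u + wt w v = n + (m + \<theta>)}"
    if "x \<in> path_alg G" "homog w n 0 x" for x n
  proof -
    have "T x \<in> free_on {(u, v). u \<in> paths G \<and> v \<in> paths G \<and> wt w u + wt w v = n + \<theta>}"
      using T that by (auto simp: DDer_def)
    then show ?thesis
      by (rule inner_l_free_on[OF a'(1)]) (auto simp: paths_append[OF G] wt_append)
  qed
  have leib: "inner_l w a (T (x \<cdot> y)) =
      outer_r (inner_l w a (T x)) y + scal (ksign ((m + \<theta>) * n)) (outer_l x (inner_l w a (T y)))"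
    if "x \<in> path_alg G" "y \<in> path_alg G" "homog w n 0 x" for x y n
  proof -
    have L: "T (x \<cdot> y) = outer_r (T x) y + scal (ksign (\<theta> * n)) (outer_l x (T y))"
      using T that by (auto simp: DDer_def)
    have x: "x \<in> free_on {p. wt w p = n}"
      using that(3) by (auto simp: free_on_def homog_def)
    show ?thesis
      by (simp add: L inner_l_outer_r inner_l_outer_l[OF a'(2) x] ksign_mult algebra_simps)
  qed
  show ?thesis
    using T wts leib by (auto simp: DDer_def DDer_l_def linear_on_def)
qed

lemma twist_twist [simp]: "twist w q (twist w q x) = x"
  by (rule lin_eqI[of "\<lambda>x. twist w q (twist w q x)"])
    (intro lin_intros | simp add: lin_scal[OF lin_twist[OF lin_id]] ksign_mult | simp add: ksign_def)+

lemma twist_free_on: "x \<in> free_on S \<Longrightarrow> twist w q x \<in> free_on S"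
  by (rule lin_mem_subspace[OF _ lin_twist[OF lin_id] subspace_free_on]) auto

lemma twist_homog: "x \<in> free_on {p. wt w p = n} \<Longrightarrow> twist w q x = scal (ksign (q * n)) x"
  by (rule lin_eqI_on) (intro lin_intros | auto)+

lemma twist_mul: "twist w q (x \<cdot> y) = twist w q x \<cdot> twist w q y"
  by (rule lin_eqI2[of "\<lambda>x y. twist w q (x \<cdot> y)" "\<lambda>x y. twist w q x \<cdot> twist w q y" UNIV UNIV])
    (intro lin_intros | auto simp: ksign_mult lin_zero[OF lin_twist[OF lin_id]] algebra_simps)+

text \<open>The sign of moving \<open>b\<close> past \<open>y\<close> varies with the words of
  \<open>y\<close>; \<open>twist\<close> records it word by word.\<close>

lemma inner_r_outer_r_twist:
  assumes "b \<in> free_on {p. wt w p = m}"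
  shows "inner_r w (outer_r t y) b = outer_r (inner_r w t b) (twist w m y)"
  by (rule lin_eqI3[of "\<lambda>b t y. inner_r w (outer_r t y) b" "\<lambda>b t y. outer_r (inner_r w t b) (twist w m y)",
        OF _ _ _ _ _ _ _ assms free_on_UNIV free_on_UNIV])
    (intro lin_intros | auto simp: ksign_mult algebra_simps)+

text \<open>The twist of the argument does two things. On the right factor of a product it cancels
  the sign that arises when \<open>b\<close> passes that factor; on a left factor of weight
  \<open>n\<close> it supplies the sign of \<open>m * n\<close> by which \<theta> becomes \<theta> +
  m in the Leibniz rule.\<close>

lemma DDer_r_DDer:
  assumes G: "wf_digraph G" and T: "T \<in> DDer G w \<theta>" and b: "b \<in> path_alg G" "homog w m 0 b"
  shows "DDer_r w m T b \<in> DDer G w (\<theta> + m)"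
proof -
  have b': "b \<in> free_on {p \<in> paths G. wt w p = m}" "b \<in> free_on {p. wt w p = m}"
    using b by (auto simp: path_alg_def free_on_def homog_def)
  have tw: "twist w m x \<in> path_alg G \<longleftrightarrow> x \<in> path_alg G" for x
    using twist_free_on[of x "paths G" w m] twist_free_on[of "twist w m x" "paths G" w m]
    by (auto simp: path_alg_def)
  have tw_lin: "twist w m (x + y) = twist w m x + twist w m y" "twist w m (scal c x) = scal c (twist w m x)"
    for x y :: "('a, 'b, 'c) form" and c
    by (auto simp: lin_add[OF lin_twist[OF lin_id]] lin_scal[OF lin_twist[OF lin_id]])
  have wts: "inner_r w (T (twist w m x)) b \<in>
      free_on {(u, v). u \<in> paths G \<and> v \<in> paths G \<and> wt w u + wt w v = n + (\<theta> + m)}"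
    if "x \<in> path_alg G" "homog w n 0 x" for x n
  proof -
    have "homog w n 0 (twist w m x)" using that(2) by (simp add: homog_iff twist_free_on)
    then have "T (twist w m x) \<in> free_on {(u, v). u \<in> paths G \<and> v \<in> paths G \<and> wt w u + wt w v = n + \<theta>}"
      using T that by (auto simp: DDer_def tw)
    then show ?thesis
      by (rule inner_r_free_on[OF _ b'(1)]) (auto simp: paths_append[OF G] wt_append)
  qed
  have leib: "inner_r w (T (twist w m (x \<cdot> y))) b =
      outer_r (inner_r w (T (twist w m x)) b) y +
      scal (ksign ((\<theta> + m) * n)) (outer_l x (inner_r w (T (twist w m y)) b))"
    if "x \<in> path_alg G" "y \<in> path_alg G" "homog w n 0 x" for x y n
  proof -
    have hx: "homog w n 0 (twist w m x)" using that(3) by (simp add: homog_iff twist_free_on)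
    have L: "T (twist w m x \<cdot> twist w m y) =
        outer_r (T (twist w m x)) (twist w m y) + scal (ksign (\<theta> * n)) (outer_l (twist w m x) (T (twist w m y)))"
      using T that hx by (auto simp: DDer_def tw)
    have x: "twist w m x = scal (ksign (m * n)) x"
      using that(3) by (intro twist_homog) (auto simp: free_on_def homog_def)
    show ?thesis
      unfolding twist_mul L
      by (simp add: inner_r_outer_r_twist[OF b'(2)])
        (simp add: x inner_r_outer_l ksign_mult algebra_simps)
  qed
  have "vertex_alg G \<subseteq> (free_on {p. wt w p = 0} :: ('a, 'b, 'c) form set)"
    unfolding vertex_alg_def by (rule scal.span_minimal[OF _ subspace_free_on]) (auto simp: idem_def)
  then have "twist w m r = r" if "r \<in> vertex_alg G" for r :: "('a, 'b, 'c) form"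
    using that twist_homog[of r w 0 m] by auto
  then show ?thesis
    using T wts leib by (auto simp: DDer_def DDer_r_def linear_on_def tw tw_lin)
qed

section \<open>The canonical form\<close>

lemma double_quiver_simps [simp]:
  "verts (double_quiver P) = verts P"
  "Fwd a \<in> arcs (double_quiver P) \<longleftrightarrow> a \<in> arcs P"
  "Rev a \<in> arcs (double_quiver P) \<longleftrightarrow> a \<in> arcs P"
  "head (double_quiver P) (Fwd a) = head P a"
  "tail (double_quiver P) (Fwd a) = tail P a"
  "head (double_quiver P) (Rev a) = tail P a"
  "tail (double_quiver P) (Rev a) = head P a"
  by (auto simp: double_quiver_def)

lemma fin_double_quiver:
  assumes "fin_digraph P"
  shows "fin_digraph (double_quiver P)"
proof -
  interpret fin_digraph P by fact
  show ?thesis by unfold_locales (auto simp: double_quiver_def)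
qed

lemma star_simps [simp]:
  "star (star c) = c"
  "star c \<in> arcs (double_quiver P) \<longleftrightarrow> c \<in> arcs (double_quiver P)"
  "head (double_quiver P) (star c) = tail (double_quiver P) c"
  "tail (double_quiver P) (star c) = head (double_quiver P) c"
  by (cases c; simp)+

lemma star_eq_iff [simp]: "star c = star d \<longleftrightarrow> c = d"
  by (cases c; cases d) auto

lemma sum_double_quiver:
  assumes "fin_digraph P"
  shows "(\<Sum>c\<in>arcs (double_quiver P). f c) = (\<Sum>a\<in>arcs P. f (Rev a) + f (Fwd a))"
proof -
  interpret fin_digraph P by fact
  have "(\<Sum>c\<in>arcs (double_quiver P). f c) = sum f (Fwd ` arcs P) + sum f (Rev ` arcs P)"
    by (simp add: double_quiver_def) (rule sum.union_disjoint, auto)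
  then show ?thesis
    by (simp add: sum.reindex inj_on_def sum.distrib add.commute)
qed

definition symp_form :: "('v, 'e) pre_digraph \<Rightarrow> ('v, 'e dbl, 'k::field) form" where
  "symp_form P = (\<Sum>a\<in>arcs P. diff (double_quiver P) (arw (double_quiver P) (Fwd a)) \<cdot>
     diff (double_quiver P) (arw (double_quiver P) (Rev a)))"

text \<open>The contraction of \<open>symp_form\<close> as a function of the values \<open>t\<close>
  of a double derivation on arrows. The explicit sign is that of moving a map of bidegree
  \<open>(\<theta>, -1)\<close> past the left factor da.\<close>

definition symp_iota ::
  "('v, 'e) pre_digraph \<Rightarrow> ('e dbl \<Rightarrow> nat) \<Rightarrow> int \<Rightarrow> ('e dbl \<Rightarrow> ('v, 'e dbl, 'k::field) form2) \<Rightarrow>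
   ('v, 'e dbl, 'k) form" where
  "symp_iota P w \<theta> t = (\<Sum>a\<in>arcs P.
     swap_mul w (outer_r (t (Fwd a)) (diff (double_quiver P) (arw (double_quiver P) (Rev a)))) +
     scal (ksign (\<theta> * int (w (Fwd a)) - 1))
       (swap_mul w (outer_l (diff (double_quiver P) (arw (double_quiver P) (Fwd a))) (t (Rev a)))))"

text \<open>
  The sign with which \<open>u \<otimes> v\<close>, the value of a double derivation on the arrow \<open>c\<^sup>*\<close>, contributes
  \<open>v dc u\<close> to the contraction of \<open>\<Sum> da da\<^sup>*\<close>.
\<close>

fun symp_sign ::
  "('e dbl \<Rightarrow> nat) \<Rightarrow> int \<Rightarrow> 'e dbl \<Rightarrow> ('v, 'e dbl) word \<Rightarrow> ('v, 'e dbl) word \<Rightarrow> 'k::field" where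
  "symp_sign w \<theta> (Fwd a) u v =
     ksign (\<theta> * int (w (Fwd a)) - 1 + (int (w (Fwd a)) + wt w u) * wt w v)"
| "symp_sign w \<theta> (Rev a) u v = ksign (wt w u * (wt w v + int (w (Rev a))))"

lemma ksign_square [simp]: "ksign n * ksign n = 1"
  by (simp add: ksign_def)

lemma symp_sign_square [simp]: "symp_sign w \<theta> c u v * symp_sign w \<theta> c u v = 1"
  by (cases c) simp_all

definition symp_term ::
  "('v, 'e) pre_digraph \<Rightarrow> ('e dbl \<Rightarrow> nat) \<Rightarrow> int \<Rightarrow> 'e dbl \<Rightarrow> ('v, 'e dbl, 'k::field) form2 \<Rightarrow>
   ('v, 'e dbl, 'k) form" where
  "symp_term P w \<theta> c =
     lin_ext (\<lambda>(u, v). scal (symp_sign w \<theta> c u v) (one_form (double_quiver P) v c u))"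

lemma lin_symp_term: "lin (symp_term P w \<theta> c)"
  unfolding symp_term_def by (rule lin_lin_ext)

lemma symp_term_basis:
  "symp_term P w \<theta> c (basis (u, v)) = scal (symp_sign w \<theta> c u v) (one_form (double_quiver P) v c u)"
  by (simp add: symp_term_def)

text \<open>Only weights enter the sign, as the factor \<open>u\<close> of form degree 0 switches
  off the form part of the flip.\<close>

lemma swap_mul_outer_r_basis:
  assumes "fdeg u = 0" "D \<in> free_on {p. wt w p = k \<and> fdeg p = n}"
  shows "swap_mul w (outer_r (basis (u, v)) D) =
    scal (ksign (wt w u * (wt w v + k))) (basis v \<cdot> D \<cdot> basis u)"
  by (rule lin_eqI_on[OF assms(2), of "\<lambda>D. swap_mul w (outer_r (basis (u, v)) D)"
        "\<lambda>D. scal (ksign (wt w u * (wt w v + k))) (basis v \<cdot> D \<cdot> basis u)"])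
    (intro lin_intros | cases u; cases v; use assms(1) in \<open>auto simp: algebra_simps\<close>)+

lemma swap_mul_outer_l_basis:
  assumes "fdeg v = 0" "D \<in> free_on {p. wt w p = k \<and> fdeg p = n}"
  shows "swap_mul w (outer_l D (basis (u, v))) =
    scal (ksign ((k + wt w u) * wt w v)) (basis v \<cdot> D \<cdot> basis u)"
  by (rule lin_eqI_on[OF assms(2), of "\<lambda>D. swap_mul w (outer_l D (basis (u, v)))"
        "\<lambda>D. scal (ksign ((k + wt w u) * wt w v)) (basis v \<cdot> D \<cdot> basis u)"])
    (intro lin_intros | cases u; cases v; use assms(1) in \<open>auto simp: algebra_simps mul_assoc\<close>)+

text \<open>Contracting the left factor of a summand leaves the differential of the reverse arrow,
  contracting the right factor leaves that of the forward arrow. Hence the term at dc always reads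
  the value on \<open>star c\<close>, and the two kinds of terms combine to one sum over all arrows
  of the double.\<close>

lemma symp_iota_eq:
  assumes P: "fin_digraph P"
    and t: "\<And>b. b \<in> arcs (double_quiver P) \<Longrightarrow> t b \<in> free_on {(u, v). fdeg u = 0 \<and> fdeg v = 0}"
  shows "symp_iota P w \<theta> t = (\<Sum>c\<in>arcs (double_quiver P). symp_term P w \<theta> c (t (star c)))"
proof -
  let ?Q = "double_quiver P"
  note Q = fin_double_quiver[OF P]
  have r: "swap_mul w (outer_r T (diff ?Q (arw ?Q (Rev a)))) = symp_term P w \<theta> (Rev a) T"
    if "a \<in> arcs P" "T \<in> free_on {(u, v). fdeg u = 0 \<and> fdeg v = 0}" for a T
  proof -
    have "homog w (int (w (Rev a))) 1 (diff ?Q (arw ?Q (Rev a)))"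
      by (rule diff_arw_homog[OF Q]) (use that(1) in simp)
    note * = swap_mul_outer_r_basis[OF _ this[unfolded homog_iff]]
    show ?thesis
      by (rule lin_eqI_on[OF that(2), of "\<lambda>T. swap_mul w (outer_r T (diff ?Q (arw ?Q (Rev a))))"])
        (intro lin_intros lin_symp_term | auto simp: * symp_term_basis one_form_def)+
  qed
  have l: "scal (ksign (\<theta> * int (w (Fwd a)) - 1)) (swap_mul w (outer_l (diff ?Q (arw ?Q (Fwd a))) T)) =
      symp_term P w \<theta> (Fwd a) T"
    if "a \<in> arcs P" "T \<in> free_on {(u, v). fdeg u = 0 \<and> fdeg v = 0}" for a T
  proof -
    have "homog w (int (w (Fwd a))) 1 (diff ?Q (arw ?Q (Fwd a)))"
      by (rule diff_arw_homog[OF Q]) (use that(1) in simp)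
    note * = swap_mul_outer_l_basis[OF _ this[unfolded homog_iff]]
    show ?thesis
      by (rule lin_eqI_on[OF that(2), of "\<lambda>T. scal (ksign (\<theta> * int (w (Fwd a)) - 1))
            (swap_mul w (outer_l (diff ?Q (arw ?Q (Fwd a))) T))"])
        (intro lin_intros lin_symp_term | auto simp: * symp_term_basis one_form_def ksign_mult)+
  qed
  show ?thesis
    unfolding sum_double_quiver[OF P] symp_iota_def
    by (rule sum.cong) (simp_all add: r[OF _ t] l[OF _ t])
qed

text \<open>The coefficients of \<open>q dc p\<close> are extracted by the contraction with \<open>\<partial>/\<partial>c\<close>.\<close>

definition form_coeff ::
  "('v, 'e) pre_digraph \<Rightarrow> ('e \<Rightarrow> nat) \<Rightarrow> 'e \<Rightarrow> ('v, 'e, 'k::field) form \<Rightarrow> ('v, 'e, 'k) form2" where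
  "form_coeff G w c = arrow_der G (contr_coeff w (- int (w c)))
     (\<lambda>a. path_double_der G w (- int (w c))
       (\<lambda>a. if a = c then basis ((head G c, [], head G c), (tail G c, [], tail G c)) else 0) (arw G a))"

lemma form_coeff_one_form:
  fixes G :: "('v, 'e) pre_digraph"
  assumes G: "fin_digraph G" and "a \<in> arcs G" "c \<in> arcs G" "q \<in> paths G" "p \<in> paths G"
    and e: "snd (snd q) = head G a" "fst p = tail G a"
  shows "form_coeff G w c (one_form G q a p) =
    (if a = c then scal (ksign (- int (w c) * wt w q)) (basis (q, p) :: ('v, 'e, 'k::field) form2) else 0)"
proof -
  interpret fin_digraph G by fact
  define \<delta> :: "'e \<Rightarrow> ('v, 'e, 'k) form2" where
    "\<delta> = (\<lambda>a. if a = c then basis ((head G c, [], head G c), (tail G c, [], tail G c)) else 0)"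
  have \<delta>: "\<delta> a \<in> free_on (path_pairs G w (head G a) (tail G a) (int (w a) + - int (w c)))" if "a \<in> arcs G" for a
    using that by (auto simp: \<delta>_def path_pairs_def paths_iff)
  let ?T = "path_double_der G w (- int (w c)) \<delta>"
  have T: "?T \<in> DDer G w (- int (w c))"
    by (rule path_double_der_DDer[OF wf_digraph \<delta>])
  have "?T (arw G a) = \<delta> a"
    by (rule path_double_der_arw[where t = \<delta>, OF wf_digraph assms(2) \<delta>[OF assms(2)]])
  then show ?thesis
    unfolding form_coeff_def \<delta>_def[symmetric]
      contraction_one_form[OF G contr_der_is_contraction[OF G T] assms(2,4,5)]
    using e by (cases q; cases p) (auto simp: \<delta>_def)
qed

text \<open>Left inverse of \<open>symp_term\<close>: flip the coefficient of \<open>v dc u\<close>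
  back to \<open>u \<otimes> v\<close> and repeat both signs, each of which squares to 1. Terms at
  other arrows give 0, which yields injectivity.\<close>

definition symp_extract ::
  "('v, 'e) pre_digraph \<Rightarrow> ('e dbl \<Rightarrow> nat) \<Rightarrow> int \<Rightarrow> 'e dbl \<Rightarrow> ('v, 'e dbl, 'k::field) form \<Rightarrow>
   ('v, 'e dbl, 'k) form2" where
  "symp_extract P w \<theta> c x =
     lin_ext (\<lambda>(v, u). scal (ksign (- int (w c) * wt w v) * symp_sign w \<theta> c u v) (basis (u, v)))
       (form_coeff (double_quiver P) w c x)"

lemma lin_form_coeff: "lin (form_coeff G w c)"
  unfolding form_coeff_def by (intro lin_arrow_der[OF lin_id])

lemma lin_symp_extract: "lin (symp_extract P w \<theta> c)"
  unfolding symp_extract_def[abs_def] form_coeff_def by (intro lin_intros lin_arrow_der)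

lemma symp_extract_term:
  fixes T :: "('v, 'e dbl, 'k::field) form2"
  assumes P: "fin_digraph P" and c: "c \<in> arcs (double_quiver P)" "d \<in> arcs (double_quiver P)"
    and T: "T \<in> free_on (path_pairs (double_quiver P) w (tail (double_quiver P) d) (head (double_quiver P) d) m)"
  shows "symp_extract P w \<theta> c (symp_term P w \<theta> d T) = (if c = d then T else 0)"
proof -
  have s: "scal (ksign i * symp_sign w \<theta> c u v) (scal (symp_sign w \<theta> c u v) (scal (ksign i) x)) = x"
    for i u v and x :: "('v, 'e dbl, 'k) form2"
  proof -
    have "ksign i * symp_sign w \<theta> c u v * (symp_sign w \<theta> c u v * ksign i) =
        (ksign i * ksign i) * (symp_sign w \<theta> c u v * symp_sign w \<theta> c u v :: 'k)"
      by (simp only: ac_simps)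
    then show ?thesis by simp
  qed
  have "symp_extract P w \<theta> c (symp_term P w \<theta> d (basis (u, v))) =
      (if c = d then basis (u, v) else 0 :: ('v, 'e dbl, 'k) form2)"
    if uv: "(u, v) \<in> path_pairs (double_quiver P) w (tail (double_quiver P) d) (head (double_quiver P) d) m" for u v
  proof -
    have "form_coeff (double_quiver P) w c (one_form (double_quiver P) v d u) =
        (if d = c then scal (ksign (- int (w c) * wt w v)) (basis (v, u) :: ('v, 'e dbl, 'k) form2) else 0)"
      by (rule form_coeff_one_form[OF fin_double_quiver[OF P] c(2,1)])
        (use uv in \<open>auto simp: path_pairs_def\<close>)
    then show ?thesis
      using s[of "- int (w c) * wt w v" u v "basis (u, v)"]
      by (auto simp: symp_extract_def symp_term_basis lin_scal[OF lin_form_coeff] lin_scal[OF lin_lin_ext]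
          lin_zero[OF lin_lin_ext] ac_simps)
  qed
  moreover have "lin (\<lambda>T. symp_extract P w \<theta> c (symp_term P w \<theta> d T))"
    by (rule lin_comp[OF lin_symp_extract lin_symp_term])
  moreover have "lin (\<lambda>T :: ('v, 'e dbl, 'k) form2. if c = d then T else 0)"
    by (cases "c = d") (simp_all add: lin_id lin_const_zero)
  ultimately show ?thesis
    using lin_eqI_on[OF T, of "\<lambda>T. symp_extract P w \<theta> c (symp_term P w \<theta> d T)" "\<lambda>T. if c = d then T else 0"]
    by auto
qed

lemma symp_extract_iota:
  assumes P: "fin_digraph P" and c: "c \<in> arcs (double_quiver P)"
    and t: "\<And>b. b \<in> arcs (double_quiver P) \<Longrightarrow>
      t b \<in> free_on (path_pairs (double_quiver P) w (head (double_quiver P) b) (tail (double_quiver P) b) (int (w b) + \<theta>))"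
  shows "symp_extract P w \<theta> c (symp_iota P w \<theta> t) = t (star c)"
proof -
  interpret fin_digraph "double_quiver P" by (rule fin_double_quiver[OF P])
  have t': "t b \<in> free_on {(u, v). fdeg u = 0 \<and> fdeg v = 0}" if "b \<in> arcs (double_quiver P)" for b
    by (rule subsetD[OF free_on_mono t[OF that]]) (auto simp: path_pairs_def paths_def)
  have "symp_extract P w \<theta> c (symp_term P w \<theta> d (t (star d))) = (if c = d then t (star d) else 0)"
    if "d \<in> arcs (double_quiver P)" for d
    by (rule symp_extract_term[OF P c that]) (use t[of "star d"] that in simp)
  then show ?thesis
    by (simp add: symp_iota_eq[OF P t'] lin_sum[OF lin_symp_extract] c)
qed

lemma symp_form_Omega:
  assumes P: "fin_digraph P"
  shows "symp_form P \<in> Omega (double_quiver P) 2"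
proof -
  note Q = fin_double_quiver[OF P]
  have "diff (double_quiver P) (arw (double_quiver P) (Fwd a)) \<cdot> diff (double_quiver P) (arw (double_quiver P) (Rev a))
      \<in> Omega (double_quiver P) (Suc (Suc 0))" if "a \<in> arcs P" for a
    using diff_arw_Omega1[OF Q, of "Fwd a"] diff_arw_Omega1[OF Q, of "Rev a"] that
    by (intro mul_Omega_Omega1 subsetD[OF Omega1_Omega_1[OF Q]]) auto
  then have "symp_form P \<in> Omega (double_quiver P) (Suc (Suc 0))"
    unfolding symp_form_def by (rule scal.subspace_sum[OF subspace_Omega])
  then show ?thesis by (simp only: numeral_2_eq_2)
qed

lemma symp_form_homog:
  assumes P: "fin_digraph P" and "\<forall>a\<in>arcs P. w (Fwd a) + w (Rev a) = N"
  shows "homog w (int N) 2 (symp_form P)"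
  unfolding homog_iff symp_form_def
proof (rule free_on_sum)
  fix a assume a: "a \<in> arcs P"
  note d = diff_arw_homog[OF fin_double_quiver[OF P], of _ w]
  have "int (w (Fwd a)) + int (w (Rev a)) = int N" using assms(2) a by (simp flip: of_nat_add)
  then show "diff (double_quiver P) (arw (double_quiver P) (Fwd a)) \<cdot> diff (double_quiver P) (arw (double_quiver P) (Rev a))
      \<in> free_on {p. wt w p = int N \<and> fdeg p = 2}"
    using homog_mul[OF d[of "Fwd a"] d[of "Rev a"]] a by (simp add: homog_iff)
qed

lemma iota_canonical_form:
  fixes T :: "('v, 'e dbl, 'k::field) form \<Rightarrow> ('v, 'e dbl, 'k) form2"
  assumes P: "fin_digraph P" and T: "T \<in> DDer (double_quiver P) w \<theta>"
  shows "iota (double_quiver P) w (dr_class (double_quiver P) w (symp_form P)) \<theta> T =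
    symp_iota P w \<theta> (\<lambda>a. T (arw (double_quiver P) a))"
proof -
  let ?Q = "double_quiver P"
  interpret Q: fin_digraph ?Q by (rule fin_double_quiver[OF P])
  note Q = fin_double_quiver[OF P]
  have "symp_form P \<in> (Omegas ?Q :: ('v, 'e dbl, 'k) form set)"
    using symp_form_Omega[OF P] Omega_Omegas by blast
  from iota_dr_class[OF Q T this] show ?thesis
    by (simp add: symp_form_def symp_iota_def lin_sum[OF lin_arrow_der[OF lin_id]]
        lin_sum[OF lin_swap_mul[OF lin_id]])
      (intro sum.cong refl, subst contr_der_diff_mul_diff[OF Q _ _ DDer_arw[OF Q T]], simp_all)
qed

section \<open>Additivity and bimodule compatibility of the contraction\<close>

lemma symp_iota_add: "symp_iota P w \<theta> (\<lambda>a. t a + t' a) = symp_iota P w \<theta> t + symp_iota P w \<theta> t'"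
  by (simp add: symp_iota_def sum.distrib[symmetric] scal.scale_right_distrib algebra_simps)

lemma diff_arw_wt:
  assumes "fin_digraph G" "a \<in> arcs G"
  shows "diff G (arw G a) \<in> free_on {p. wt w p = int (w a)}"
  using diff_arw_homog[OF assms, of w] by (auto simp: homog_def free_on_def)

text \<open>In the terms where da stands on the left, \<open>a\<close> has to pass it; the resulting
  sign accounts for the change from \<open>\<theta>\<close> to \<open>m + \<theta>\<close> in the
  prefactor.\<close>

lemma symp_iota_inner_l:
  fixes a :: "('v, 'e dbl, 'k::field) form"
  assumes P: "fin_digraph P" and a: "a \<in> path_alg (double_quiver P)" "homog w m 0 a"
  shows "symp_iota P w (m + \<theta>) (\<lambda>b. inner_l w a (t b)) = a \<cdot> symp_iota P w \<theta> t"
proof -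
  let ?d = "\<lambda>b. diff (double_quiver P) (arw (double_quiver P) b)"
  have a': "a \<in> free_on {p. wt w p = m}" "a \<in> free_on {p. fdeg p = 0}"
    using a(2) by (auto simp: homog_def free_on_def)
  have 1: "swap_mul w (outer_r (inner_l w a T) D) = a \<cdot> swap_mul w (outer_r T D)" for T D
    by (simp flip: inner_l_outer_r add: swap_mul_inner_l[OF a'(2)])
  have 2: "scal (ksign ((m + \<theta>) * int (w b) - 1)) (swap_mul w (outer_l (?d b) (inner_l w a T))) =
      a \<cdot> scal (ksign (\<theta> * int (w b) - 1)) (swap_mul w (outer_l (?d b) T))"
    if b: "b \<in> arcs (double_quiver P)" for b T
  proof -
    note I = inner_l_outer_l[OF a'(1) diff_arw_wt[OF fin_double_quiver[OF P] b]]
    have "outer_l (?d b) (inner_l w a T) = scal (ksign (m * int (w b))) (inner_l w a (outer_l (?d b) T))"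
      by (simp add: I)
    moreover have "ksign ((m + \<theta>) * int (w b) - 1) * ksign (m * int (w b)) = (ksign (\<theta> * int (w b) - 1) :: 'k)"
      unfolding ksign_mult by (rule ksign_eqI) (simp add: algebra_simps)
    ultimately show ?thesis
      by (simp add: swap_mul_inner_l[OF a'(2)])
  qed
  show ?thesis
    unfolding symp_iota_def lin_sum[OF lin_mul_right[OF lin_id]]
    by (rule sum.cong[OF refl]) (simp only: 1 2 double_quiver_simps mul_linear)
qed

text \<open>The sign under the binder is the twist of \<open>DDer_r\<close>, evaluated on an arrow
  \<open>b\<close>. It involves the weight of the arrow that is contracted, whereas the sign to be
  cancelled involves the weight of the arrow whose differential remains. These weights add up to 2,
  so their parities agree.\<close>

lemma symp_iota_inner_r:
  fixes c :: "('v, 'e dbl, 'k::field) form"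
  assumes P: "fin_digraph P" and w: "\<forall>a\<in>arcs P. w (Fwd a) + w (Rev a) = 2"
    and c: "c \<in> path_alg (double_quiver P)" "homog w m 0 c"
  shows "symp_iota P w (\<theta> + m) (\<lambda>b. scal (ksign (m * int (w b))) (inner_r w (t b) c)) = symp_iota P w \<theta> t \<cdot> c"
proof -
  let ?d = "\<lambda>b. diff (double_quiver P) (arw (double_quiver P) b)"
  have c': "c \<in> free_on {p. wt w p = m}" "c \<in> free_on {p. fdeg p = 0}"
    using c(2) by (auto simp: homog_def free_on_def)
  have 1: "swap_mul w (outer_r (scal (ksign (m * int (w (Fwd a)))) (inner_r w T c)) (?d (Rev a))) =
      swap_mul w (outer_r T (?d (Rev a))) \<cdot> c"
    if a: "a \<in> arcs P" for a T
  proof -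
    have "?d (Rev a) \<in> free_on {p. wt w p = int (w (Rev a))}"
      by (rule diff_arw_wt[OF fin_double_quiver[OF P]]) (simp add: a)
    note I = inner_r_outer_r[OF this c'(1)]
    have w2: "int (w (Fwd a)) = 2 - int (w (Rev a))" using w a by auto
    have "ksign (m * int (w (Fwd a))) = (ksign (m * int (w (Rev a))) :: 'k)"
      by (rule ksign_eqI) (simp add: w2 algebra_simps)
    then have "outer_r (scal (ksign (m * int (w (Fwd a)))) (inner_r w T c)) (?d (Rev a)) =
        inner_r w (outer_r T (?d (Rev a))) c"
      by (simp add: I)
    then show ?thesis
      by (simp add: swap_mul_inner_r[OF c'(2)])
  qed
  have 2: "scal (ksign ((\<theta> + m) * int (w (Fwd a)) - 1)) (swap_mul w (outer_l (?d (Fwd a))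
        (scal (ksign (m * int (w (Rev a)))) (inner_r w T c)))) =
      scal (ksign (\<theta> * int (w (Fwd a)) - 1)) (swap_mul w (outer_l (?d (Fwd a)) T)) \<cdot> c"
    if a: "a \<in> arcs P" for a T
  proof -
    have w2: "int (w (Fwd a)) = 2 - int (w (Rev a))" using w a by auto
    have "ksign ((\<theta> + m) * int (w (Fwd a)) - 1) * ksign (m * int (w (Rev a))) =
        (ksign (\<theta> * int (w (Fwd a)) - 1) :: 'k)"
      unfolding ksign_mult by (rule ksign_eqI) (simp add: w2 algebra_simps)
    then show ?thesis
      by (simp add: swap_mul_inner_r[OF c'(2)] flip: inner_r_outer_l)
  qed
  show ?thesis
    unfolding symp_iota_def lin_sum[OF lin_mul_left[OF lin_id]]
    by (rule sum.cong[OF refl]) (simp only: 1 2 mul_linear)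
qed

lemma path_pairs_star:
  assumes w: "\<forall>a\<in>arcs P. w (Fwd a) + w (Rev a) = 2" and c: "c \<in> arcs (double_quiver P)"
  shows "int (w c) + int (w (star c)) = 2"
  using assms by (cases c) (auto simp add: add.commute simp flip: of_nat_add)

text \<open>A term \<open>u \<otimes> v\<close> of the value on \<open>star c\<close> has weight
  \<open>w (star c) + \<theta>\<close>, so \<open>v dc u\<close> has weight
  \<open>w c + w (star c) + \<theta> = \<theta> + 2\<close>.\<close>

lemma symp_iota_Omega1:
  fixes t :: "'e dbl \<Rightarrow> ('v, 'e dbl, 'k::field) form2"
  assumes P: "fin_digraph P" and w: "\<forall>a\<in>arcs P. w (Fwd a) + w (Rev a) = 2"
    and t: "\<And>b. b \<in> arcs (double_quiver P) \<Longrightarrow>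
      t b \<in> free_on (path_pairs (double_quiver P) w (head (double_quiver P) b) (tail (double_quiver P) b) (int (w b) + \<theta>))"
  shows "symp_iota P w \<theta> t \<in> {\<alpha> \<in> Omega1 (double_quiver P). homog w (\<theta> + 2) 1 \<alpha>}"
proof -
  let ?Q = "double_quiver P"
  note Q = fin_double_quiver[OF P]
  let ?V = "{\<alpha> \<in> Omega1 ?Q. homog w (\<theta> + 2) 1 \<alpha>} :: ('v, 'e dbl, 'k) form set"
  have sub: "scal.subspace ?V"
    using subspace_Omega1[of ?Q] by (auto simp: scal.subspace_def homog_iff free_on_add)
  have t': "t b \<in> free_on {(u, v). fdeg u = 0 \<and> fdeg v = 0}" if "b \<in> arcs ?Q" for b
    by (rule subsetD[OF free_on_mono t[OF that]]) (auto simp: path_pairs_def paths_def)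
  have "symp_term P w \<theta> c (t (star c)) \<in> ?V" if c: "c \<in> arcs ?Q" for c
  proof (rule lin_mem_subspace[OF t lin_symp_term sub])
    fix p assume "p \<in> path_pairs ?Q w (head ?Q (star c)) (tail ?Q (star c)) (int (w (star c)) + \<theta>)"
    then obtain u v where p: "p = (u, v)" and *: "u \<in> paths ?Q" "v \<in> paths ?Q"
      "wt w u + wt w v = int (w (star c)) + \<theta>" "fst u = tail ?Q c" "snd (snd v) = head ?Q c"
      by (auto simp: path_pairs_def)
    have "homog w (wt w v + int (w c) + wt w u) (0 + 1 + 0) (one_form ?Q v c u)"
      unfolding one_form_def
      by (intro homog_mul diff_arw_homog[OF Q c]) (use * in \<open>auto simp: homog_iff paths_def\<close>)
    moreover have "wt w v + int (w c) + wt w u = \<theta> + 2"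
      using * path_pairs_star[OF w c] by linarith
    ultimately have "one_form ?Q v c u \<in> ?V"
      using one_form_Omega1[OF Q c *(2,1)] by simp
    then show "symp_term P w \<theta> c (basis p) \<in> ?V"
      unfolding p symp_term_basis by (rule scal.subspace_scale[OF sub])
  qed (use c in simp)
  then have "(\<Sum>c\<in>arcs ?Q. symp_term P w \<theta> c (t (star c))) \<in> ?V"
    by (rule scal.subspace_sum[OF sub])
  also have "(\<Sum>c\<in>arcs ?Q. symp_term P w \<theta> c (t (star c))) = symp_iota P w \<theta> t"
    by (rule symp_iota_eq[OF P t', symmetric])
  finally show ?thesis .
qed

text \<open>The set \<open>V\<close> of all values is a subspace, so it suffices that it contains
  the spanning forms \<open>q da p\<close> of weight \<open>\<theta> + 2\<close>; such a form comes
  from a family \<open>t\<close> concentrated at \<open>star a\<close>.\<close>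

lemma symp_iota_surj:
  fixes \<alpha> :: "('v, 'e dbl, 'k::field) form"
  assumes P: "fin_digraph P" and w: "\<forall>a\<in>arcs P. w (Fwd a) + w (Rev a) = 2"
    and \<alpha>: "\<alpha> \<in> Omega1 (double_quiver P)" "homog w (\<theta> + 2) 1 \<alpha>"
  obtains t where "\<And>b. t b \<in> free_on (path_pairs (double_quiver P) w (head (double_quiver P) b)
      (tail (double_quiver P) b) (int (w b) + \<theta>))"
    and "\<alpha> = symp_iota P w \<theta> t"
proof -
  let ?Q = "double_quiver P"
  interpret Q: fin_digraph ?Q by (rule fin_double_quiver[OF P])
  note Q = fin_double_quiver[OF P]
  let ?t = "\<lambda>t. \<forall>b. t b \<in> free_on (path_pairs ?Q w (head ?Q b) (tail ?Q b) (int (w b) + \<theta>))"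
  let ?F = "\<lambda>t. \<Sum>c\<in>arcs ?Q. symp_term P w \<theta> c (t (star c))"
  define V :: "('v, 'e dbl, 'k) form set" where "V = {?F t | t. ?t t}"
  have VI: "?F t \<in> V" if "?t t" for t
    using that unfolding V_def by blast
  have "scal.subspace V"
    unfolding scal.subspace_def
  proof (intro conjI ballI allI)
    show "0 \<in> V" using VI[of "\<lambda>_. 0"] by (simp add: lin_zero[OF lin_symp_term])
    show "x + y \<in> V" if "x \<in> V" "y \<in> V" for x y
    proof -
      obtain t t' where "x = ?F t" "?t t" "y = ?F t'" "?t t'" using \<open>x \<in> V\<close> \<open>y \<in> V\<close> by (auto simp: V_def)
      then have "x + y = ?F (\<lambda>b. t b + t' b)" "?t (\<lambda>b. t b + t' b)"
        by (simp_all add: lin_add[OF lin_symp_term] sum.distrib free_on_add)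
      then show ?thesis using VI[of "\<lambda>b. t b + t' b"] by simp
    qed
    show "scal c x \<in> V" if "x \<in> V" for c x
    proof -
      obtain t where "x = ?F t" "?t t" using \<open>x \<in> V\<close> by (auto simp: V_def)
      then have "scal c x = ?F (\<lambda>b. scal c (t b))" "?t (\<lambda>b. scal c (t b))"
        by (simp_all add: lin_scal[OF lin_symp_term] scal.scale_sum_right)
      then show ?thesis using VI[of "\<lambda>b. scal c (t b)"] by simp
    qed
  qed
  moreover have "one_form ?Q q a p \<in> V"
    if *: "q \<in> paths ?Q" "p \<in> paths ?Q" "a \<in> arcs ?Q" "snd (snd q) = head ?Q a" "fst p = tail ?Q a"
      "wt w q + int (w a) + wt w p = \<theta> + 2" for q a p
  proof -
    \<comment> \<open>The sign is included because it squares to 1 and thereby cancels the one in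
      \<open>symp_term\<close>.\<close>
    define t where "t = (\<lambda>b. if b = star a then scal (symp_sign w \<theta> a p q) (basis (p, q)) else 0 :: ('v, 'e dbl, 'k) form2)"
    have "symp_term P w \<theta> c (t (star c)) = (if c = a then one_form ?Q q a p else 0)" for c
      by (simp add: t_def lin_scal[OF lin_symp_term] lin_zero[OF lin_symp_term] symp_term_basis)
    then have "one_form ?Q q a p = ?F t"
      using *(3) by simp
    moreover have "?t t"
      using * path_pairs_star[OF w *(3)] by (auto simp: t_def path_pairs_def)
    ultimately show ?thesis using VI[of t] by simp
  qed
  ultimately have "lspan {one_form ?Q q a p | q a p. q \<in> paths ?Q \<and> p \<in> paths ?Q \<and> a \<in> arcs ?Q \<and>
    snd (snd q) = head ?Q a \<and> fst p = tail ?Q a \<and> wt w q + int (w a) + wt w p = \<theta> + 2} \<subseteq> V"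
    by (intro scal.span_minimal) blast
  with Omega1_homog_span[OF Q \<alpha>] obtain t where t: "\<alpha> = ?F t" "?t t"
    unfolding V_def by blast
  have "t b \<in> free_on {(u, v). fdeg u = 0 \<and> fdeg v = 0}" for b
    by (rule subsetD[OF free_on_mono spec[OF t(2), of b]]) (auto simp: path_pairs_def paths_def)
  with t show ?thesis
    by (intro that[of t]) (simp_all add: symp_iota_eq[OF P])
qed

section \<open>Closedness of the canonical form, and its bi-symplecticity\<close>

lemma de_Rham_differential_de_Rham:
  assumes G: "fin_digraph G"
  shows "de_Rham_differential G (de_Rham G :: ('v, 'e, 'k::field) form \<Rightarrow> ('v, 'e, 'k) form)"
proof -
  interpret fin_digraph G by fact
  have 1: "de_Rham G a = diff G a" if "a \<in> path_alg G" for a :: "('v, 'e, 'k) form"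
    by (rule lin_eqI_on[OF that[unfolded path_alg_def] lin_de_Rham[OF lin_id] lin_difference[OF lin_id]])
      (auto simp: paths_iff de_Rham_path diff_basis[OF G])
  have 2: "de_Rham G (diff G a) = 0" if "a \<in> path_alg G" for a :: "('v, 'e, 'k) form"
  proof (rule lin_eqI_on[OF that[unfolded path_alg_def] lin_de_Rham[OF lin_difference[OF lin_id]] lin_const_zero])
    fix p :: "('v, 'e) word" assume p: "p \<in> paths G"
    obtain j xs i where eq: "p = (j, xs, i)" by (cases p)
    have xs: "Bar \<notin> set xs" "(j, xs, i) \<in> words G" using p by (auto simp: eq paths_iff)
    \<comment> \<open>Both halves of d xs have the differential \<open>| xs |\<close>: for
      \<open>| xs\<close> the double bar on the left cancels, for \<open>xs |\<close> the one on the
      right.\<close>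
    have "(de_Rham G (basis (j, [Bar], j)) :: ('v, 'e, 'k) form) = basis (j, [Bar, Bar], j)"
      by (simp add: de_Rham_snoc_Bar[of G j "[]" j, simplified])
    then have "(de_Rham G (basis (j, [Bar] @ xs, i)) :: ('v, 'e, 'k) form) = basis (j, Bar # xs @ [Bar], i)"
      by (subst de_Rham_mul_basis[where k = j]) (simp add: de_Rham_path[OF xs(1)] ksign_def)
    moreover have "(de_Rham G (basis (j, xs @ [Bar], i)) :: ('v, 'e, 'k) form) = basis (j, Bar # xs @ [Bar], i)"
      using xs(1) by (simp add: de_Rham_snoc_Bar de_Rham_path[OF xs(1)] count_list_0_iff)
    ultimately show "(de_Rham G (diff G (basis p)) :: ('v, 'e, 'k) form) = 0"
      by (simp add: eq diff_basis[OF G xs(2)])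
  qed
  have 3: "de_Rham G (u \<cdot> v) = de_Rham G u \<cdot> v + scal (ksign (int n)) (u \<cdot> de_Rham G v)"
    if "u \<in> Omega G n" for u v :: "('v, 'e, 'k) form" and n
    by (rule de_Rham_mul) (use Omega_free_on[OF wf_digraph] that in \<open>fastforce simp: free_on_def\<close>)
  show ?thesis
    using 1 2 3 by (simp add: de_Rham_differential_def linear_on_def)
qed

lemma symp_form_closed:
  fixes w :: "'e dbl \<Rightarrow> nat" and P :: "('v, 'e) pre_digraph"
  assumes P: "fin_digraph P"
  shows "dr_closed (double_quiver P) w (dr_class (double_quiver P) w (symp_form P :: ('v, 'e dbl, 'k::field) form))"
proof -
  let ?Q = "double_quiver P"
  interpret Q: fin_digraph ?Q by (rule fin_double_quiver[OF P])
  note Q = fin_double_quiver[OF P]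
  have D: "de_Rham ?Q (diff ?Q (arw ?Q b)) = (0 :: ('v, 'e dbl, 'k) form)" if "b \<in> arcs ?Q" for b
    using de_Rham_differential_de_Rham[OF Q, where ?'k = 'k] arw_in_path_alg[OF Q.wf_digraph that]
    unfolding de_Rham_differential_def by blast
  have "de_Rham ?Q (diff ?Q (arw ?Q (Fwd a)) \<cdot> diff ?Q (arw ?Q (Rev a))) = (0 :: ('v, 'e dbl, 'k) form)"
    if a: "a \<in> arcs P" for a
  proof -
    have "diff ?Q (arw ?Q (Fwd a)) \<in> (free_on {p. fdeg p = 1} :: ('v, 'e dbl, 'k) form set)"
      using diff_arw_Omega1[OF Q, of "Fwd a", where ?'c = 'k] a by (auto simp: Omega1_def free_on_def)
    from de_Rham_mul[OF this] show ?thesis by (simp add: D a)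
  qed
  then have "de_Rham ?Q (symp_form P) = (0 :: ('v, 'e dbl, 'k) form)"
    by (simp add: symp_form_def lin_sum[OF lin_de_Rham[OF lin_id]])
  moreover have "symp_form P \<in> dr_class ?Q w (symp_form P :: ('v, 'e dbl, 'k) form)"
    using symp_form_Omega[OF P] Omega_Omegas
    by (auto simp: dr_class_def commutators_def scal.span_zero)
  moreover have "0 \<in> (commutators ?Q w :: ('v, 'e dbl, 'k) form set)"
    by (simp add: commutators_def scal.span_zero)
  ultimately show ?thesis
    unfolding dr_closed_def
    by (intro exI[of _ "de_Rham ?Q"] conjI de_Rham_differential_de_Rham[OF Q]
        bexI[of _ "symp_form P"]) simp_all
qed

lemma symp_form_bi_symplectic:
  fixes w :: "'e dbl \<Rightarrow> nat" and P :: "('v, 'e) pre_digraph"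
  assumes P: "fin_digraph P" and w: "\<forall>a\<in>arcs P. w (Fwd a) + w (Rev a) = 2"
  shows "bi_symplectic (double_quiver P) w 2
    (dr_class (double_quiver P) w (symp_form P :: ('v, 'e dbl, 'k::field) form))"
proof -
  let ?Q = "double_quiver P"
  interpret Q: fin_digraph ?Q by (rule fin_double_quiver[OF P])
  note Q = fin_double_quiver[OF P]
  let ?\<omega> = "dr_class ?Q w (symp_form P :: ('v, 'e dbl, 'k) form)"
  note iota = iota_canonical_form[OF P, where ?'k = 'k and w = w]
  have bij: "bij_betw (iota ?Q w ?\<omega> \<theta>) (DDer ?Q w \<theta>) {\<alpha> \<in> Omega1 ?Q. homog w (\<theta> + 2) 1 \<alpha>}" for \<theta>
  proof (rule bij_betw_imageI)
    show "inj_on (iota ?Q w ?\<omega> \<theta>) (DDer ?Q w \<theta>)"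
    proof (rule inj_onI, rule DDer_eqI[OF Q], assumption+)
      fix T T' :: "('v, 'e dbl, 'k) form \<Rightarrow> ('v, 'e dbl, 'k) form2" and a
      assume T: "T \<in> DDer ?Q w \<theta>" "T' \<in> DDer ?Q w \<theta>" "iota ?Q w ?\<omega> \<theta> T = iota ?Q w ?\<omega> \<theta> T'"
        and a: "a \<in> arcs ?Q"
      have "symp_extract P w \<theta> (star a) (iota ?Q w ?\<omega> \<theta> U) = U (arw ?Q a)" if U: "U \<in> DDer ?Q w \<theta>" for U
        using symp_extract_iota[OF P, of "star a" "\<lambda>a. U (arw ?Q a)" w \<theta>, OF _ DDer_arw[OF Q U]] a
        by (simp add: iota[OF U])
      from this[OF T(1)] this[OF T(2)] T(3) show "T (arw ?Q a) = T' (arw ?Q a)" by simp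
    qed
    show "iota ?Q w ?\<omega> \<theta> ` DDer ?Q w \<theta> = {\<alpha> \<in> Omega1 ?Q. homog w (\<theta> + 2) 1 \<alpha>}"
    proof (intro equalityI subsetI)
      fix \<alpha> assume "\<alpha> \<in> iota ?Q w ?\<omega> \<theta> ` DDer ?Q w \<theta>"
      then obtain T where T: "T \<in> DDer ?Q w \<theta>" and \<alpha>: "\<alpha> = iota ?Q w ?\<omega> \<theta> T" by blast
      show "\<alpha> \<in> {\<alpha> \<in> Omega1 ?Q. homog w (\<theta> + 2) 1 \<alpha>}"
        unfolding \<alpha> iota[OF T] by (rule symp_iota_Omega1[OF P w DDer_arw[OF Q T]])
    next
      fix \<alpha> :: "('v, 'e dbl, 'k) form"
      assume "\<alpha> \<in> {\<alpha> \<in> Omega1 ?Q. homog w (\<theta> + 2) 1 \<alpha>}"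
      then obtain t where t: "\<And>b. t b \<in> free_on (path_pairs ?Q w (head ?Q b) (tail ?Q b) (int (w b) + \<theta>))"
        and \<alpha>: "\<alpha> = symp_iota P w \<theta> t"
        using symp_iota_surj[OF P w, of \<alpha> \<theta>] by auto
      let ?T = "path_double_der ?Q w \<theta> t"
      have T: "?T \<in> DDer ?Q w \<theta>" by (rule path_double_der_DDer[OF Q.wf_digraph t])
      have "iota ?Q w ?\<omega> \<theta> ?T = \<alpha>"
        unfolding iota[OF T] \<alpha> symp_iota_def
        by (rule sum.cong) (simp_all add: path_double_der_arw[where t = t, OF Q.wf_digraph _ t])
      with T show "\<alpha> \<in> iota ?Q w ?\<omega> \<theta> ` DDer ?Q w \<theta>" by blast
    qed
  qed
  have add: "iota ?Q w ?\<omega> \<theta> (T + T') = iota ?Q w ?\<omega> \<theta> T + iota ?Q w ?\<omega> \<theta> T'"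
    if "T \<in> DDer ?Q w \<theta>" "T' \<in> DDer ?Q w \<theta>" for T T' \<theta>
    using that by (simp add: iota DDer_add symp_iota_add)
  have left: "iota ?Q w ?\<omega> (m + \<theta>) (DDer_l w a T) = a \<cdot> iota ?Q w ?\<omega> \<theta> T"
    if "T \<in> DDer ?Q w \<theta>" "a \<in> path_alg ?Q" "homog w m 0 a" for T \<theta> m a
    unfolding iota[OF DDer_l_DDer[OF Q.wf_digraph that]] iota[OF that(1)]
    by (simp add: DDer_l_def symp_iota_inner_l[OF P that(2,3)])
  have right: "iota ?Q w ?\<omega> (\<theta> + m) (DDer_r w m T a) = scal (ksign (2 * m)) (iota ?Q w ?\<omega> \<theta> T \<cdot> a)"
    if T: "T \<in> DDer ?Q w \<theta>" and a: "a \<in> path_alg ?Q" "homog w m 0 a" for T \<theta> m a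
  proof -
    have "DDer_r w m T a (arw ?Q b) = scal (ksign (m * int (w b))) (inner_r w (T (arw ?Q b)) a)"
      if b: "b \<in> arcs ?Q" for b
    proof -
      have "twist w m (arw ?Q b) = (scal (ksign (m * int (w b))) (arw ?Q b) :: ('v, 'e dbl, 'k) form)"
        by (simp add: arw_def)
      moreover have "T (scal (ksign (m * int (w b))) (arw ?Q b)) = scal (ksign (m * int (w b))) (T (arw ?Q b))"
        using T by (simp add: DDer_def linear_on_def arw_in_path_alg[OF Q.wf_digraph b])
      ultimately show ?thesis by (simp add: DDer_r_def)
    qed
    then have "symp_iota P w (\<theta> + m) (\<lambda>b. DDer_r w m T a (arw ?Q b)) =
        symp_iota P w (\<theta> + m) (\<lambda>b. scal (ksign (m * int (w b))) (inner_r w (T (arw ?Q b)) a))"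
      unfolding symp_iota_def by (intro sum.cong) simp_all
    moreover have "ksign (2 * m) = (1 :: 'k)" by (simp add: ksign_def)
    ultimately show ?thesis
      unfolding iota[OF DDer_r_DDer[OF Q.wf_digraph T a]] iota[OF T]
      by (simp add: symp_iota_inner_r[OF P w a])
  qed
  have form: "\<exists>x\<in>Omega ?Q 2. homog w 2 2 x \<and> ?\<omega> = dr_class ?Q w x"
    using symp_form_Omega[OF P] symp_form_homog[OF P w] by auto
  show ?thesis
    unfolding bi_symplectic_def
    using form symp_form_closed[OF P] bij add left right by blast
qed

section \<open>The weight one part\<close>

declare One_nat_def [simp del]

lemma wt_nonneg: "wt w p \<ge> 0"
  by (cases p) (auto intro!: sum_list_nonneg)

lemma wf_weight0_quiver: "wf_digraph G \<Longrightarrow> wf_digraph (weight0_quiver G w)"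
  by (auto simp: wf_digraph_def weight0_quiver_def)

lemma paths_weight0_quiver:
  assumes G: "wf_digraph G"
  shows "paths (weight0_quiver G w) = {p \<in> paths G. wt w p = 0}"
proof -
  have "(j, xs, i) \<in> paths (weight0_quiver G w) \<longleftrightarrow> (j, xs, i) \<in> paths G \<and> wt w (j, xs, i) = 0" for j xs i
  proof (induction xs arbitrary: j)
    case Nil
    then show ?case by (simp add: paths_iff weight0_quiver_def)
  next
    case (Cons l xs)
    show ?case
    proof (cases l)
      case (Arr a)
      have "(\<Sum>a\<leftarrow>arrows xs. int (w a)) \<ge> 0" by (rule sum_list_nonneg) auto
      then have "int (w a) + (\<Sum>a\<leftarrow>arrows xs. int (w a)) = 0 \<longleftrightarrow> w a = 0 \<and> (\<Sum>a\<leftarrow>arrows xs. int (w a)) = 0"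
        by auto
      then show ?thesis
        using Cons.IH[of "tail G a"]
        by (auto simp: Arr paths_iff words_Arr[OF G] words_Arr[OF wf_weight0_quiver[OF G]])
          (auto simp: weight0_quiver_def)
    qed (simp add: paths_iff)
  qed
  then show ?thesis by auto
qed

lemma B_alg_eq: "wf_digraph G \<Longrightarrow> B_alg G w = free_on {p \<in> paths G. wt w p = 0}"
  by (simp add: B_alg_def path_alg_def paths_weight0_quiver)

text \<open>Weights of letters are nonnegative integers, so in a path of weight 1 one letter has
  weight 1 and all others have weight 0. Therefore \<open>E_mod G w 1\<close> is the whole weight 1
  part of the path algebra, and linear maps on it can be tested on paths.\<close>

lemma weight_one_path:
  assumes G: "wf_digraph G" and "(j, xs, i) \<in> paths G" "wt w (j, xs, i) = 1"
  obtains us a vs where "xs = us @ Arr a # vs" "a \<in> arcs G" "w a = 1"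
    "(j, us, head G a) \<in> paths G" "(tail G a, vs, i) \<in> paths G"
    "wt w (j, us, head G a) = 0" "wt w (tail G a, vs, i) = 0"
proof -
  have "\<exists>us a vs. xs = us @ Arr a # vs \<and> a \<in> arcs G \<and> w a = 1 \<and>
    (j, us, head G a) \<in> paths G \<and> (tail G a, vs, i) \<in> paths G \<and>
    wt w (j, us, head G a) = 0 \<and> wt w (tail G a, vs, i) = 0"
    using assms(2,3)
  proof (induction xs arbitrary: j)
    case (Cons l xs)
    then obtain b where l: "l = Arr b" by (cases l) (auto simp: paths_iff)
    have b: "b \<in> arcs G" "head G b = j" "(tail G b, xs, i) \<in> paths G"
      using Cons.prems by (auto simp: l paths_iff words_Arr[OF G])
    have s: "int (w b) + wt w (tail G b, xs, i) = 1" using Cons.prems by (simp add: l)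
    then consider "w b = 1" "wt w (tail G b, xs, i) = 0" | "w b = 0" "wt w (tail G b, xs, i) = 1"
      using wt_nonneg[of w "(tail G b, xs, i)"] by linarith
    then show ?case
    proof cases
      case 1
      show ?thesis
        by (rule exI[of _ "[]"], rule exI[of _ b], rule exI[of _ xs])
          (use 1 b in \<open>auto simp: l paths_iff wf_digraph.head_in_verts[OF G]\<close>)
    next
      case 2
      from Cons.IH[OF b(3) 2(2)] obtain us a vs where *: "xs = us @ Arr a # vs" "a \<in> arcs G" "w a = 1"
        "(tail G b, us, head G a) \<in> paths G" "(tail G a, vs, i) \<in> paths G"
        "wt w (tail G b, us, head G a) = 0" "wt w (tail G a, vs, i) = 0"
        by blast
      show ?thesis
        by (rule exI[of _ "Arr b # us"], rule exI[of _ a], rule exI[of _ vs])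
          (use 2 * b in \<open>auto simp: l paths_iff words_Arr[OF G]\<close>)
    qed
  qed simp
  then show ?thesis using that by blast
qed

lemma E_mod_1_eq:
  fixes G :: "('v, 'e) pre_digraph"
  assumes G: "wf_digraph G"
  shows "E_mod G w 1 = (free_on {p \<in> paths G. wt w p = 1} :: ('v, 'e, 'k::field) form set)"
proof
  have "b \<cdot> arw G a \<cdot> b' \<in> (free_on {p \<in> paths G. wt w p = 1} :: ('v, 'e, 'k) form set)"
    if "a \<in> arcs G" "w a = 1" "b \<in> B_alg G w" "b' \<in> B_alg G w" for a b b'
  proof -
    have "arw G a \<in> (free_on {p \<in> paths G. wt w p = 1} :: ('v, 'e, 'k) form set)"
      using arw_in_path_alg[OF G that(1), where ?'c = 'k] that(2) by (auto simp: path_alg_def arw_def)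
    then have "b \<cdot> arw G a \<in> free_on {p \<in> paths G. wt w p = 1}"
      by (rule mul_free_on[OF that(3)[unfolded B_alg_eq[OF G]]]) (auto simp: paths_append[OF G])
    then show ?thesis
      by (rule mul_free_on[OF _ that(4)[unfolded B_alg_eq[OF G]]]) (auto simp: paths_append[OF G])
  qed
  then show "E_mod G w 1 \<subseteq> (free_on {p \<in> paths G. wt w p = 1} :: ('v, 'e, 'k) form set)"
    unfolding E_mod_def by (intro scal.span_minimal subspace_free_on) blast
  show "free_on {p \<in> paths G. wt w p = 1} \<subseteq> (E_mod G w 1 :: ('v, 'e, 'k) form set)"
  proof
    fix x :: "('v, 'e, 'k) form"
    assume "x \<in> free_on {p \<in> paths G. wt w p = 1}"
    then show "x \<in> E_mod G w 1"
    proof (rule lin_mem_subspace[OF _ lin_id])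
      show "scal.subspace (E_mod G w 1)" by (simp add: E_mod_def)
      fix p assume p: "p \<in> {p \<in> paths G. wt w p = 1}"
      obtain j xs i where eq: "p = (j, xs, i)" by (cases p)
      obtain us a vs where *: "xs = us @ Arr a # vs" "a \<in> arcs G" "w a = 1"
        "(j, us, head G a) \<in> paths G" "(tail G a, vs, i) \<in> paths G"
        "wt w (j, us, head G a) = 0" "wt w (tail G a, vs, i) = 0"
        using p weight_one_path[OF G, of j xs i w] unfolding eq by blast
      have "basis p = basis (j, us, head G a) \<cdot> arw G a \<cdot> basis (tail G a, vs, i)"
        by (simp add: eq *(1) arw_def)
      moreover have "basis (j, us, head G a) \<in> B_alg G w" "basis (tail G a, vs, i) \<in> B_alg G w"
        using * by (auto simp: B_alg_eq[OF G])
      ultimately show "basis p \<in> E_mod G w 1"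
        unfolding E_mod_def using *(2,3) by (intro scal.span_base) blast
    qed
  qed
qed

lemma E_mod_eqI:
  assumes G: "wf_digraph G" and x: "x \<in> E_mod G w 1" and "lin f" "lin g"
    and "\<And>q a p. q \<in> paths G \<Longrightarrow> p \<in> paths G \<Longrightarrow> a \<in> arcs G \<Longrightarrow> w a = 1 \<Longrightarrow>
      wt w q = 0 \<Longrightarrow> wt w p = 0 \<Longrightarrow> snd (snd q) = head G a \<Longrightarrow> fst p = tail G a \<Longrightarrow>
      f (basis q \<cdot> arw G a \<cdot> basis p) = g (basis q \<cdot> arw G a \<cdot> basis p)"
  shows "f x = g x"
proof (rule lin_eqI_on[OF x[unfolded E_mod_1_eq[OF G]] assms(3,4)])
  fix p assume p: "p \<in> {p \<in> paths G. wt w p = 1}"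
  obtain j xs i where eq: "p = (j, xs, i)" by (cases p)
  obtain us a vs where *: "xs = us @ Arr a # vs" "a \<in> arcs G" "w a = 1"
    "(j, us, head G a) \<in> paths G" "(tail G a, vs, i) \<in> paths G"
    "wt w (j, us, head G a) = 0" "wt w (tail G a, vs, i) = 0"
    using p weight_one_path[OF G, of j xs i w] unfolding eq by blast
  show "f (basis p) = g (basis p)"
    using assms(5)[OF *(4,5,2,3,6,7)] by (simp add: eq *(1) arw_def)
qed

lemma arw_E_mod:
  assumes "wf_digraph G" "a \<in> arcs G" "w a = 1"
  shows "arw G a \<in> E_mod G w 1"
  unfolding E_mod_1_eq[OF assms(1)]
  by (simp add: arw_def paths_iff words_Arr[OF assms(1)] wf_digraph.tail_in_verts[OF assms(1)] assms(2,3))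

lemma E_mod_mul_B:
  assumes G: "wf_digraph G" and "x \<in> E_mod G w 1" "b \<in> B_alg G w"
  shows "b \<cdot> x \<in> E_mod G w 1" "x \<cdot> b \<in> E_mod G w 1"
proof -
  have *: "x \<in> free_on {p \<in> paths G. wt w p = 1}" "b \<in> free_on {p \<in> paths G. wt w p = 0}"
    using assms by (simp_all add: E_mod_1_eq B_alg_eq)
  show "b \<cdot> x \<in> E_mod G w 1" "x \<cdot> b \<in> E_mod G w 1"
    unfolding E_mod_1_eq[OF G]
    by (rule mul_free_on[OF *(2,1)] mul_free_on[OF *(1,2)]; force simp: paths_append[OF G])+
qed

lemma path_der_B_alg:
  assumes G: "wf_digraph G" and t: "\<And>a. w a = 0 \<Longrightarrow> t a = 0" and x: "x \<in> B_alg G w"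
  shows "arrow_der G (path_coeff w \<theta>) t x = 0"
proof (rule lin_eqI_on[OF x[unfolded B_alg_def path_alg_def] lin_arrow_der[OF lin_id] lin_const_zero])
  fix p assume p: "p \<in> paths (weight0_quiver G w)"
  obtain j xs i where eq: "p = (j, xs, i)" by (cases p)
  have "arrow_der G (path_coeff w \<theta>) t (basis (j, xs, i)) = 0" if "(j, xs, i) \<in> paths (weight0_quiver G w)" for i
    using that
  proof (induction xs arbitrary: i rule: rev_induct)
    case (snoc l xs)
    obtain a where l: "l = Arr a" using snoc.prems by (cases l) (auto simp: paths_iff)
    have "(j, xs, head G a) \<in> paths (weight0_quiver G w)" "w a = 0"
      using snoc.prems words_Arr[OF wf_weight0_quiver[OF G]]
      by (auto simp: l paths_iff words_append[OF wf_weight0_quiver[OF G]]) (auto simp: weight0_quiver_def)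
    then show ?case by (simp add: l arrow_der_snoc_Arr snoc.IH t)
  qed simp
  then show "arrow_der G (path_coeff w \<theta>) t (basis p) = 0" using p by (simp add: eq)
qed

text \<open>As \<open>t\<close> vanishes on arrows of weight 0, the paths \<open>q\<close> and
  \<open>p\<close> have derivative 0; and \<open>q\<close>, being of weight 0, causes no
  sign.\<close>

lemma path_der_E_mod:
  assumes G: "wf_digraph G" and t0: "\<And>a. w a = 0 \<Longrightarrow> t a = 0"
    and a: "t a \<in> free_on (path_pairs G w (head G a) (tail G a) m)"
    and qp: "q \<in> paths G" "p \<in> paths G" "wt w q = 0" "wt w p = 0"
  shows "arrow_der G (path_coeff w \<theta>) t (basis q \<cdot> arw G a \<cdot> basis p) = outer_l (basis q) (outer_r (t a) (basis p))"
proof -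
  have B: "basis q \<in> B_alg G w" "basis p \<in> B_alg G w"
    using qp by (auto simp: B_alg_eq[OF G])
  have h: "homog w 0 0 (basis q)" "homog w (int (w a)) 0 (arw G a)"
    using qp by (auto simp: homog_iff paths_def arw_def)
  show ?thesis
    unfolding mul_assoc path_der_mul[OF h(1)] path_der_mul[OF h(2)]
    by (simp add: path_der_B_alg[OF G t0 B(1)] path_der_B_alg[OF G t0 B(2)] path_der_arw[where t = t, OF a])
qed

section \<open>The dual bimodule and its embedding into double derivations\<close>

lemma E1_dual_mul:
  assumes "f \<in> E1_dual G w" "x \<in> E_mod G w 1" "b \<in> B_alg G w"
  shows "f (b \<cdot> x) = outer_l b (f x)" "f (x \<cdot> b) = outer_r (f x) b"
  using assms by (auto simp: E1_dual_def)

lemma E1_dual_arw: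
  fixes f :: "('v, 'e, 'k::field) form \<Rightarrow> ('v, 'e, 'k) form2"
  assumes G: "wf_digraph G" and f: "f \<in> E1_dual G w" and a: "a \<in> arcs G" "w a = 1"
  shows "f (arw G a) \<in> free_on (path_pairs G w (head G a) (tail G a) 0)"
proof -
  note arw = arw_E_mod[where w = w, OF G a]
  have idem: "idem (head G a) \<in> (B_alg G w :: ('v, 'e, 'k) form set)"
    "idem (tail G a) \<in> (B_alg G w :: ('v, 'e, 'k) form set)"
    using a(1) G by (auto simp: B_alg_eq[OF G] idem_def paths_iff wf_digraph.head_in_verts wf_digraph.tail_in_verts)
  have l: "outer_l (idem (head G a)) (f (arw G a)) = f (arw G a)" "outer_r (f (arw G a)) (idem (tail G a)) = f (arw G a)"
    by (simp_all flip: E1_dual_mul[OF f arw idem(1)] E1_dual_mul[OF f arw idem(2)])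
      (simp_all add: arw_def idem_def)
  have "f (arw G a) \<in> free_on (paths (weight0_quiver G w) \<times> paths (weight0_quiver G w))"
    using f arw by (auto simp: E1_dual_def)
  then have "outer_l (idem (head G a)) (outer_r (f (arw G a)) (idem (tail G a))) \<in>
      free_on (path_pairs G w (head G a) (tail G a) 0)"
    unfolding idem_def
    by (intro outer_l_free_on[of _ "{(head G a, [], head G a)}" _
          "{(u, v). u \<in> paths G \<and> v \<in> paths G \<and> wt w u = 0 \<and> wt w v = 0 \<and> snd (snd v) = tail G a}"]
        outer_r_free_on[of _ _ _ "{(tail G a, [], tail G a)}"])
      (auto simp: path_pairs_def paths_weight0_quiver[OF G])
  then show ?thesis by (simp add: l)
qed

text \<open>Extension by 0 to the arrows of other weights, as in the passage from a dual element to
  a double derivation of weight -1.\<close>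

definition weight1_part :: "('e \<Rightarrow> nat) \<Rightarrow> ('e \<Rightarrow> ('v, 'e, 'k::field) form2) \<Rightarrow> 'e \<Rightarrow> ('v, 'e, 'k) form2" where
  "weight1_part w t a = (if w a = 1 then t a else 0)"

text \<open>Every \<open>\<theta>\<close> is admissible, since what stands to the left of the arrow
  of weight 1 has weight 0 and causes no sign. The value 0 serves to compare dual elements, the
  value -1 to compare them with double derivations.\<close>

lemma E1_dual_eq_path_der:
  fixes f :: "('v, 'e, 'k::field) form \<Rightarrow> ('v, 'e, 'k) form2"
  assumes G: "wf_digraph G" and f: "f \<in> E1_dual G w" and x: "x \<in> E_mod G w 1"
  shows "f x = arrow_der G (path_coeff w \<theta>) (weight1_part w (\<lambda>a. f (arw G a))) x"
proof -
  let ?K = "arrow_der G (path_coeff w \<theta>) (weight1_part w (\<lambda>a. f (arw G a)))"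
  have lin: "linear_on (E_mod G w 1) f" using f by (simp add: E1_dual_def)
  have bas: "f (basis r) = ?K (basis r)" if r: "r \<in> {p \<in> paths G. wt w p = 1}" for r
  proof -
    obtain j xs i where eq: "r = (j, xs, i)" by (cases r)
    obtain us a vs where *: "xs = us @ Arr a # vs" "a \<in> arcs G" "w a = 1"
      "(j, us, head G a) \<in> paths G" "(tail G a, vs, i) \<in> paths G"
      "wt w (j, us, head G a) = 0" "wt w (tail G a, vs, i) = 0"
      using r weight_one_path[OF G, of j xs i w] unfolding eq by blast
    let ?q = "(j, us, head G a)" and ?p = "(tail G a, vs, i)"
    have B: "basis ?q \<in> (B_alg G w :: ('v, 'e, 'k) form set)" "basis ?p \<in> (B_alg G w :: ('v, 'e, 'k) form set)"
      using * by (auto simp: B_alg_eq[OF G])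
    have r_eq: "basis r = (basis ?q \<cdot> (arw G a \<cdot> basis ?p) :: ('v, 'e, 'k) form)"
      by (simp add: eq *(1) arw_def)
    have E: "arw G a \<cdot> basis ?p \<in> (E_mod G w 1 :: ('v, 'e, 'k) form set)"
      "arw G a \<in> (E_mod G w 1 :: ('v, 'e, 'k) form set)"
      using arw_E_mod[where w = w, OF G *(2,3)] E_mod_mul_B[OF G _ B(2)] by auto
    have "f (basis r) = outer_l (basis ?q) (outer_r (f (arw G a)) (basis ?p))"
      unfolding r_eq by (simp only: E1_dual_mul(1)[OF f E(1) B(1)] E1_dual_mul(2)[OF f E(2) B(2)])
    also have "\<dots> = ?K (basis ?q \<cdot> arw G a \<cdot> basis ?p)"
      using E1_dual_arw[OF G f *(2,3)] *
      by (subst path_der_E_mod[OF G _ _ *(4,5)]) (auto simp: weight1_part_def)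
    finally show ?thesis by (simp add: r_eq mul_assoc)
  qed
  let ?S = "{x \<in> E_mod G w 1. f x = ?K x}"
  have sub0: "scal.subspace (E_mod G w 1)" by (simp add: E_mod_def)
  have "f (scal 0 0) = scal 0 (f 0)" using lin scal.subspace_0[OF sub0] unfolding linear_on_def by blast
  then have "f 0 = 0" by simp
  then have "scal.subspace ?S"
    using lin sub0 by (auto simp: scal.subspace_def linear_on_def)
  from lin_mem_subspace[OF x[unfolded E_mod_1_eq[OF G]] lin_id this] bas have "x \<in> ?S"
    by (simp add: E_mod_1_eq[OF G])
  then show ?thesis by blast
qed

lemma E1_dual_eqI:
  assumes G: "wf_digraph G" and f: "f \<in> E1_dual G w" "f' \<in> E1_dual G w"
    and "\<And>a. a \<in> arcs G \<Longrightarrow> w a = 1 \<Longrightarrow> f (arw G a) = f' (arw G a)"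
  shows "f = f'"
proof
  fix x
  show "f x = f' x"
  proof (cases "x \<in> E_mod G w 1")
    case True
    then show ?thesis
      unfolding E1_dual_eq_path_der[OF G f(1) True, of 0] E1_dual_eq_path_der[OF G f(2) True, of 0]
    proof (rule E_mod_eqI[OF G _ lin_arrow_der[OF lin_id] lin_arrow_der[OF lin_id]], goal_cases)
      case (1 q a p)
      then show ?case
        using assms(4)[of a] E1_dual_arw[OF G f(1), of a] E1_dual_arw[OF G f(2), of a]
        by (subst (1 2) path_der_E_mod[OF G]) (auto simp: weight1_part_def)
    qed
  next
    case False
    then show ?thesis using f by (simp add: E1_dual_def)
  qed
qed

definition E1_dual_of ::
  "('v, 'e) pre_digraph \<Rightarrow> ('e \<Rightarrow> nat) \<Rightarrow> ('e \<Rightarrow> ('v, 'e, 'k::field) form2) \<Rightarrow>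
   (('v, 'e, 'k) form \<Rightarrow> ('v, 'e, 'k) form2)" where
  "E1_dual_of G w t x =
     (if x \<in> E_mod G w 1 then arrow_der G (path_coeff w 0) (weight1_part w t) x else 0)"

lemma weight1_part_path_pairs:
  assumes "\<And>a. a \<in> arcs G \<Longrightarrow> w a = 1 \<Longrightarrow> t a \<in> free_on (path_pairs G w (head G a) (tail G a) 0)" "a \<in> arcs G"
  shows "weight1_part w t a \<in> free_on (path_pairs G w (head G a) (tail G a) (int (w a) + - 1))"
  using assms by (auto simp: weight1_part_def)

lemma E1_dual_of_E1_dual:
  fixes t :: "'e \<Rightarrow> ('v, 'e, 'k::field) form2"
  assumes G: "wf_digraph G"
    and t: "\<And>a. a \<in> arcs G \<Longrightarrow> w a = 1 \<Longrightarrow> t a \<in> free_on (path_pairs G w (head G a) (tail G a) 0)"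
  shows "E1_dual_of G w t \<in> E1_dual G w"
proof -
  let ?K = "arrow_der G (path_coeff w 0) (weight1_part w t)"
  have sub: "x + y \<in> E_mod G w 1" "scal c x \<in> E_mod G w 1" if "x \<in> E_mod G w 1" "y \<in> E_mod G w 1"
    for x y :: "('v, 'e, 'k) form" and c
    using that by (auto simp: E_mod_1_eq[OF G] free_on_add)
  have K0: "?K b = 0" if "b \<in> B_alg G w" for b
    by (rule path_der_B_alg[OF G _ that]) (simp add: weight1_part_def)
  have vals: "?K x \<in> free_on (paths (weight0_quiver G w) \<times> paths (weight0_quiver G w))"
    if x: "x \<in> E_mod G w 1" for x
  proof (rule lin_mem_subspace[OF x[unfolded E_mod_1_eq[OF G]] lin_arrow_der[OF lin_id] subspace_free_on])
    fix p assume p: "p \<in> {p \<in> paths G. wt w p = 1}"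
    obtain j xs i where eq: "p = (j, xs, i)" by (cases p)
    have "?K (basis p) \<in> free_on (path_pairs G w j i (wt w (j, xs, i) + - 1))"
      unfolding eq using p by (intro path_der_free_on[OF G weight1_part_path_pairs[OF t]]) (auto simp: eq)
    then show "?K (basis p) \<in> free_on (paths (weight0_quiver G w) \<times> paths (weight0_quiver G w))"
    proof (rule subsetD[OF free_on_mono, rotated], intro subsetI)
      fix z assume z: "z \<in> path_pairs G w j i (wt w (j, xs, i) + - 1)"
      obtain u v where uv: "z = (u, v)" by (cases z)
      \<comment> \<open>The total weight 1 - 1 = 0 forces both tensor factors to have weight 0, so
        they lie in \<open>B_alg G w\<close>.\<close>
      show "z \<in> paths (weight0_quiver G w) \<times> paths (weight0_quiver G w)"
        using z p wt_nonneg[of w u] wt_nonneg[of w v]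
        unfolding uv eq path_pairs_def paths_weight0_quiver[OF G] by auto
    qed
  qed
  have mul: "?K (b \<cdot> x) = outer_l b (?K x)" "?K (x \<cdot> b) = outer_r (?K x) b"
    if "x \<in> E_mod G w 1" "b \<in> B_alg G w" for x b
  proof -
    have h: "homog w 0 0 b" "homog w 1 0 x"
      using that by (auto simp: E_mod_1_eq[OF G] B_alg_eq[OF G] homog_def free_on_def paths_def)
    show "?K (b \<cdot> x) = outer_l b (?K x)" "?K (x \<cdot> b) = outer_r (?K x) b"
      by (simp_all add: path_der_mul[OF h(1)] path_der_mul[OF h(2)] K0[OF that(2)])
  qed
  show ?thesis
    by (simp add: E1_dual_def E1_dual_of_def linear_on_def sub vals mul E_mod_mul_B[OF G])
qed

lemma E1_dual_of_arw:
  assumes "wf_digraph G" "a \<in> arcs G" "w a = 1"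
    and "t a \<in> free_on (path_pairs G w (head G a) (tail G a) m)"
  shows "E1_dual_of G w t (arw G a) = t a"
  using path_der_arw[of "weight1_part w t" a G w m 0] assms(3,4)
  by (simp add: E1_dual_of_def arw_E_mod[where w = w, OF assms(1-3)] weight1_part_def)

lemma dual_to_DDer_eq:
  fixes f :: "('v, 'e, 'k::field) form \<Rightarrow> ('v, 'e, 'k) form2"
  assumes G: "fin_digraph G" and f: "f \<in> E1_dual G w"
  shows "dual_to_DDer G w f = path_double_der G w (- 1) (weight1_part w (\<lambda>a. f (arw G a)))" (is "_ = ?T")
    and "path_double_der G w (- 1) (weight1_part w (\<lambda>a. f (arw G a))) \<in> DDer G w (- 1)"
proof -
  interpret fin_digraph G by fact
  have t: "weight1_part w (\<lambda>a. f (arw G a)) a \<in> free_on (path_pairs G w (head G a) (tail G a) (int (w a) + - 1))"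
    if "a \<in> arcs G" for a
    by (rule weight1_part_path_pairs[OF _ that]) (rule E1_dual_arw[OF wf_digraph f])
  show T: "?T \<in> DDer G w (- 1)"
    by (rule path_double_der_DDer[OF wf_digraph t])
  have arw: "?T (arw G a) = weight1_part w (\<lambda>a. f (arw G a)) a" if "a \<in> arcs G" for a
    by (rule path_double_der_arw[where t = "weight1_part w (\<lambda>a. f (arw G a))", OF wf_digraph that t[OF that]])
  have sub: "E_mod G w 1 \<subseteq> (path_alg G :: ('v, 'e, 'k) form set)"
    by (auto simp: E_mod_1_eq[OF wf_digraph] path_alg_def free_on_def)
  show "dual_to_DDer G w f = ?T"
    unfolding dual_to_DDer_def
  proof (rule the_equality)
    show "?T \<in> DDer G w (- 1) \<and> (\<forall>x\<in>E_mod G w 1. ?T x = f x) \<and> (\<forall>b\<in>arcs G. w b \<noteq> 1 \<longrightarrow> ?T (arw G b) = 0)"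
    proof (intro conjI ballI impI T)
      show "?T x = f x" if "x \<in> E_mod G w 1" for x
        using that subsetD[OF sub that]
        by (simp add: path_double_der_def E1_dual_eq_path_der[OF wf_digraph f, of _ "- 1"])
      show "?T (arw G b) = 0" if "b \<in> arcs G" "w b \<noteq> 1" for b
        using that by (simp add: arw weight1_part_def)
    qed
    fix S assume S: "S \<in> DDer G w (- 1) \<and> (\<forall>x\<in>E_mod G w 1. S x = f x) \<and> (\<forall>b\<in>arcs G. w b \<noteq> 1 \<longrightarrow> S (arw G b) = 0)"
    show "S = ?T"
      by (rule DDer_eqI[OF G conjunct1[OF S] T])
        (use S arw arw_E_mod[OF wf_digraph, of _ w] in \<open>auto simp: weight1_part_def\<close>)
  qed
qed

section \<open>Projection to the weight one part\<close>

text \<open>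
  On words with one bar: erase the bar if the part to its right has weight \<open>1\<close>.  A form \<open>q dx p\<close>
  with \<open>x\<close>, \<open>p\<close> of weights \<open>1\<close>, \<open>0\<close> is the difference of a word with weight \<open>1\<close> and one with
  weight \<open>0\<close> to the right of the bar, while for \<open>x\<close> of weight \<open>0\<close> the two contributions cancel.
\<close>

definition bar_proj :: "('e \<Rightarrow> nat) \<Rightarrow> ('v, 'e, 'k::field) form \<Rightarrow> ('v, 'e, 'k) form" where
  "bar_proj w = lin_ext (\<lambda>(j, ls, i).
     if wt w (j, tl (dropWhile (\<lambda>l. l \<noteq> Bar) ls), i) = 1 then basis (unbar (j, ls, i)) else 0)"

lemma lin_bar_proj: "lin f \<Longrightarrow> lin (\<lambda>x. bar_proj w (f x))"
  unfolding bar_proj_def by (rule lin_ext_comp)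

lemma bar_proj_basis:
  fixes j :: 'v and w :: "'e \<Rightarrow> nat"
  assumes "Bar \<notin> set us" "Bar \<notin> set vs"
  shows "bar_proj w (basis (j, us @ Bar # vs, i)) =
    (if wt w (k, vs, i) = 1 then basis (j, us @ vs, i) else 0 :: ('v, 'e, 'k::field) form)"
proof -
  have "dropWhile (\<lambda>l. l \<noteq> Bar) (us @ Bar # vs) = Bar # vs"
    using assms(1) by (induction us) auto
  then show ?thesis using assms by (simp add: bar_proj_def filter_not_Bar)
qed

lemma bar_proj_diff:
  fixes G :: "('v, 'e) pre_digraph"
  assumes G: "fin_digraph G" and xs: "(j', xs, k) \<in> paths G" and "Bar \<notin> set us" "Bar \<notin> set vs"
  shows "bar_proj w (basis (j, us, j') \<cdot> diff G (basis (j', xs, k)) \<cdot> basis (k, vs, i)) =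
    ((if wt w (j', xs, k) + wt w (k, vs, i) = 1 then basis (j, us @ xs @ vs, i) else 0) -
     (if wt w (k, vs, i) = 1 then basis (j, us @ xs @ vs, i) else 0) :: ('v, 'e, 'k::field) form)"
proof -
  have *: "Bar \<notin> set xs" "(j', xs, k) \<in> words G" using xs by (auto simp: paths_iff)
  have "bar_proj w (basis (j, us @ Bar # xs @ vs, i)) =
      (if wt w (j', xs, k) + wt w (k, vs, i) = 1 then basis (j, us @ xs @ vs, i) else 0 :: ('v, 'e, 'k) form)"
    using bar_proj_basis[where us = us and vs = "xs @ vs" and w = w and j = j and i = i and k = k and ?'k = 'k] *(1) assms by simp
  moreover have "bar_proj w (basis (j, us @ xs @ Bar # vs, i)) =
      (if wt w (k, vs, i) = 1 then basis (j, us @ xs @ vs, i) else 0 :: ('v, 'e, 'k) form)"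
    using bar_proj_basis[where us = "us @ xs" and vs = vs and w = w and j = j and i = i and k = k and ?'k = 'k] *(1) assms by simp
  ultimately show ?thesis
    using *(2) assms(1) by (simp add: diff_basis lin_diff[OF lin_bar_proj[OF lin_id]])
qed

lemma bar_proj_E:
  fixes x :: "('v, 'e, 'k::field) form"
  assumes G: "fin_digraph G" and "b \<in> B_alg G w" "x \<in> E_mod G w 1" "b' \<in> B_alg G w"
  shows "bar_proj w (b \<cdot> diff G x \<cdot> b') = b \<cdot> x \<cdot> b'"
proof -
  interpret fin_digraph G by fact
  show ?thesis
  proof (rule lin_eqI3[of "\<lambda>b x b'. bar_proj w (b \<cdot> diff G x \<cdot> b')" "\<lambda>b x b'. b \<cdot> x \<cdot> b'",
        OF _ _ _ _ _ _ _ assms(2)[unfolded B_alg_eq[OF wf_digraph]] assms(3)[unfolded E_mod_1_eq[OF wf_digraph]]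
          assms(4)[unfolded B_alg_eq[OF wf_digraph]]])
    fix p q r
    assume *: "p \<in> {p \<in> paths G. wt w p = 0}" "q \<in> {p \<in> paths G. wt w p = 1}" "r \<in> {p \<in> paths G. wt w p = 0}"
    obtain j us i' j' xs k k' vs i where eq: "p = (j, us, i')" "q = (j', xs, k)" "r = (k', vs, i)"
      by (cases p; cases q; cases r)
    have q: "(j', xs, k) \<in> words G" using * by (simp add: eq paths_iff)
    show "(bar_proj w (basis p \<cdot> diff G (basis q) \<cdot> basis r) :: ('v, 'e, 'k) form) = basis p \<cdot> basis q \<cdot> basis r"
    proof (cases "i' = j' \<and> k = k'")
      case True
      then show ?thesis
        using * bar_proj_diff[OF G, of j' xs k us vs w j i]
        by (simp add: eq paths_iff)
    next
      case False
      then have "(basis p \<cdot> diff G (basis q) \<cdot> basis r :: ('v, 'e, 'k) form) = 0"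
        unfolding eq by (auto simp: diff_basis[OF G q])
      with False show ?thesis
        by (auto simp: eq lin_zero[OF lin_bar_proj[OF lin_id]])
    qed
  qed (intro lin_intros lin_bar_proj)+
qed

lemma bar_proj_weight0:
  fixes x :: "('v, 'e, 'k::field) form"
  assumes G: "fin_digraph G" and "x \<in> path_alg G" "b \<in> B_alg G w" "y \<in> path_alg G"
  shows "bar_proj w (x \<cdot> diff G b \<cdot> y) = 0"
proof -
  interpret fin_digraph G by fact
  show ?thesis
  proof (rule lin_eqI3[of "\<lambda>x b y. bar_proj w (x \<cdot> diff G b \<cdot> y)" "\<lambda>x b y. 0",
        OF _ _ _ _ _ _ _ assms(2)[unfolded path_alg_def] assms(3)[unfolded B_alg_eq[OF wf_digraph]]
          assms(4)[unfolded path_alg_def]])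
    fix p q r
    assume *: "p \<in> paths G" "q \<in> {p \<in> paths G. wt w p = 0}" "r \<in> paths G"
    obtain j us i' j' xs k k' vs i where eq: "p = (j, us, i')" "q = (j', xs, k)" "r = (k', vs, i)"
      by (cases p; cases q; cases r)
    have q: "(j', xs, k) \<in> words G" using * by (simp add: eq paths_iff)
    show "(bar_proj w (basis p \<cdot> diff G (basis q) \<cdot> basis r) :: ('v, 'e, 'k) form) = 0"
    proof (cases "i' = j' \<and> k = k'")
      case True
      then show ?thesis
        using * bar_proj_diff[OF G, of j' xs k us vs w j i]
        by (simp add: eq paths_iff)
    next
      case False
      then have "(basis p \<cdot> diff G (basis q) \<cdot> basis r :: ('v, 'e, 'k) form) = 0"
        unfolding eq by (auto simp: diff_basis[OF G q])
      then show ?thesis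
        by (auto simp: lin_zero[OF lin_bar_proj[OF lin_id]])
    qed
  qed (intro lin_intros lin_bar_proj lin_const_zero)+
qed

text \<open>The specification determines the value on each form q da p of weight 1: either
  \<open>a\<close> has weight 1 and \<open>q\<close>, \<open>p\<close> lie in
  \<open>B_alg G w\<close>, or \<open>a\<close> has weight 0 and is itself an element of
  \<open>B_alg G w\<close>, so that the form is sent to 0.\<close>

lemma proj_E1_eq_bar_proj:
  fixes \<alpha> :: "('v, 'e, 'k::field) form"
  assumes G: "fin_digraph G" and \<alpha>: "\<alpha> \<in> Omega1 G" "homog w 1 1 \<alpha>"
  shows "proj_E1 G w \<alpha> = bar_proj w \<alpha>"
proof -
  interpret fin_digraph G by fact
  let ?V = "{\<alpha> \<in> Omega1 G. homog w 1 1 \<alpha>} :: ('v, 'e, 'k) form set"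
  define C :: "(('v, 'e, 'k) form \<Rightarrow> ('v, 'e, 'k) form) \<Rightarrow> bool" where
    "C = (\<lambda>\<pi>. linear_on ?V \<pi> \<and>
     (\<forall>x\<in>E_mod G w 1. \<forall>b\<in>B_alg G w. \<forall>b'\<in>B_alg G w. \<pi> (b \<cdot> diff G x \<cdot> b') = b \<cdot> x \<cdot> b') \<and>
     (\<forall>x\<in>path_alg G. \<forall>y\<in>path_alg G. \<forall>b\<in>B_alg G w.
        homog w 1 1 (x \<cdot> diff G b \<cdot> y) \<longrightarrow> \<pi> (x \<cdot> diff G b \<cdot> y) = 0))"
  have "C (bar_proj w)"
    unfolding C_def
    by (simp add: bar_proj_E[OF G] bar_proj_weight0[OF G] linear_on_def
        lin_add[OF lin_bar_proj[OF lin_id]] lin_scal[OF lin_bar_proj[OF lin_id]])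
  then have proj: "C (proj_E1 G w)"
    unfolding proj_E1_def C_def by (rule someI[of _ "bar_proj w"])
  have sub: "scal.subspace ?V"
    using subspace_Omega1[of G] by (auto simp: scal.subspace_def homog_iff free_on_add)
  let ?S = "{\<alpha> \<in> ?V. proj_E1 G w \<alpha> = bar_proj w \<alpha>}"
  have lin: "linear_on ?V (proj_E1 G w)" using proj by (simp add: C_def)
  have "proj_E1 G w (scal 0 0) = scal 0 (proj_E1 G w (0 :: ('v, 'e, 'k) form))"
    using lin scal.subspace_0[OF sub] unfolding linear_on_def by blast
  then have "proj_E1 G w (0 :: ('v, 'e, 'k) form) = 0" by simp
  then have subS: "scal.subspace ?S"
    using lin sub unfolding scal.subspace_def linear_on_def
    by (auto simp: lin_zero[OF lin_bar_proj[OF lin_id]]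
        lin_add[OF lin_bar_proj[OF lin_id]] lin_scal[OF lin_bar_proj[OF lin_id]])
  have "one_form G q a p \<in> ?S"
    if *: "q \<in> paths G" "p \<in> paths G" "a \<in> arcs G" "wt w q + int (w a) + wt w p = 1" for q a p
  proof -
    have "homog w (wt w q + int (w a) + wt w p) (0 + 1 + 0) (one_form G q a p :: ('v, 'e, 'k) form)"
      unfolding one_form_def
      by (intro homog_mul diff_arw_homog[OF G *(3)]) (use * in \<open>auto simp: homog_iff paths_def\<close>)
    then have V: "one_form G q a p \<in> ?V"
      using one_form_Omega1[OF G *(3,1,2)] *(4) by simp
    have alg: "basis q \<in> (path_alg G :: ('v, 'e, 'k) form set)" "basis p \<in> (path_alg G :: ('v, 'e, 'k) form set)"
      using *(1,2) by (simp_all add: path_alg_def)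
    consider "w a = 1" "wt w q = 0" "wt w p = 0" | "w a = 0"
      using *(4) wt_nonneg[of w q] wt_nonneg[of w p] by linarith
    then have "proj_E1 G w (one_form G q a p) = (bar_proj w (one_form G q a p) :: ('v, 'e, 'k) form)"
    proof cases
      case 1
      then have "basis q \<in> (B_alg G w :: ('v, 'e, 'k) form set)" "basis p \<in> (B_alg G w :: ('v, 'e, 'k) form set)"
        using *(1,2) by (simp_all add: B_alg_eq[OF wf_digraph])
      moreover have "arw G a \<in> (E_mod G w 1 :: ('v, 'e, 'k) form set)"
        by (rule arw_E_mod[where w = w, OF wf_digraph *(3) 1(1)])
      ultimately show ?thesis
        using proj by (simp add: C_def one_form_def bar_proj_E[OF G])
    next
      case 2
      then have "arw G a \<in> (B_alg G w :: ('v, 'e, 'k) form set)"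
        using arw_in_path_alg[OF wf_digraph *(3), where ?'c = 'k]
        by (simp add: B_alg_eq[OF wf_digraph] path_alg_def arw_def)
      with alg V show ?thesis
        using proj by (simp add: C_def one_form_def bar_proj_weight0[OF G])
    qed
    with V show ?thesis by simp
  qed
  then have "lspan {one_form G q a p | q a p. q \<in> paths G \<and> p \<in> paths G \<and> a \<in> arcs G \<and>
    snd (snd q) = head G a \<and> fst p = tail G a \<and> wt w q + int (w a) + wt w p = 1} \<subseteq> ?S"
    by (intro scal.span_minimal[OF _ subS]) blast
  with Omega1_homog_span[OF G \<alpha>] show ?thesis by blast
qed

section \<open>The isomorphism in weight one\<close>

text \<open>What \<open>symp_term\<close> becomes after projecting dc to \<open>c\<close>; in weight
  1 its sign is +1.\<close>

definition symp_E1_term ::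
  "('v, 'e) pre_digraph \<Rightarrow> 'e \<Rightarrow> ('v, 'e, 'k::field) form2 \<Rightarrow> ('v, 'e, 'k) form" where
  "symp_E1_term G c = lin_ext (\<lambda>(u, v). basis v \<cdot> arw G c \<cdot> basis u)"

lemma lin_symp_E1_term: "lin f \<Longrightarrow> lin (\<lambda>x. symp_E1_term G c (f x))"
  unfolding symp_E1_term_def by (rule lin_ext_comp)

lemma path_pairs_0:
  "path_pairs G w h t 0 = {(u, v). u \<in> paths G \<and> v \<in> paths G \<and> wt w u = 0 \<and> wt w v = 0 \<and> fst u = h \<and> snd (snd v) = t}"
  unfolding path_pairs_def
  using wt_nonneg[of w] by (auto simp: add_nonneg_eq_0_iff)

lemma weight_star:
  fixes w :: "'e dbl \<Rightarrow> nat"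
  assumes "\<forall>a\<in>arcs P. w (Fwd a) + w (Rev a) = 2" "c \<in> arcs (double_quiver P)"
  shows "w (star c) = 1 \<longleftrightarrow> w c = 1"
  using path_pairs_star[OF assms] by auto

lemma iota1_eq:
  fixes f :: "('v, 'e dbl, 'k::field) form \<Rightarrow> ('v, 'e dbl, 'k) form2"
  assumes P: "fin_digraph P" and w: "\<forall>a\<in>arcs P. w (Fwd a) + w (Rev a) = 2"
    and f: "f \<in> E1_dual (double_quiver P) w"
  shows "iota1 (double_quiver P) w (dr_class (double_quiver P) w (symp_form P)) f =
    (\<Sum>c\<in>{c \<in> arcs (double_quiver P). w c = 1}.
      symp_E1_term (double_quiver P) c (f (arw (double_quiver P) (star c))))"
proof -
  let ?Q = "double_quiver P"
  interpret Q: fin_digraph ?Q by (rule fin_double_quiver[OF P])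
  note Q = fin_double_quiver[OF P]
  define t where "t = weight1_part w (\<lambda>a. f (arw ?Q a))"
  have t: "t a \<in> free_on (path_pairs ?Q w (head ?Q a) (tail ?Q a) (int (w a) + - 1))" if "a \<in> arcs ?Q" for a
    unfolding t_def by (rule weight1_part_path_pairs[OF _ that]) (rule E1_dual_arw[OF Q.wf_digraph f])
  let ?T = "path_double_der ?Q w (- 1) t"
  have T: "dual_to_DDer ?Q w f = ?T" "?T \<in> DDer ?Q w (- 1)"
    using dual_to_DDer_eq[OF Q f] by (simp_all add: t_def)
  have "iota ?Q w (dr_class ?Q w (symp_form P)) (- 1) ?T = symp_iota P w (- 1) t"
    unfolding iota_canonical_form[OF P T(2)] symp_iota_def
    by (rule sum.cong) (simp_all add: path_double_der_arw[where t = t, OF Q.wf_digraph _ t])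
  moreover have "symp_iota P w (- 1) t \<in> {\<alpha> \<in> Omega1 ?Q. homog w (- 1 + 2) 1 \<alpha>}"
    by (rule symp_iota_Omega1[OF P w t])
  moreover have t': "t b \<in> free_on {(u, v). fdeg u = 0 \<and> fdeg v = 0}" if "b \<in> arcs ?Q" for b
    by (rule subsetD[OF free_on_mono t[OF that]]) (auto simp: path_pairs_def paths_def)
  moreover have "bar_proj w (symp_term P w (- 1) c (t (star c))) =
      (if w c = 1 then symp_E1_term ?Q c (f (arw ?Q (star c))) else 0)" if c: "c \<in> arcs ?Q" for c
  proof (cases "w c = 1")
    case True
    have ts: "t (star c) = f (arw ?Q (star c))"
      using True c by (simp add: t_def weight1_part_def weight_star[OF w])
    have "f (arw ?Q (star c)) \<in> free_on (path_pairs ?Q w (tail ?Q c) (head ?Q c) 0)"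
      using E1_dual_arw[OF Q.wf_digraph f, of "star c"] True c by (simp add: weight_star[OF w])
    then have "bar_proj w (symp_term P w (- 1) c (f (arw ?Q (star c)))) = symp_E1_term ?Q c (f (arw ?Q (star c)))"
    proof (rule lin_eqI_on[OF _ lin_bar_proj[OF lin_symp_term] lin_symp_E1_term[OF lin_id]])
      fix p assume p: "p \<in> path_pairs ?Q w (tail ?Q c) (head ?Q c) 0"
      obtain u v where uv: "p = (u, v)" by (cases p)
      have *: "u \<in> paths ?Q" "v \<in> paths ?Q" "wt w u = 0" "wt w v = 0"
        using p by (auto simp: uv path_pairs_0)
      \<comment> \<open>The paths \<open>u\<close> and \<open>v\<close> have weight 0, so the
        exponent is -1 - 1 = -2 for a forward arrow and 0 for a reverse one.\<close>
      have "symp_sign w (- 1) c u v = (1 :: 'k)"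
        using True * by (cases c) (auto simp: ksign_def)
      moreover have "bar_proj w (basis v \<cdot> diff ?Q (arw ?Q c) \<cdot> basis u) = (basis v \<cdot> arw ?Q c \<cdot> basis u :: ('v, 'e dbl, 'k) form)"
        by (rule bar_proj_E[OF Q _ arw_E_mod[where w = w, OF Q.wf_digraph c True]])
          (use * in \<open>simp_all add: B_alg_eq[OF Q.wf_digraph]\<close>)
      ultimately show "(bar_proj w (symp_term P w (- 1) c (basis p)) :: ('v, 'e dbl, 'k) form) = symp_E1_term ?Q c (basis p)"
        by (simp add: uv symp_term_basis symp_E1_term_def one_form_def)
    qed
    then show ?thesis using True by (simp add: ts)
  next
    case False
    then show ?thesis
      using c by (simp add: t_def weight1_part_def weight_star[OF w] lin_zero[OF lin_symp_term]
          lin_zero[OF lin_bar_proj[OF lin_id]])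
  qed
  ultimately show ?thesis
    by (simp add: iota1_def T(1) proj_E1_eq_bar_proj[OF Q] symp_iota_eq[OF P]
        lin_sum[OF lin_bar_proj[OF lin_id]] sum.inter_filter flip: sum.inter_filter)
qed

lemma E1_dual_add: "f \<in> E1_dual G w \<Longrightarrow> f' \<in> E1_dual G w \<Longrightarrow> f + f' \<in> E1_dual G w"
  by (auto simp: E1_dual_def linear_on_def free_on_add scal.scale_right_distrib)

lemma E1_dual_l_closed:
  assumes G: "wf_digraph G" and b: "b \<in> B_alg G w" and f: "f \<in> E1_dual G w"
  shows "E1_dual_l w b f \<in> E1_dual G w"
proof -
  have b0: "b \<in> free_on {p. wt w p = 0}" if "b \<in> B_alg G w" for b :: "('a, 'b, 'c) form"
    using that by (auto simp: B_alg_eq[OF G] free_on_def)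
  have "inner_l w b (f x) \<in> free_on (paths (weight0_quiver G w) \<times> paths (weight0_quiver G w))"
    if "x \<in> E_mod G w 1" for x
  proof -
    have "f x \<in> free_on (paths (weight0_quiver G w) \<times> paths (weight0_quiver G w))"
      using f that by (auto simp: E1_dual_def)
    then show ?thesis
      by (rule inner_l_free_on[OF b[unfolded B_alg_def path_alg_def]])
        (auto simp: paths_append[OF wf_weight0_quiver[OF G]])
  qed
  then show ?thesis
    using f b by (auto simp: E1_dual_def E1_dual_l_def linear_on_def inner_l_outer_r inner_l_outer_l[OF b0 b0])
qed

lemma E1_dual_r_closed:
  assumes G: "wf_digraph G" and b: "b \<in> B_alg G w" and f: "f \<in> E1_dual G w"
  shows "E1_dual_r w f b \<in> E1_dual G w"
proof -
  have b0: "b \<in> free_on {p. wt w p = 0}" if "b \<in> B_alg G w" for b :: "('a, 'b, 'c) form"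
    using that by (auto simp: B_alg_eq[OF G] free_on_def)
  have "inner_r w (f x) b \<in> free_on (paths (weight0_quiver G w) \<times> paths (weight0_quiver G w))"
    if "x \<in> E_mod G w 1" for x
  proof -
    have "f x \<in> free_on (paths (weight0_quiver G w) \<times> paths (weight0_quiver G w))"
      using f that by (auto simp: E1_dual_def)
    then show ?thesis
      by (rule inner_r_free_on[OF _ b[unfolded B_alg_def path_alg_def]])
        (auto simp: paths_append[OF wf_weight0_quiver[OF G]])
  qed
  then show ?thesis
    using f b by (auto simp: E1_dual_def E1_dual_r_def linear_on_def inner_r_outer_l inner_r_outer_r[OF b0 b0])
qed

text \<open>The inner left action multiplies \<open>v\<close>, which stands leftmost in
  \<open>v c u\<close>; all weights involved in its sign are 0.\<close>

lemma symp_E1_term_inner_l: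
  assumes G: "wf_digraph G" and b: "b \<in> B_alg G w" and T: "T \<in> free_on (path_pairs G w h t 0)"
  shows "symp_E1_term G c (inner_l w b T) = b \<cdot> symp_E1_term G c T"
proof (rule lin_eqI2[of "\<lambda>b T. symp_E1_term G c (inner_l w b T)" "\<lambda>b T. b \<cdot> symp_E1_term G c T",
      OF _ _ _ _ _ b[unfolded B_alg_eq[OF G]] T])
  fix p z assume p: "p \<in> {p \<in> paths G. wt w p = 0}" and z: "z \<in> path_pairs G w h t 0"
  obtain u v where uv: "z = (u, v)" by (cases z)
  have "symp_E1_term G c (tens (basis u) (mulw p v)) = mulw p v \<cdot> arw G c \<cdot> basis u"
    by (cases p; cases v) (auto simp: symp_E1_term_def lin_zero[OF lin_lin_ext])
  then show "symp_E1_term G c (inner_l w (basis p) (basis z)) = basis p \<cdot> symp_E1_term G c (basis z)"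
    using p by (simp add: uv symp_E1_term_def flip: mul_assoc)
qed (intro lin_intros lin_symp_E1_term)+

lemma symp_E1_term_inner_r:
  assumes G: "wf_digraph G" and b: "b \<in> B_alg G w" and T: "T \<in> free_on (path_pairs G w h t 0)"
  shows "symp_E1_term G c (inner_r w T b) = symp_E1_term G c T \<cdot> b"
proof (rule lin_eqI2[of "\<lambda>b T. symp_E1_term G c (inner_r w T b)" "\<lambda>b T. symp_E1_term G c T \<cdot> b",
      OF _ _ _ _ _ b[unfolded B_alg_eq[OF G]] T])
  fix p z assume p: "p \<in> {p \<in> paths G. wt w p = 0}" and z: "z \<in> path_pairs G w h t 0"
  obtain u v where uv: "z = (u, v)" by (cases z)
  have "symp_E1_term G c (tens (mulw u p) (basis v)) = basis v \<cdot> arw G c \<cdot> mulw u p"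
    by (cases p; cases u) (auto simp: symp_E1_term_def lin_zero[OF lin_lin_ext])
  then show "symp_E1_term G c (inner_r w (basis z) (basis p)) = symp_E1_term G c (basis z) \<cdot> basis p"
    using p by (simp add: uv symp_E1_term_def mul_assoc)
qed (intro lin_intros lin_symp_E1_term)+

text \<open>The derivative along \<open>c\<close>, followed by a flip. An arrow of weight 1 occurs
  at most once in a path of weight 1, so \<open>q c p\<close> goes to \<open>p \<otimes> q\<close>,
  which inverts \<open>symp_E1_term\<close>.\<close>

definition E1_extract ::
  "('v, 'e) pre_digraph \<Rightarrow> ('e \<Rightarrow> nat) \<Rightarrow> 'e \<Rightarrow> ('v, 'e, 'k::field) form \<Rightarrow> ('v, 'e, 'k) form2" where
  "E1_extract G w c x = lin_ext (\<lambda>(v, u). basis (u, v))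
     (arrow_der G (path_coeff w 0)
       (\<lambda>a. if a = c then basis ((head G c, [], head G c), (tail G c, [], tail G c)) else 0) x)"

lemma lin_E1_extract: "lin f \<Longrightarrow> lin (\<lambda>x. E1_extract G w c (f x))"
  unfolding E1_extract_def by (intro lin_ext_comp lin_arrow_der)

lemma E1_extract_basis:
  fixes G :: "('v, 'e) pre_digraph"
  assumes G: "wf_digraph G" and c: "c \<in> arcs G" "w c = 1" and d: "d \<in> arcs G"
    and qp: "q \<in> paths G" "p \<in> paths G" "wt w q = 0" "wt w p = 0" "snd (snd q) = head G d" "fst p = tail G d"
  shows "E1_extract G w c (basis q \<cdot> arw G d \<cdot> basis p) = (if d = c then basis (p, q) else 0 :: ('v, 'e, 'k::field) form2)"
proof -
  define \<delta> :: "'e \<Rightarrow> ('v, 'e, 'k) form2" where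
    "\<delta> = (\<lambda>a. if a = c then basis ((head G c, [], head G c), (tail G c, [], tail G c)) else 0)"
  have "\<delta> d \<in> free_on (path_pairs G w (head G d) (tail G d) 0)"
    using c(1) G by (auto simp: \<delta>_def path_pairs_def paths_iff wf_digraph.head_in_verts wf_digraph.tail_in_verts)
  moreover have "\<delta> a = 0" if "w a = 0" for a
    using that c(2) by (auto simp: \<delta>_def)
  ultimately have "arrow_der G (path_coeff w 0) \<delta> (basis q \<cdot> arw G d \<cdot> basis p) =
      outer_l (basis q) (outer_r (\<delta> d) (basis p))"
    by (intro path_der_E_mod[where t = \<delta>, OF G _ _ qp(1-4)])
  then show ?thesis
    unfolding E1_extract_def \<delta>_def[symmetric]
    using qp by (cases q; cases p) (simp add: \<delta>_def lin_zero[OF lin_lin_ext])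
qed

lemma E1_extract_term:
  fixes T :: "('v, 'e, 'k::field) form2"
  assumes G: "wf_digraph G" and c: "c \<in> arcs G" "w c = 1" and d: "d \<in> arcs G"
    and T: "T \<in> free_on (path_pairs G w (tail G d) (head G d) 0)"
  shows "E1_extract G w c (symp_E1_term G d T) = (if d = c then T else 0)"
proof -
  have l: "lin (\<lambda>T :: ('v, 'e, 'k) form2. if d = c then T else 0)"
    by (cases "d = c") (simp_all add: lin_id lin_const_zero)
  show ?thesis
  proof (rule lin_eqI_on[OF T lin_E1_extract[OF lin_symp_E1_term[OF lin_id]] l])
    fix z assume z: "z \<in> path_pairs G w (tail G d) (head G d) 0"
    obtain u v where uv: "z = (u, v)" by (cases z)
    show "(E1_extract G w c (symp_E1_term G d (basis z)) :: ('v, 'e, 'k) form2) = (if d = c then basis z else 0)"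
      using z E1_extract_basis[where w = w and ?'k = 'k, OF G c d, of v u]
      by (simp add: uv symp_E1_term_def path_pairs_0)
  qed
qed

lemma E1_extract_path_pairs:
  fixes x :: "('v, 'e, 'k::field) form"
  assumes G: "wf_digraph G" and c: "c \<in> arcs G" "w c = 1" and x: "x \<in> E_mod G w 1"
  shows "E1_extract G w c x \<in> free_on (path_pairs G w (tail G c) (head G c) 0)"
proof (rule lin_mem_subspace[OF x[unfolded E_mod_1_eq[OF G]] lin_E1_extract[OF lin_id] subspace_free_on])
  fix r assume r: "r \<in> {p \<in> paths G. wt w p = 1}"
  obtain j xs i where eq: "r = (j, xs, i)" by (cases r)
  obtain us a vs where *: "xs = us @ Arr a # vs" "a \<in> arcs G" "w a = 1"
    "(j, us, head G a) \<in> paths G" "(tail G a, vs, i) \<in> paths G"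
    "wt w (j, us, head G a) = 0" "wt w (tail G a, vs, i) = 0"
    using r weight_one_path[OF G, of j xs i w] unfolding eq by blast
  have "(basis r :: ('v, 'e, 'k) form) = basis (j, us, head G a) \<cdot> arw G a \<cdot> basis (tail G a, vs, i)"
    by (simp add: eq *(1) arw_def)
  moreover have "E1_extract G w c (basis (j, us, head G a) \<cdot> arw G a \<cdot> basis (tail G a, vs, i)) =
      (if a = c then basis ((tail G a, vs, i), (j, us, head G a)) else 0 :: ('v, 'e, 'k) form2)"
    by (rule E1_extract_basis[where w = w, OF G c *(2,4-7)]) simp_all
  ultimately show "(E1_extract G w c (basis r) :: ('v, 'e, 'k) form2) \<in> free_on (path_pairs G w (tail G c) (head G c) 0)"
    using *(4-7) by (auto simp: path_pairs_0)
qed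

lemma E1_extract_expand:
  fixes x :: "('v, 'e, 'k::field) form"
  assumes G: "fin_digraph G" and x: "x \<in> E_mod G w 1"
  shows "(\<Sum>c\<in>{c \<in> arcs G. w c = 1}. symp_E1_term G c (E1_extract G w c x)) = x"
proof -
  interpret fin_digraph G by fact
  show ?thesis
  proof (rule E_mod_eqI[OF wf_digraph x, of "\<lambda>x. \<Sum>c\<in>{c \<in> arcs G. w c = 1}. symp_E1_term G c (E1_extract G w c x)"])
    fix q a p
    assume *: "q \<in> paths G" "p \<in> paths G" "a \<in> arcs G" "w a = 1" "wt w q = 0" "wt w p = 0"
      "snd (snd q) = head G a" "fst p = tail G a"
    have "symp_E1_term G c (E1_extract G w c (basis q \<cdot> arw G a \<cdot> basis p)) =
        (if a = c then basis q \<cdot> arw G a \<cdot> basis p else 0 :: ('v, 'e, 'k) form)"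
      if "c \<in> {c \<in> arcs G. w c = 1}" for c
      using that E1_extract_basis[where w = w and ?'k = 'k and c = c, OF wf_digraph _ _ *(3,1,2,5-8)]
      by (simp add: symp_E1_term_def lin_zero[OF lin_lin_ext])
    then have "(\<Sum>c\<in>{c \<in> arcs G. w c = 1}. symp_E1_term G c (E1_extract G w c (basis q \<cdot> arw G a \<cdot> basis p))) =
        (\<Sum>c\<in>{c \<in> arcs G. w c = 1}. if a = c then basis q \<cdot> arw G a \<cdot> basis p else 0 :: ('v, 'e, 'k) form)"
      by (rule sum.cong[OF refl])
    also have "\<dots> = basis q \<cdot> arw G a \<cdot> basis p"
      using *(3,4) by simp
    finally show "(\<Sum>c\<in>{c \<in> arcs G. w c = 1}. symp_E1_term G c (E1_extract G w c (basis q \<cdot> arw G a \<cdot> basis p))) =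
        (basis q \<cdot> arw G a \<cdot> basis p :: ('v, 'e, 'k) form)" .
  qed (intro lin_intros lin_symp_E1_term lin_E1_extract)+
qed

lemma dual_arrow_eq:
  fixes G :: "('v, 'e) pre_digraph"
  assumes G: "wf_digraph G" and a: "a \<in> arcs G" "w a = 1"
  shows "(dual_arrow G w a :: ('v, 'e, 'k::field) form \<Rightarrow> ('v, 'e, 'k) form2) \<in> E1_dual G w"
    and "b \<in> arcs G \<Longrightarrow> w b = 1 \<Longrightarrow> dual_arrow G w a (arw G b) =
      (if b = a then tens (idem (head G a)) (idem (tail G a)) else 0 :: ('v, 'e, 'k) form2)"
proof -
  let ?\<delta> = "\<lambda>b. if b = a then tens (idem (head G a)) (idem (tail G a)) else 0 :: ('v, 'e, 'k) form2"
  have \<delta>: "?\<delta> b \<in> free_on (path_pairs G w (head G b) (tail G b) 0)" for b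
    using a(1) G by (auto simp: idem_def path_pairs_def paths_iff wf_digraph.head_in_verts wf_digraph.tail_in_verts)
  let ?f = "E1_dual_of G w ?\<delta>"
  have f: "?f \<in> E1_dual G w" by (rule E1_dual_of_E1_dual[where t = ?\<delta>, OF G \<delta>])
  have fb: "?f (arw G b) = ?\<delta> b" if "b \<in> arcs G" "w b = 1" for b
    by (rule E1_dual_of_arw[where t = ?\<delta>, OF G that \<delta>])
  have "dual_arrow G w a = ?f"
    unfolding dual_arrow_def
  proof (rule the_equality)
    show "?f \<in> E1_dual G w \<and> (\<forall>b\<in>arcs G. w b = 1 \<longrightarrow> ?f (arw G b) = ?\<delta> b)"
      using f fb by blast
    fix g :: "('v, 'e, 'k) form \<Rightarrow> ('v, 'e, 'k) form2"
    assume g: "g \<in> E1_dual G w \<and> (\<forall>b\<in>arcs G. w b = 1 \<longrightarrow> g (arw G b) = ?\<delta> b)"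
    show "g = ?f"
      by (rule E1_dual_eqI[OF G conjunct1[OF g] f]) (simp only: g fb)
  qed
  then show "(dual_arrow G w a :: ('v, 'e, 'k) form \<Rightarrow> ('v, 'e, 'k) form2) \<in> E1_dual G w"
    and "b \<in> arcs G \<Longrightarrow> w b = 1 \<Longrightarrow> dual_arrow G w a (arw G b) = ?\<delta> b"
    using f fb by (simp_all only:)
qed

text \<open>Additivity follows by applying \<open>g\<close> to
  \<open>f (g y + g y') = y + y'\<close>, and the actions are treated in the same way; the closure
  conditions on \<open>M\<close> ensure that \<open>g\<close> inverts \<open>f\<close> at these
  elements.\<close>

lemma bimodule_iso_inverse:
  assumes f: "bimodule_iso B M lM rM N lN rN f"
    and g: "\<And>y. y \<in> N \<Longrightarrow> g y \<in> M" "\<And>y. y \<in> N \<Longrightarrow> f (g y) = y" "\<And>x. x \<in> M \<Longrightarrow> g (f x) = x"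
    and M: "\<And>x x'. x \<in> M \<Longrightarrow> x' \<in> M \<Longrightarrow> x + x' \<in> M"
      "\<And>b x. b \<in> B \<Longrightarrow> x \<in> M \<Longrightarrow> lM b x \<in> M" "\<And>b x. b \<in> B \<Longrightarrow> x \<in> M \<Longrightarrow> rM x b \<in> M"
  shows "bimodule_iso B N lN rN M lM rM g"
proof -
  have fN: "f x \<in> N" if "x \<in> M" for x
    using f that by (auto simp: bimodule_iso_def bij_betw_def)
  have "bij_betw g N M"
    by (rule bij_betw_byWitness[where f' = f]) (use g fN in auto)
  moreover have "g (y + y') = g y + g y'" if "y \<in> N" "y' \<in> N" for y y'
    using g(3)[OF M(1)[OF g(1)[OF that(1)] g(1)[OF that(2)]]] f g that by (simp add: bimodule_iso_def)
  moreover have "g (lN b y) = lM b (g y)" "g (rN y b) = rM (g y) b" if "b \<in> B" "y \<in> N" for b y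
    using g(3)[OF M(2)[OF that(1) g(1)[OF that(2)]]] g(3)[OF M(3)[OF that(1) g(1)[OF that(2)]]] f g that
    by (simp_all add: bimodule_iso_def)
  ultimately show ?thesis by (simp add: bimodule_iso_def)
qed

theorem theorem5p6:
  fixes P :: "('v, 'e) pre_digraph" and wP :: "'e \<Rightarrow> nat"
    and Q :: "('v, 'e dbl) pre_digraph" and w :: "'e dbl \<Rightarrow> nat"
    and \<omega> :: "('v, 'e dbl, 'k::field_char_0) form set"
  assumes "fin_digraph P" and "\<forall>a\<in>arcs P. wP a \<le> 2"
    and "Q = double_quiver P" and "w = double_weight 2 wP" and "\<omega> = canonical_form P 2 wP"
  shows "bi_symplectic Q w 2 \<omega> \<and>
    bimodule_iso (B_alg Q w) (E1_dual Q w) (E1_dual_l w) (E1_dual_r w)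
      (E_mod Q w 1) (\<cdot>) (\<cdot>) (iota1 Q w \<omega>) \<and>
    (\<forall>a\<in>arcs Q. w a = 1 \<longrightarrow>
       iota1 Q w \<omega> (dual_arrow Q w a) = scal (eps w a) (arw Q (star a))) \<and>
    (\<exists>flat. bimodule_iso (B_alg Q w) (E_mod Q w 1) (\<cdot>) (\<cdot>)
           (E1_dual Q w) (E1_dual_l w) (E1_dual_r w) flat \<and>
         (\<forall>f\<in>E1_dual Q w. flat (iota1 Q w \<omega> f) = f) \<and>
         (\<forall>x\<in>E_mod Q w 1. iota1 Q w \<omega> (flat x) = x) \<and>
         (\<forall>a\<in>arcs Q. w a = 1 \<longrightarrow>
            flat (arw Q a) = (\<lambda>x. scal (eps w a) (dual_arrow Q w (star a) x))))"
proof -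
  note P = assms(1)
  have wN: "\<forall>a\<in>arcs P. w (Fwd a) + w (Rev a) = 2"
    using assms(2,4) by (auto simp: double_weight_def)
  have \<omega>: "\<omega> = dr_class (double_quiver P) w (symp_form P)"
    by (simp add: assms canonical_form_def symp_form_def Let_def)
  have Q: "fin_digraph Q" unfolding assms(3) by (rule fin_double_quiver[OF P])
  interpret Q: fin_digraph Q by (rule Q)
  have star: "star (star c) = c" "star c \<in> arcs Q \<longleftrightarrow> c \<in> arcs Q"
    "head Q (star c) = tail Q c" "tail Q (star c) = head Q c"
    "c \<in> arcs Q \<Longrightarrow> w (star c) = 1 \<longleftrightarrow> w c = 1" for c
    using weight_star[OF wN] by (simp_all add: assms(3))
  have iota: "iota1 Q w \<omega> f = (\<Sum>c\<in>{c \<in> arcs Q. w c = 1}. symp_E1_term Q c (f (arw Q (star c))))"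
    if "f \<in> E1_dual Q w" for f
    unfolding \<omega> assms(3)[symmetric] by (rule iota1_eq[OF P wN, folded assms(3), OF that])
  have dual: "f (arw Q (star c)) \<in> free_on (path_pairs Q w (tail Q c) (head Q c) 0)"
    if "f \<in> E1_dual Q w" "c \<in> {c \<in> arcs Q. w c = 1}" for f :: "('v, 'e dbl, 'k) form \<Rightarrow> ('v, 'e dbl, 'k) form2" and c
    using E1_dual_arw[OF Q.wf_digraph that(1), of "star c"] that(2) by (simp add: star)
  \<comment> \<open>The value of a dual element on \<open>star c\<close> is the coefficient of
    \<open>c\<close> in its image. Hence the inverse must take on \<open>b\<close> the coefficient
    of \<open>star b\<close>.\<close>
  define flat :: "('v, 'e dbl, 'k) form \<Rightarrow> (('v, 'e dbl, 'k) form \<Rightarrow> ('v, 'e dbl, 'k) form2)" where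
    "flat = (\<lambda>x. E1_dual_of Q w (\<lambda>b. E1_extract Q w (star b) x))"
  have ext: "E1_extract Q w (star b) x \<in> free_on (path_pairs Q w (head Q b) (tail Q b) 0)"
    if "x \<in> E_mod Q w 1" "b \<in> arcs Q" "w b = 1" for x :: "('v, 'e dbl, 'k) form" and b
    using E1_extract_path_pairs[OF Q.wf_digraph _ _ that(1), of "star b"] that(2,3) by (simp add: star)
  have flat: "flat x \<in> E1_dual Q w" if "x \<in> E_mod Q w 1" for x
    unfolding flat_def by (rule E1_dual_of_E1_dual[OF Q.wf_digraph ext[OF that]])
  have flat_arw: "flat x (arw Q b) = E1_extract Q w (star b) x"
    if "x \<in> E_mod Q w 1" "b \<in> arcs Q" "w b = 1" for x b
    unfolding flat_def
    by (rule E1_dual_of_arw[where t = "\<lambda>b. E1_extract Q w (star b) x", OF Q.wf_digraph that(2,3) ext[OF that]])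
  have iota_flat: "iota1 Q w \<omega> (flat x) = x" if x: "x \<in> E_mod Q w 1" for x
  proof -
    have "iota1 Q w \<omega> (flat x) = (\<Sum>c\<in>{c \<in> arcs Q. w c = 1}. symp_E1_term Q c (E1_extract Q w c x))"
      unfolding iota[OF flat[OF x]] by (rule sum.cong) (simp_all add: flat_arw[OF x] star)
    then show ?thesis by (simp add: E1_extract_expand[OF Q x])
  qed
  have iota_mem: "iota1 Q w \<omega> f \<in> E_mod Q w 1" if f: "f \<in> E1_dual Q w" for f
    unfolding iota[OF f]
  proof (rule scal.subspace_sum)
    show sub: "scal.subspace (E_mod Q w 1)" by (simp add: E_mod_def)
    fix c assume c: "c \<in> {c \<in> arcs Q. w c = 1}"
    show "symp_E1_term Q c (f (arw Q (star c))) \<in> E_mod Q w 1"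
    proof (rule lin_mem_subspace[OF dual[OF f c] lin_symp_E1_term[OF lin_id] sub])
      fix z assume z: "z \<in> path_pairs Q w (tail Q c) (head Q c) 0"
      obtain u v where uv: "z = (u, v)" by (cases z)
      have "basis u \<in> (B_alg Q w :: ('v, 'e dbl, 'k) form set)" "basis v \<in> (B_alg Q w :: ('v, 'e dbl, 'k) form set)"
        using z by (simp_all add: uv path_pairs_0 B_alg_eq[OF Q.wf_digraph])
      then show "(symp_E1_term Q c (basis z) :: ('v, 'e dbl, 'k) form) \<in> E_mod Q w 1"
        using c by (simp add: uv symp_E1_term_def E_mod_mul_B[OF Q.wf_digraph] arw_E_mod[where w = w, OF Q.wf_digraph])
    qed
  qed
  have flat_iota: "flat (iota1 Q w \<omega> f) = f" if f: "f \<in> E1_dual Q w" for f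
  proof (rule E1_dual_eqI[OF Q.wf_digraph flat[OF iota_mem[OF f]] f])
    fix a assume a: "a \<in> arcs Q" "w a = 1"
    have "flat (iota1 Q w \<omega> f) (arw Q a) =
        (\<Sum>c\<in>{c \<in> arcs Q. w c = 1}. E1_extract Q w (star a) (symp_E1_term Q c (f (arw Q (star c)))))"
      by (subst flat_arw[OF iota_mem[OF f] a], subst iota[OF f], rule lin_sum[OF lin_E1_extract[OF lin_id]])
    also have "\<dots> = (\<Sum>c\<in>{c \<in> arcs Q. w c = 1}. if c = star a then f (arw Q (star c)) else 0)"
      using a by (intro sum.cong refl E1_extract_term[OF Q.wf_digraph _ _ _ dual[OF f]]) (auto simp: star)
    also have "\<dots> = f (arw Q a)" using a by (simp add: star)
    finally show "flat (iota1 Q w \<omega> f) (arw Q a) = f (arw Q a)" .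
  qed
  have iso: "bimodule_iso (B_alg Q w) (E1_dual Q w) (E1_dual_l w) (E1_dual_r w)
      (E_mod Q w 1) (\<cdot>) (\<cdot>) (iota1 Q w \<omega>)"
    unfolding bimodule_iso_def
  proof (intro conjI ballI)
    show "bij_betw (iota1 Q w \<omega>) (E1_dual Q w) (E_mod Q w 1)"
      by (rule bij_betw_byWitness[where f' = flat]) (use flat iota_mem iota_flat flat_iota in auto)
    show "iota1 Q w \<omega> (f + f') = iota1 Q w \<omega> f + iota1 Q w \<omega> f'" if "f \<in> E1_dual Q w" "f' \<in> E1_dual Q w" for f f'
      by (simp add: iota that E1_dual_add lin_add[OF lin_symp_E1_term[OF lin_id]] sum.distrib)
    fix b :: "('v, 'e dbl, 'k) form" and f :: "('v, 'e dbl, 'k) form \<Rightarrow> ('v, 'e dbl, 'k) form2"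
    assume b: "b \<in> B_alg Q w" and f: "f \<in> E1_dual Q w"
    show "iota1 Q w \<omega> (E1_dual_l w b f) = b \<cdot> iota1 Q w \<omega> f"
      unfolding iota[OF f] iota[OF E1_dual_l_closed[OF Q.wf_digraph b f]] lin_sum[OF lin_mul_right[OF lin_id]]
      by (intro sum.cong refl) (simp only: E1_dual_l_def symp_E1_term_inner_l[OF Q.wf_digraph b dual[OF f]])
    show "iota1 Q w \<omega> (E1_dual_r w f b) = iota1 Q w \<omega> f \<cdot> b"
      unfolding iota[OF f] iota[OF E1_dual_r_closed[OF Q.wf_digraph b f]] lin_sum[OF lin_mul_left[OF lin_id]]
      by (intro sum.cong refl) (simp only: E1_dual_r_def symp_E1_term_inner_r[OF Q.wf_digraph b dual[OF f]])
  qed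
  \<comment> \<open>The partner of an arrow of weight 1 has weight 1 as well, so for a reverse arrow
    the value is \<open>- ksign 1 = 1\<close>.\<close>
  have eps: "eps w a = (1 :: 'k)" if "a \<in> arcs Q" "w a = 1" for a
    using that star(5)[of a] by (cases a) (auto simp: ksign_def)
  have iota_dual: "iota1 Q w \<omega> (dual_arrow Q w a) = arw Q (star a)" if a: "a \<in> arcs Q" "w a = 1" for a
  proof -
    have "iota1 Q w \<omega> (dual_arrow Q w a) = (\<Sum>c\<in>{c \<in> arcs Q. w c = 1}.
        if c = star a then symp_E1_term Q c (tens (idem (head Q a)) (idem (tail Q a))) else 0)"
      unfolding iota[OF dual_arrow_eq(1)[where w = w, OF Q.wf_digraph a]]
    proof (intro sum.cong refl)
      fix c assume c: "c \<in> {c \<in> arcs Q. w c = 1}"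
      have "star c = a \<longleftrightarrow> c = star a" by (cases c; cases a) auto
      then show "symp_E1_term Q c (dual_arrow Q w a (arw Q (star c))) =
          (if c = star a then symp_E1_term Q c (tens (idem (head Q a)) (idem (tail Q a))) else 0 :: ('v, 'e dbl, 'k) form)"
        using c by (simp add: dual_arrow_eq(2)[where w = w, OF Q.wf_digraph a] star lin_zero[OF lin_symp_E1_term[OF lin_id]])
    qed
    also have "\<dots> = arw Q (star a)"
      using a by (simp add: star symp_E1_term_def idem_def arw_def)
    finally show ?thesis .
  qed
  have "bimodule_iso (B_alg Q w) (E_mod Q w 1) (\<cdot>) (\<cdot>) (E1_dual Q w) (E1_dual_l w) (E1_dual_r w) flat"
    by (rule bimodule_iso_inverse[OF iso])
      (auto simp: flat iota_flat flat_iota E1_dual_add E1_dual_l_closed[OF Q.wf_digraph] E1_dual_r_closed[OF Q.wf_digraph])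
  moreover have "flat (arw Q a) = (\<lambda>x. scal (eps w a) (dual_arrow Q w (star a) x))" if a: "a \<in> arcs Q" "w a = 1" for a
  proof -
    have a': "star a \<in> arcs Q" "w (star a) = 1" using a by (simp_all add: star)
    \<comment> \<open>Since \<open>star\<close> is an involution and the sign is 1, the arrow
      \<open>a\<close> is the image of the dual of \<open>star a\<close>.\<close>
    have "flat (arw Q a) = flat (iota1 Q w \<omega> (dual_arrow Q w (star a)))"
      by (simp add: iota_dual[OF a'] star)
    also have "\<dots> = dual_arrow Q w (star a)"
      by (rule flat_iota[OF dual_arrow_eq(1)[where w = w, OF Q.wf_digraph a']])
    finally show ?thesis by (simp add: eps a)
  qed
  moreover have "bi_symplectic Q w 2 \<omega>"
    unfolding \<omega> assms(3) by (rule symp_form_bi_symplectic[OF P wN])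
  ultimately show ?thesis
    using iso iota_dual eps iota_flat flat_iota by auto
qed

end
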